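(* Let $\delta\in(0,\frac18)$. There exists a constant $C>0$ such that the following holds for all $1\le M\le N$, all $a\in\mathbb{R}^2$ with $|a|=1$, all $c\in\mathbb{R}$ and all $\xi^0\in\mathbb{R}\times\mathbb{Z}$ (that is, $C$ is uniform in $a,c,\xi^0,M,N$). Define $$\mathcal{R}=\{\xi=(\xi_1,\xi_2)\in \mathbb{R}\times \mathbb{Z} : |\xi-\xi^0|\le N,\ |a\cdot \xi-c|\le M\}.$$ Assume that $\phi\in L^2(\mathbb{R}\times\mathbb{T})$ and $\mathrm{supp}(\widehat{\phi})\subset\mathcal{R}$. Then $$\left\|\varphi(t)\int_{\mathbb{R}\times\mathbb{Z}} e^{ix_1\cdot\xi_1-it|\xi|^2}\,\widehat{\phi}(\xi)\,d\xi\right\|_{L^4_{t,x_1}(\mathbb{R}\times\mathbb{R})}\leq C\left(\frac{M}{N}\right)^{\delta}N^{\frac14}\,\|\phi\|_{L^2(\mathbb{R}\times\mathbb{T})}.$$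
   Context: $\mathbb{T}=\mathbb{R}/2\pi\mathbb{Z}$. For $\phi$ on $\mathbb{R}_{x_1}\times\mathbb{T}_{x_2}$ the Fourier transform is $\widehat{\phi}(\xi_1,\xi_2)=\frac{1}{4\pi^2}\int_0^{2\pi}\int_{\mathbb{R}}\phi(x_1,x_2)e^{-i(\xi_1x_1+\xi_2x_2)}\,dx_1\,dx_2$ for $(\xi_1,\xi_2)\in\mathbb{R}\times\mathbb{Z}$. The measure $d\xi$ on $\mathbb{R}\times\mathbb{Z}$ is the product of Lebesgue measure on $\mathbb{R}$ and counting measure on $\mathbb{Z}$, and $|\xi|^2=\xi_1^2+\xi_2^2$. Throughout, $\varphi\in\mathcal{S}(\mathbb{R})$ is a fixed Schwartz function such that: (1) $\widehat{\varphi}(\tau)\geq0$ for all $\tau\in\mathbb{R}$; (2) $\mathrm{supp}\,\widehat{\varphi}\subset[-1,1]$; (3) $\varphi(t)\geq0$ for all $t\in\mathbb{R}$ and $\varphi(t)\geq1$ for $t\in[0,1]$; here $\widehat{\varphi}(\tau)=\frac{1}{2\pi}\int_{\mathbb{R}}\varphi(t)e^{-i\tau t}\,dt$. *)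

theory Defs
  imports "HOL-Analysis.Analysis"
begin

text \<open>Bochner integrals of non-integrable functions are 0, so \<open>Lp_norm\<close> is meaningful only
  together with \<open>in_Lp\<close>.\<close>

definition in_Lp :: "real \<Rightarrow> 'a measure \<Rightarrow> ('a \<Rightarrow> complex) \<Rightarrow> bool" where
  "in_Lp p M f \<longleftrightarrow> f \<in> borel_measurable M \<and> integrable M (\<lambda>x. norm (f x) powr p)"

definition Lp_norm :: "real \<Rightarrow> 'a measure \<Rightarrow> ('a \<Rightarrow> complex) \<Rightarrow> real" where
  "Lp_norm p M f = (LINT x|M. norm (f x) powr p) powr (1 / p)"

text \<open>The support of a function defined up to null sets. On a second countable space it is the
  complement of the largest open set on which the function vanishes almost everywhere.\<close>

definition ess_supp :: "'a::topological_space measure \<Rightarrow> ('a \<Rightarrow> complex) \<Rightarrow> 'a set" where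
  "ess_supp M f = {x. \<forall>U. open U \<and> x \<in> U \<longrightarrow> \<not> (AE y in M. y \<in> U \<longrightarrow> f y = 0)}"

definition schwartz :: "(real \<Rightarrow> real) \<Rightarrow> bool" where
  "schwartz f \<longleftrightarrow>
     (\<forall>n x. (deriv ^^ n) f differentiable (at x)) \<and>
     (\<forall>k n. bounded (range (\<lambda>x. x ^ k * (deriv ^^ n) f x)))"

definition fourier_real :: "(real \<Rightarrow> real) \<Rightarrow> real \<Rightarrow> complex" where
  "fourier_real f \<tau> =
     1 / (2 * pi) * (LINT t|lborel. of_real (f t) * exp (- (\<i> * of_real (\<tau> * t))))"

text \<open>Functions on \<open>\<real> \<times> \<real>/2\<pi>\<int>\<close> are functions on the plane that are \<open>2\<pi>\<close>-periodic
  in the second variable; they are integrated over one period.\<close>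

definition cyl_measure :: "(real \<times> real) measure" where
  "cyl_measure = lborel \<Otimes>\<^sub>M restrict_space lborel {0..<2 * pi}"

definition cyl_periodic :: "(real \<times> real \<Rightarrow> complex) \<Rightarrow> bool" where
  "cyl_periodic f \<longleftrightarrow> (\<forall>x1 x2. f (x1, x2 + 2 * pi) = f (x1, x2))"

definition in_Lp_cyl :: "real \<Rightarrow> (real \<times> real \<Rightarrow> complex) \<Rightarrow> bool" where
  "in_Lp_cyl p f \<longleftrightarrow> cyl_periodic f \<and> in_Lp p cyl_measure f"

definition freq_measure :: "(real \<times> int) measure" where
  "freq_measure = lborel \<Otimes>\<^sub>M count_space UNIV"

definition freq_vec :: "real \<times> int \<Rightarrow> real \<times> real" where
  "freq_vec \<xi> = (fst \<xi>, of_int (snd \<xi>))"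

definition fourier_cyl :: "(real \<times> real \<Rightarrow> complex) \<Rightarrow> real \<times> int \<Rightarrow> complex" where
  "fourier_cyl f \<xi> =
     1 / (4 * pi\<^sup>2) *
       (LINT x2:{0..2 * pi}|lborel. LINT x1|lborel.
          f (x1, x2) * exp (- (\<i> * of_real (freq_vec \<xi> \<bullet> (x1, x2)))))"

text \<open>For a general \<open>L\<^sup>2\<close> function the integral above need not converge, and the Fourier transform
  is its continuous extension from \<open>L\<^sup>1 \<inter> L\<^sup>2\<close> to \<open>L\<^sup>2\<close>. It is determined only almost everywhere, so
  it is rendered as a relation: \<open>g\<close> is a representative of the transform of \<open>f\<close>. By Plancherel,
  the transforms of the approximants lie in \<open>L\<^sup>2\<close> automatically; the condition is stated so that
  the last norm is meaningful.\<close>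

definition is_fourier_L2 :: "(real \<times> real \<Rightarrow> complex) \<Rightarrow> (real \<times> int \<Rightarrow> complex) \<Rightarrow> bool" where
  "is_fourier_L2 f g \<longleftrightarrow>
     in_Lp_cyl 2 f \<and> in_Lp 2 freq_measure g \<and>
     (\<exists>F. (\<forall>n::nat. in_Lp_cyl 1 (F n) \<and> in_Lp_cyl 2 (F n) \<and>
                    in_Lp 2 freq_measure (fourier_cyl (F n))) \<and>
          (\<lambda>n. Lp_norm 2 cyl_measure (\<lambda>x. F n x - f x)) \<longlonglongrightarrow> 0 \<and>
          (\<lambda>n. Lp_norm 2 freq_measure (\<lambda>\<xi>. fourier_cyl (F n) \<xi> - g \<xi>)) \<longlonglongrightarrow> 0)"

definition freq_region ::
    "real \<Rightarrow> real \<Rightarrow> real \<times> real \<Rightarrow> real \<Rightarrow> real \<times> int \<Rightarrow> (real \<times> int) set" where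
  "freq_region M N a c \<xi>0 =
     {\<xi>. norm (freq_vec \<xi> - freq_vec \<xi>0) \<le> N \<and> \<bar>a \<bullet> freq_vec \<xi> - c\<bar> \<le> M}"

definition extension_op :: "(real \<times> int \<Rightarrow> complex) \<Rightarrow> real \<Rightarrow> real \<Rightarrow> complex" where
  "extension_op g t x1 =
     (LINT \<xi>|freq_measure.
        exp (\<i> * of_real (x1 * fst \<xi>) - \<i> * of_real (t * (norm (freq_vec \<xi>))\<^sup>2)) * g \<xi>)"

end

theory Submission
  imports Defs "HOL-Probability.Probability"
begin

text \<open>The square of the extension is an integral over pairs of frequencies \<open>(\<xi>, \<zeta>)\<close>,
with the phase \<open>x\<^sub>1 (\<xi>\<^sub>1 + \<zeta>\<^sub>1) - t (|\<xi>|\<^sup>2 + |\<zeta>|\<^sup>2)\<close>. So its fourth moment in \<open>(t, x\<^sub>1)\<close> is the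
second moment of another extension operator, which a Schur test controls
(\<open>schur_extension_bound\<close>). Only pairs with the same \<open>\<eta> = \<xi>\<^sub>1 + \<zeta>\<^sub>1\<close> and with nearby values of
\<open>|\<xi>|\<^sup>2 + |\<zeta>|\<^sup>2\<close> interact, and the fourth power of the norm is at most a constant times
\<open>K \<parallel>f\<parallel>\<^sup>4\<close>, where \<open>K\<close> bounds, uniformly in \<open>\<eta>\<close> and \<open>W\<close>, the measure of the pairs in the region
with sum \<open>\<eta>\<close> of the first coordinates and \<open>W \<le> |\<xi>|\<^sup>2 + |\<zeta>|\<^sup>2 \<le> W + 1\<close>. The weight in time that
makes this work is a Gaussian; the fourth power of the given cut-off is dominated by a summable
superposition of its integer translates.

The theorem therefore reduces to the count \<open>K \<le> C N (M/N)\<^bsup>4\<delta>\<^esup>\<close> (\<open>freq_region_pair_count\<close>).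
Let \<open>m, n\<close> be the integer coordinates of the pair and put \<open>p = m + n\<close>, \<open>q = m - n\<close>,
\<open>u = \<xi>\<^sub>1 - \<zeta>\<^sub>1\<close>. Then \<open>2 (|\<xi>|\<^sup>2 + |\<zeta>|\<^sup>2) = \<eta>\<^sup>2 + p\<^sup>2 + q\<^sup>2 + u\<^sup>2\<close>, so \<open>K\<close> measures a thin spherical
shell with two integer coordinates and one real coordinate. For a fixed \<open>p\<close> the shell has bounded
measure (\<open>circle_shell_le\<close>). Adding and subtracting the two strip conditions gives
\<open>|a\<^sub>1 \<eta> + a\<^sub>2 p - 2 c| \<le> 2 M\<close> and \<open>|a\<^sub>1 u + a\<^sub>2 q| \<le> 2 M\<close>.

\<^item> If \<open>|a\<^sub>2| \<ge> (M/N)\<^bsup>1/2\<^esup>\<close>, the first condition leaves \<open>O((MN)\<^bsup>1/2\<^esup>)\<close> values of \<open>p\<close>.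
\<^item> Otherwise \<open>|a\<^sub>1|\<close> is bounded below, except in the trivial case that \<open>M\<close> is comparable to \<open>N\<close>, and
  the second condition gives \<open>|u| = O((MN)\<^bsup>1/2\<^esup>)\<close>. Where \<open>|u| \<ge> N\<^bsup>1/2\<^esup>\<close>, the shell has length
  \<open>O(1/|u|)\<close> over each \<open>(p, q)\<close>, and these lengths are summed by comparison with an integral.
  For \<open>|u| \<le> N\<^bsup>1/2\<^esup>\<close> one fixes \<open>u\<close> and counts lattice points \<open>(p, q)\<close> on a circle inside a box of side \<open>N\<close>: there are \<open>O(N\<^bsup>\<epsilon>\<^esup>)\<close> of them, whatever the radius
  (\<open>card_circle_points_box_le\<close>).

Altogether \<open>K = O((MN)\<^bsup>1/2\<^esup> + N\<^bsup>1/2 + \<epsilon>\<^esup>)\<close>. Since \<open>1 \<le> M \<le> N\<close>, this is at most a constant times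
\<open>N (M/N)\<^bsup>4\<delta>\<^esup>\<close> for \<open>\<epsilon> = 1/2 - 4\<delta>\<close>, which is positive exactly when \<open>\<delta> < 1/8\<close>.

The norm of the transform is replaced by that of the function itself through a Plancherel
inequality (\<open>fourier_L2_norm_le\<close>), which is another instance of the same Schur test, with the
Gaussian kernel in the first variable and the Fejer kernel in the periodic one.\<close>

section \<open>The divisor function\<close>

definition num_divisors :: "nat \<Rightarrow> nat" where
  "num_divisors n = card {d. d dvd n}"

lemma num_divisors_mono_dvd:
  assumes "m dvd n" "n > 0"
  shows "num_divisors m \<le> num_divisors n"
  unfolding num_divisors_def
  by (rule card_mono) (use assms in \<open>auto intro: finite_divisors_nat dvd_trans\<close>)

text \<open>A divisor of a product splits into divisors of the factors. The prime may also divide \<open>m\<close>, so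
this is only an inequality.\<close>

lemma num_divisors_prime_power_mult_le:
  assumes p: "prime p" and m: "m > 0"
  shows "num_divisors (p ^ k * m) \<le> (k + 1) * num_divisors m"
proof -
  have "{d. d dvd p ^ k * m} \<subseteq> (\<lambda>(i, e). p ^ i * e) ` ({..k} \<times> {e. e dvd m})"
  proof
    fix d assume "d \<in> {d. d dvd p ^ k * m}"
    then obtain a e where ae: "d = a * e" "a dvd p ^ k" "e dvd m"
      using division_decomp[of d "p ^ k" m] by auto
    then obtain i where "i \<le> k" "a = p ^ i"
      using divides_primepow_nat[OF p] by blast
    with ae show "d \<in> (\<lambda>(i, e). p ^ i * e) ` ({..k} \<times> {e. e dvd m})" by force
  qed
  then have "num_divisors (p ^ k * m) \<le> card ((\<lambda>(i, e). p ^ i * e) ` ({..k} \<times> {e. e dvd m}))"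
    unfolding num_divisors_def by (intro card_mono) (use m in auto)
  also have "\<dots> \<le> card ({..k} \<times> {e. e dvd m})"
    by (rule card_image_le) (use m in auto)
  finally show ?thesis by (simp add: num_divisors_def card_cartesian_product)
qed

text \<open>When \<open>p \<ge> 2\<^bsup>1/\<epsilon>\<^esup>\<close>, the power \<open>p\<^bsup>\<epsilon>\<^esup>\<close> is at least \<open>2\<close>, and \<open>k + 1 \<le> 2\<^sup>k\<close>: large primes cost
nothing in the divisor bound.\<close>

lemma Suc_le_powr_of_large_base:
  fixes \<epsilon> :: real
  assumes "\<epsilon> > 0" "p \<ge> 2 powr (1 / \<epsilon>)"
  shows "real k + 1 \<le> (p ^ k) powr \<epsilon>"
proof -
  have "real k + 1 \<le> 2 ^ k"
    by (induction k) auto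
  also have "\<dots> = (2 powr (1 / \<epsilon>)) powr (\<epsilon> * k)"
    using assms by (simp add: powr_powr powr_realpow)
  also have "\<dots> \<le> p powr (\<epsilon> * k)"
    using assms by (intro powr_mono2) auto
  also have "\<dots> = (p ^ k) powr \<epsilon>"
  proof -
    have "0 < (2::real) powr (1 / \<epsilon>)" by simp
    then have "0 < p" using assms(2) by linarith
    then show ?thesis by (simp add: powr_powr flip: powr_realpow) (simp add: mult.commute)
  qed
  finally show ?thesis .
qed

text \<open>For a small prime a constant is lost, but the same one for all exponents \<open>k\<close>.\<close>

lemma Suc_le_const_powr:
  fixes \<epsilon> :: real
  assumes "\<epsilon> > 0" "p \<ge> (2::real)"
  shows "real k + 1 \<le> (1 + 2 / \<epsilon>) * (p ^ k) powr \<epsilon>"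
proof -
  have "1 + real k * (\<epsilon> * ln 2) \<le> exp (real k * (\<epsilon> * ln 2))"
    by (rule exp_ge_add_one_self)
  also have "\<dots> = (2 ^ k) powr \<epsilon>"
    by (simp add: powr_def ln_realpow)
  also have "\<dots> \<le> (p ^ k) powr \<epsilon>"
    using assms by (intro powr_mono2 power_mono) auto
  finally have *: "1 + real k * (\<epsilon> * ln 2) \<le> (p ^ k) powr \<epsilon>" .
  have "ln 2 \<ge> (1/2::real)" using ln_2_less_1 ln2_ge_two_thirds by simp
  then have "real k \<le> real k * (2 * ln 2)"
    using mult_left_mono[of 1 "2 * ln 2" "real k"] by simp
  then have "real k + 1 \<le> 1 + real k * \<epsilon> * ln 2 + 2 / \<epsilon> + real k * (2 * ln 2)"
    using assms by (simp add: add_increasing)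
  also have "\<dots> = (1 + 2 / \<epsilon>) * (1 + real k * (\<epsilon> * ln 2))"
    using assms by (simp add: field_simps)
  also have "\<dots> \<le> (1 + 2 / \<epsilon>) * (p ^ k) powr \<epsilon>"
    using assms * by (intro mult_left_mono) auto
  finally show ?thesis .
qed

text \<open>The prime powers are stripped off one at a time. A factor is lost only for primes below
\<open>2\<^bsup>1/\<epsilon>\<^esup>\<close>, and there are boundedly many of these, however large \<open>n\<close> is.\<close>

lemma num_divisors_le_small_primes:
  fixes \<epsilon> :: real
  assumes "\<epsilon> > 0" "n > 0"
  shows "real (num_divisors n)
    \<le> (1 + 2 / \<epsilon>) ^ card {p. prime p \<and> p dvd n \<and> real p < 2 powr (1 / \<epsilon>)} * real n powr \<epsilon>"
  using \<open>n > 0\<close>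
proof (induction n rule: less_induct)
  case (less n)
  let ?S = "\<lambda>n. {p. prime p \<and> p dvd n \<and> real p < 2 powr (1 / \<epsilon>)}"
  show ?case
  proof (cases "n = 1")
    case True
    have "{d::nat. d dvd 1} = {1}" by auto
    with True assms show ?thesis by (simp add: num_divisors_def)
  next
    case False
    then obtain p where p: "prime p" "p dvd n"
      using prime_factor_nat by blast
    obtain m where m: "n = p ^ multiplicity p n * m" "\<not> p dvd m"
      using multiplicity_decompose'[of n p] less.prems p by (metis not_prime_unit gr_implies_not0)
    define k where "k = multiplicity p n"
    have k: "k > 0" unfolding k_def using p less.prems
      by (simp add: prime_multiplicity_gt_zero_iff)
    have n: "n = p ^ k * m" using m k_def by simp
    have m0: "m > 0" using n less.prems by (cases m) auto
    have p2: "p \<ge> 2" using p prime_ge_2_nat by blast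
    have "p ^ k > 1" using k p2 by (intro one_less_power) auto
    then have "m < n" using n m0 by simp
    note IH = less.IH[OF this m0]
    have fin: "finite (?S n)" 
      by (rule finite_subset[OF _ finite_divisors_nat[of n]]) (use less.prems in auto)
    have sub: "?S m \<subseteq> ?S n" using n by auto
    have "real (num_divisors n) \<le> (real k + 1) * num_divisors m"
      using num_divisors_prime_power_mult_le[OF p(1) m0, of k] unfolding n
      by (metis of_nat_1 of_nat_add of_nat_mono of_nat_mult)
    also have "\<dots> \<le> (real k + 1) * ((1 + 2 / \<epsilon>) ^ card (?S m) * real m powr \<epsilon>)"
      by (intro mult_left_mono IH) auto
    also have "\<dots> \<le> (1 + 2 / \<epsilon>) ^ card (?S n) * real n powr \<epsilon>"
    proof (cases "real p < 2 powr (1 / \<epsilon>)")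
      case True
      have "insert p (?S m) \<subseteq> ?S n" using sub p True by auto
      then have "card (insert p (?S m)) \<le> card (?S n)" using fin card_mono by blast
      moreover have "card (insert p (?S m)) = Suc (card (?S m))"
        using m fin sub by (subst card_insert_disjoint) (auto intro: finite_subset)
      ultimately have c: "Suc (card (?S m)) \<le> card (?S n)" by simp
      have "(real k + 1) * ((1 + 2 / \<epsilon>) ^ card (?S m) * real m powr \<epsilon>)
          \<le> (1 + 2 / \<epsilon>) * (real p ^ k) powr \<epsilon> * ((1 + 2 / \<epsilon>) ^ card (?S m) * real m powr \<epsilon>)"
        using assms p2 by (intro mult_right_mono Suc_le_const_powr) auto
      also have "\<dots> = (1 + 2 / \<epsilon>) ^ Suc (card (?S m)) * real n powr \<epsilon>"
        unfolding n by (simp add: powr_mult)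
      also have "\<dots> \<le> (1 + 2 / \<epsilon>) ^ card (?S n) * real n powr \<epsilon>"
        using assms c by (intro mult_right_mono power_increasing) auto
      finally show ?thesis .
    next
      case False
      have "(real k + 1) * ((1 + 2 / \<epsilon>) ^ card (?S m) * real m powr \<epsilon>)
          \<le> (real p ^ k) powr \<epsilon> * ((1 + 2 / \<epsilon>) ^ card (?S n) * real m powr \<epsilon>)"
        using assms p2 False sub fin
        by (intro mult_mono Suc_le_powr_of_large_base power_increasing card_mono) auto
      also have "\<dots> = (1 + 2 / \<epsilon>) ^ card (?S n) * real n powr \<epsilon>"
        unfolding n by (simp add: powr_mult)
      finally show ?thesis .
    qed
    finally show ?thesis .
  qed
qed

lemma num_divisors_le_powr:
  fixes \<epsilon> :: real
  assumes "\<epsilon> > 0"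
  obtains C where "C \<ge> 1" "\<And>n. n > 0 \<Longrightarrow> real (num_divisors n) \<le> C * real n powr \<epsilon>"
proof
  define P where "P = {p::nat. real p < 2 powr (1 / \<epsilon>)}"
  have P: "finite P"
  proof (rule finite_subset)
    show "P \<subseteq> {..nat \<lfloor>2 powr (1 / \<epsilon>)\<rfloor>}" unfolding P_def by (auto simp: le_nat_floor)
  qed simp
  show "(1 + 2 / \<epsilon>) ^ card P \<ge> 1" using assms by simp
  fix n :: nat assume n: "n > 0"
  have "real (num_divisors n) \<le> (1 + 2 / \<epsilon>) ^ card {p. prime p \<and> p dvd n \<and> real p < 2 powr (1 / \<epsilon>)} * real n powr \<epsilon>"
    using num_divisors_le_small_primes assms n .
  also have "\<dots> \<le> (1 + 2 / \<epsilon>) ^ card P * real n powr \<epsilon>"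
    using assms P by (intro mult_right_mono power_increasing card_mono) (auto simp: P_def)
  finally show "real (num_divisors n) \<le> (1 + 2 / \<epsilon>) ^ card P * real n powr \<epsilon>" .
qed

section \<open>Lattice points on circles\<close>

definition circle_points :: "int \<Rightarrow> (int \<times> int) set" where
  "circle_points n = {(p, q). p\<^sup>2 + q\<^sup>2 = n}"

definition primitive_circle_points :: "int \<Rightarrow> (int \<times> int) set" where
  "primitive_circle_points n = {(p, q). p\<^sup>2 + q\<^sup>2 = n \<and> coprime p q}"

lemma finite_circle_points: "finite (circle_points n)"
proof (rule finite_subset)
  show "circle_points n \<subseteq> {-n..n} \<times> {-n..n}"
  proof safe
    fix p q assume "(p, q) \<in> circle_points n"
    then have *: "p\<^sup>2 + q\<^sup>2 = n" by (simp add: circle_points_def)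
    have "\<bar>x\<bar> \<le> x\<^sup>2" for x :: int
    proof (cases "x = 0")
      case False
      then show ?thesis using mult_left_mono[of 1 "\<bar>x\<bar>" "\<bar>x\<bar>"] by (simp add: power2_eq_square)
    qed simp
    from this[of p] this[of q] * show "p \<in> {-n..n}" "q \<in> {-n..n}"
      using zero_le_power2[of p] zero_le_power2[of q] by (simp_all add: abs_le_iff)
  qed
qed simp

lemma coprime_square_sum:
  fixes p q n :: int
  assumes "p\<^sup>2 + q\<^sup>2 = n" "coprime p q"
  shows "coprime p n" "coprime q n"
proof -
  have c: "coprime p (q\<^sup>2)" "coprime q (p\<^sup>2)" using assms(2) by (simp_all add: coprime_commute)
  have "n = p * p + q\<^sup>2" using assms(1) by (simp add: power2_eq_square)
  with c show "coprime p n" by (simp add: coprime_iff_gcd_eq_1 gcd_add_mult)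
  have "n = q * q + p\<^sup>2" using assms(1) by (simp add: power2_eq_square)
  with c show "coprime q n" by (simp only: coprime_iff_gcd_eq_1 gcd_add_mult)
qed

text \<open>This plays the role of unique factorization of Gaussian integers. Let \<open>X = p q\<^sub>0 - p\<^sub>0 q\<close>
and \<open>Z = p q\<^sub>0 + p\<^sub>0 q\<close>. Then \<open>n\<close> divides \<open>X Z\<close>, so \<open>e = n / d\<close> divides \<open>Z\<close> when \<open>d = gcd(n, X)\<close>. For
two points with the same \<open>d\<close>, eliminating \<open>q\<^sub>0\<close> shows that \<open>d\<close> and \<open>e\<close>, which are
coprime to \<open>p\<^sub>0\<close>, both divide the determinant of the points. A common divisor of \<open>d\<close> and \<open>e\<close> divides \<open>X + Z = 2 p q\<^sub>0\<close>, hence \<open>2\<close>;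
so \<open>n = d e\<close> divides twice the determinant.\<close>

lemma dvd_determinant_of_equal_gcd:
  fixes p q p0 q0 p' q' n d :: int
  assumes n: "n > 0"
    and reps: "p\<^sup>2 + q\<^sup>2 = n" "p0\<^sup>2 + q0\<^sup>2 = n" "p'\<^sup>2 + q'\<^sup>2 = n"
    and cop: "coprime p q" "coprime p0 q0"
    and d: "gcd n (p * q0 - p0 * q) = d" "gcd n (p' * q0 - p0 * q') = d"
  shows "n dvd 2 * (p * q' - p' * q)"
proof -
  define e where "e = n div d"
  define D where "D = p * q' - p' * q"
  have dn: "d dvd n" using d(1) by auto
  then have de: "n = d * e" by (simp add: e_def)
  have cp0: "coprime p0 n" and cq0: "coprime q0 n" using coprime_square_sum reps(2) cop(2) by auto
  have cp: "coprime p n" using coprime_square_sum reps(1) cop(1) by auto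
  have en: "e dvd n" using de by simp
  have e_dvd: "e dvd x * q0 + p0 * y"
    if xy: "x\<^sup>2 + y\<^sup>2 = n" "gcd n (x * q0 - p0 * y) = d" for x y
  proof -
    have "(x * q0 - p0 * y) * (x * q0 + p0 * y) = x\<^sup>2 * q0\<^sup>2 - p0\<^sup>2 * y\<^sup>2"
      by (simp add: algebra_simps power2_eq_square)
    also have "\<dots> = n * (x\<^sup>2 - p0\<^sup>2)"
    proof -
      have "q0\<^sup>2 = n - p0\<^sup>2" "y\<^sup>2 = n - x\<^sup>2" using xy(1) reps(2) by auto
      then show ?thesis by (simp only:) (simp add: algebra_simps)
    qed
    finally have "n dvd (x * q0 - p0 * y) * (x * q0 + p0 * y)" by simp
    moreover obtain X where X: "x * q0 - p0 * y = d * X" using xy(2) by (metis dvdE gcd_dvd2)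
    ultimately have "d * e dvd d * (X * (x * q0 + p0 * y))" using de by (simp add: mult.assoc)
    moreover have d0: "d \<noteq> 0" using n de by auto
    ultimately have "e dvd X * (x * q0 + p0 * y)" by simp
    moreover have "coprime e X"
    proof -
      have "X = (x * q0 - p0 * y) div d" using X d0 by simp
      then show ?thesis
        using div_gcd_coprime[of n "x * q0 - p0 * y"] xy(2) n unfolding e_def by simp
    qed
    ultimately show ?thesis by (simp add: coprime_dvd_mult_right_iff)
  qed
  have dD: "d dvd D"
  proof -
    have "d dvd p * (p' * q0 - p0 * q') - p' * (p * q0 - p0 * q)"
      using d by (metis dvd_diff dvd_mult gcd_dvd2)
    also have "p * (p' * q0 - p0 * q') - p' * (p * q0 - p0 * q) = p0 * (- D)"
      by (simp add: D_def algebra_simps)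
    finally show ?thesis
      using cp0 dn coprime_dvd_mult_right_iff[of d p0 "- D"]
      by (metis coprime_commute coprime_divisors dvd_minus_iff dvd_refl)
  qed
  have eD: "e dvd D"
  proof -
    have "e dvd p * (p' * q0 + p0 * q') - p' * (p * q0 + p0 * q)"
      using e_dvd[OF reps(1) d(1)] e_dvd[OF reps(3) d(2)] by (metis dvd_diff dvd_mult)
    also have "p * (p' * q0 + p0 * q') - p' * (p * q0 + p0 * q) = p0 * D"
      by (simp add: D_def algebra_simps)
    finally show ?thesis
      using cp0 en coprime_dvd_mult_right_iff[of e p0 D]
      by (metis coprime_commute coprime_divisors dvd_refl)
  qed
  have "gcd d e dvd 2"
  proof -
    define h where "h = gcd d e"
    have "h dvd n" using dn unfolding h_def by (meson dvd_trans gcd_dvd1)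
    then have c: "coprime h p" "coprime h q0"
      using cp cq0 by (metis coprime_commute coprime_divisors dvd_refl)+
    have "h dvd (p * q0 - p0 * q) + (p * q0 + p0 * q)"
      using d(1) e_dvd[OF reps(1) d(1)] unfolding h_def
      by (metis dvd_add dvd_trans gcd_dvd1 gcd_dvd2)
    also have "(p * q0 - p0 * q) + (p * q0 + p0 * q) = p * (q0 * 2)" by simp
    finally have "h dvd 2" using c by (simp add: coprime_dvd_mult_right_iff)
    then show ?thesis by (simp add: h_def)
  qed
  then obtain c where c: "2 = gcd d e * c" by blast
  obtain u v where uv: "u * d + v * e = gcd d e" using bezout_int by blast
  have "2 * D = c * (u * d + v * e) * D" using c uv by (simp add: mult.commute)
  also have "\<dots> = c * u * (d * D) + c * v * (e * D)" by (simp add: algebra_simps)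
  finally have "2 * D = c * u * (d * D) + c * v * (e * D)" .
  moreover have "n dvd d * D" using de eD by simp
  moreover have "n dvd e * D" using de dD by (simp add: mult.commute)
  ultimately show ?thesis unfolding D_def by (metis dvd_add dvd_mult)
qed

text \<open>The determinant \<open>D\<close> and the scalar product \<open>E\<close> of two points on the circle satisfy
\<open>D\<^sup>2 + E\<^sup>2 = n\<^sup>2\<close>, so \<open>2 D\<close>, a multiple of \<open>n\<close>, has five possible values. The pair \<open>(D, E)\<close>
determines the second point, and \<open>D\<close> determines \<open>E\<close> up to its sign.\<close>

lemma card_gcd_fibre_le:
  fixes p0 q0 n d :: int
  assumes n: "n > 0" and base: "(p0, q0) \<in> primitive_circle_points n"
  shows "card {(p, q) \<in> primitive_circle_points n. gcd n (p * q0 - p0 * q) = d} \<le> 10"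
    (is "card ?F \<le> 10")
proof (cases "?F = {}")
  case False
  then obtain p q where pq: "(p, q) \<in> ?F" by auto
  then have P: "p\<^sup>2 + q\<^sup>2 = n" "coprime p q" "gcd n (p * q0 - p0 * q) = d"
    by (auto simp: primitive_circle_points_def)
  \<comment> \<open>The five values of twice the determinant divided by \<open>n\<close>, and the sign of the scalar product.\<close>
  define \<Phi> where "\<Phi> = (\<lambda>(p', q'). (2 * (p * q' - p' * q) div n, p * p' + q * q' \<ge> 0))"
  have brah: "(p * q' - p' * q)\<^sup>2 + (p * p' + q * q')\<^sup>2 = n\<^sup>2" if "p'\<^sup>2 + q'\<^sup>2 = n" for p' q'
  proof -
    have "(p * q' - p' * q)\<^sup>2 + (p * p' + q * q')\<^sup>2 = (p\<^sup>2 + q\<^sup>2) * (p'\<^sup>2 + q'\<^sup>2)"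
      by (simp add: power2_eq_square algebra_simps)
    with P that show ?thesis by (simp add: power2_eq_square)
  qed
  have dv: "n dvd 2 * (p * q' - p' * q)" if "(p', q') \<in> ?F" for p' q'
    using that base P n
    by (intro dvd_determinant_of_equal_gcd[OF n P(1) _ _ P(2) _ P(3), of p' q'])
       (auto simp: primitive_circle_points_def)
  have "\<Phi> ` ?F \<subseteq> {-2..2} \<times> UNIV"
  proof (rule image_subsetI)
    fix x assume x: "x \<in> ?F"
    obtain p' q' where x': "x = (p', q')" by (cases x)
    have F: "(p', q') \<in> ?F" using x x' by simp
    then have e: "p'\<^sup>2 + q'\<^sup>2 = n" by (auto simp: primitive_circle_points_def)
    define k where "k = 2 * (p * q' - p' * q) div n"
    have k: "n * k = 2 * (p * q' - p' * q)" using dv[OF F] by (simp add: k_def)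
    have "(p * q' - p' * q)\<^sup>2 \<le> n\<^sup>2" using brah[OF e] zero_le_power2[of "p * p' + q * q'"] by linarith
    then have "\<bar>p * q' - p' * q\<bar> \<le> n" using n by (simp add: abs_le_square_iff[symmetric])
    then have "\<bar>n * k\<bar> \<le> n * 2" using k by simp
    then have "\<bar>k\<bar> \<le> 2" using n by (simp add: abs_mult)
    then show "\<Phi> x \<in> {-2..2} \<times> UNIV" unfolding x' \<Phi>_def k_def by auto
  qed
  moreover have "inj_on \<Phi> ?F"
  proof (rule inj_onI)
    fix x y assume x: "x \<in> ?F" and y: "y \<in> ?F" and eq: "\<Phi> x = \<Phi> y"
    obtain p1 q1 p2 q2 where xy: "x = (p1, q1)" "y = (p2, q2)" by (cases x, cases y)
    have F: "(p1, q1) \<in> ?F" "(p2, q2) \<in> ?F" using x y xy by auto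
    then have e: "p1\<^sup>2 + q1\<^sup>2 = n" "p2\<^sup>2 + q2\<^sup>2 = n" by (auto simp: primitive_circle_points_def)
    have D: "p * q1 - p1 * q = p * q2 - p2 * q"
    proof -
      have "2 * (p * q1 - p1 * q) div n = 2 * (p * q2 - p2 * q) div n"
        using eq unfolding xy \<Phi>_def by simp
      then have "2 * (p * q1 - p1 * q) = 2 * (p * q2 - p2 * q)"
        using dv[OF F(1)] dv[OF F(2)] dvd_div_eq_cancel by blast
      then show ?thesis by simp
    qed
    then have "(p * p1 + q * q1)\<^sup>2 = (p * p2 + q * q2)\<^sup>2"
      using brah[OF e(1)] brah[OF e(2)] by simp
    then have E: "p * p1 + q * q1 = p * p2 + q * q2"
      using eq unfolding xy \<Phi>_def power2_eq_iff prod.case prod.inject by linarith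
    \<comment> \<open>A point is recovered from its scalar product and its determinant with \<open>(p, q)\<close>.\<close>
    have "n * p1 = p * (p * p1 + q * q1) - q * (p * q1 - p1 * q)"
         "n * p2 = p * (p * p2 + q * q2) - q * (p * q2 - p2 * q)"
         "n * q1 = q * (p * p1 + q * q1) + p * (p * q1 - p1 * q)"
         "n * q2 = q * (p * p2 + q * q2) + p * (p * q2 - p2 * q)"
      unfolding P(1)[symmetric] by (simp_all add: power2_eq_square algebra_simps)
    then have "n * p1 = n * p2" "n * q1 = n * q2" using D E by simp_all
    then show "x = y" using n xy by simp
  qed
  ultimately have "card ?F \<le> card ({-2..2::int} \<times> (UNIV :: bool set))"
    by (intro card_inj_on_le) auto
  then show ?thesis by (simp add: card_cartesian_product)
next
  case True
  then show ?thesis by (simp only: card.empty)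
qed

lemma card_int_divisors:
  fixes n :: nat
  assumes "n > 0"
  shows "card {d::int. d > 0 \<and> d dvd int n} = num_divisors n"
proof -
  have "{d::int. d > 0 \<and> d dvd int n} = int ` {d. d dvd n}"
  proof
    show "{d::int. d > 0 \<and> d dvd int n} \<subseteq> int ` {d. d dvd n}"
    proof
      fix d :: int assume "d \<in> {d. d > 0 \<and> d dvd int n}"
      then show "d \<in> int ` {d. d dvd n}"
        by (intro image_eqI[of _ _ "nat d"]) (auto simp: nat_dvd_iff)
    qed
    show "int ` {d. d dvd n} \<subseteq> {d. d > 0 \<and> d dvd int n}"
      using assms by (auto dest: dvd_pos_nat)
  qed
  then show ?thesis by (simp add: num_divisors_def card_image)
qed

lemma finite_primitive_circle_points: "finite (primitive_circle_points n)"
  by (rule finite_subset[OF _ finite_circle_points[of n]])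
     (auto simp: primitive_circle_points_def circle_points_def)

lemma card_primitive_circle_points_le:
  assumes n: "n > (0::nat)"
  shows "card (primitive_circle_points (int n)) \<le> 10 * num_divisors n"
proof (cases "primitive_circle_points (int n) = {}")
  case True
  show ?thesis unfolding True by simp
next
  case False
  then obtain z where "z \<in> primitive_circle_points (int n)" by (meson equals0I)
  then obtain p0 q0 where b: "(p0, q0) \<in> primitive_circle_points (int n)" by (cases z) simp
  define D where "D = {d::int. d > 0 \<and> d dvd int n}"
  define F where "F d = {(p, q) \<in> primitive_circle_points (int n). gcd (int n) (p * q0 - p0 * q) = d}" for d
  have fin: "finite D" unfolding D_def
    by (rule finite_subset[of _ "{0..int n}"]) (use n in \<open>auto intro!: zdvd_imp_le\<close>)
  have "primitive_circle_points (int n) \<subseteq> (\<Union>d\<in>D. F d)"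
  proof (rule subrelI)
    fix p q assume pq: "(p, q) \<in> primitive_circle_points (int n)"
    define d where "d = gcd (int n) (p * q0 - p0 * q)"
    have "d \<in> D" using n unfolding D_def d_def by simp
    moreover have "(p, q) \<in> F d" using pq unfolding F_def d_def by simp
    ultimately show "(p, q) \<in> (\<Union>d\<in>D. F d)" by blast
  qed
  moreover have "finite (\<Union>d\<in>D. F d)"
    by (rule finite_subset[OF _ finite_primitive_circle_points[of "int n"]]) (auto simp: F_def)
  ultimately have "card (primitive_circle_points (int n)) \<le> card (\<Union>d\<in>D. F d)"
    using card_mono by blast
  also have "\<dots> \<le> (\<Sum>d\<in>D. card (F d))" by (rule card_UN_le[OF fin])
  also have "\<dots> \<le> (\<Sum>d\<in>D. 10)"
    unfolding F_def by (rule sum_mono, rule card_gcd_fibre_le[OF _ b]) (use n in simp)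
  also have "\<dots> = card D * 10" by simp
  also have "card D = num_divisors n" unfolding D_def by (rule card_int_divisors[OF n])
  finally show ?thesis by (simp add: mult.commute)
qed

text \<open>Dividing a point by the greatest common divisor \<open>g\<close> of its coordinates gives a primitive point
on the circle of \<open>n / g\<^sup>2\<close>, and both \<open>g\<close> and \<open>n / g\<^sup>2\<close> divide \<open>n\<close>.\<close>

lemma card_circle_points_le:
  assumes n: "n > (0::nat)"
  shows "card (circle_points (int n)) \<le> 10 * (num_divisors n)\<^sup>2"
proof -
  let ?D = "{g::nat. g dvd n}"
  let ?A = "\<lambda>g::nat. if g\<^sup>2 dvd n then (\<lambda>(p, q). (int g * p, int g * q)) ` primitive_circle_points (int (n div g\<^sup>2)) else {}"
  have fin: "finite ?D" using n by simp
  note finp = finite_primitive_circle_points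
  have "circle_points (int n) \<subseteq> (\<Union>g\<in>?D. ?A g)"
  proof (rule subrelI)
    fix p q assume "(p, q) \<in> circle_points (int n)"
    then have e: "p\<^sup>2 + q\<^sup>2 = int n" by (simp add: circle_points_def)
    define g where "g = nat (gcd p q)"
    have "gcd p q \<noteq> 0" using e n by auto
    then have g: "int g = gcd p q" "g > 0"  by (auto simp: g_def)
    obtain p' q' where "p = p' * gcd p q" "q = q' * gcd p q" and cop: "coprime p' q'"
      using gcd_coprime_exists[OF \<open>gcd p q \<noteq> 0\<close>] by blast
    then have pq: "p = int g * p'" "q = int g * q'"
      by (metis g(1) mult.commute)+
    have e': "int n = int (g\<^sup>2) * (p'\<^sup>2 + q'\<^sup>2)"
      unfolding e[symmetric] pq(1,2) by (simp add: power_mult_distrib distrib_left)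
    then have "int (g\<^sup>2) dvd int n" by simp
    then have gn: "g\<^sup>2 dvd n" by (simp only: of_nat_dvd_iff)
    have "int (n div g\<^sup>2) = p'\<^sup>2 + q'\<^sup>2" using e' g(2) by (simp add: zdiv_int)
    then have "(p', q') \<in> primitive_circle_points (int (n div g\<^sup>2))"
      using cop by (simp add: primitive_circle_points_def)
    then have "(p, q) \<in> ?A g" unfolding if_P[OF gn] by (rule rev_image_eqI) (simp add: pq(1,2))
    moreover have "g \<in> ?D" using gn dvd_trans[of g "g\<^sup>2" n] by simp
    ultimately show "(p, q) \<in> (\<Union>g\<in>?D. ?A g)" by blast
  qed
  then have "card (circle_points (int n)) \<le> card (\<Union>g\<in>?D. ?A g)"
  proof (intro card_mono finite_UN_I fin)
    show "finite (?A g)" for g using finp by simp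
  qed
  also have "\<dots> \<le> (\<Sum>g\<in>?D. card (?A g))" by (rule card_UN_le[OF fin])
  also have "\<dots> \<le> (\<Sum>g\<in>?D. 10 * num_divisors n)"
  proof (rule sum_mono)
    fix g assume "g \<in> ?D"
    show "card (?A g) \<le> 10 * num_divisors n"
    proof (cases "g\<^sup>2 dvd n")
      case True
      then have "g\<^sup>2 \<le> n" "g\<^sup>2 > 0" using n by (auto intro: dvd_imp_le dvd_pos_nat)
      then have "n div g\<^sup>2 > 0" by (simp add: div_greater_zero_iff)
      have "n = (n div g\<^sup>2) * g\<^sup>2" using dvd_div_mult_self[OF True] by (rule sym)
      then have "n div g\<^sup>2 dvd n" by (rule dvdI)
      have "card (?A g) \<le> card (primitive_circle_points (int (n div g\<^sup>2)))"
        unfolding if_P[OF True] by (rule card_image_le[OF finp])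
      also have "\<dots> \<le> 10 * num_divisors (n div g\<^sup>2)"
        by (rule card_primitive_circle_points_le) fact
      also have "\<dots> \<le> 10 * num_divisors n"
        using num_divisors_mono_dvd[OF \<open>n div g\<^sup>2 dvd n\<close> n] by simp
      finally show ?thesis .
    qed simp
  qed
  also have "\<dots> = 10 * (num_divisors n)\<^sup>2" by (simp add: num_divisors_def power2_eq_square)
  finally show ?thesis .
qed

text \<open>The relation \<open>abc = 4 R \<Delta>\<close> between the sides, the circumradius and the area of a triangle,
squared and written with the determinant \<open>2 \<Delta>\<close>.\<close>

lemma square_norms_three_points_on_circle:
  fixes u1 u2 v1 v2 w1 w2 n :: int
  assumes "u1\<^sup>2 + u2\<^sup>2 = n" "v1\<^sup>2 + v2\<^sup>2 = n" "w1\<^sup>2 + w2\<^sup>2 = n"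
  shows "((v1 - u1)\<^sup>2 + (v2 - u2)\<^sup>2) * ((w1 - u1)\<^sup>2 + (w2 - u2)\<^sup>2) * ((w1 - v1)\<^sup>2 + (w2 - v2)\<^sup>2)
    = 4 * n * ((v1 - u1) * (w2 - u2) - (v2 - u2) * (w1 - u1))\<^sup>2"
proof -
  define a b c d where "a = v1 - u1" and "b = v2 - u2" and "c = w1 - u1" and "d = w2 - u2"
  have A: "a\<^sup>2 + b\<^sup>2 = - 2 * (u1 * a + u2 * b)"
    using assms(1,2) unfolding a_def b_def by (simp add: power2_eq_square algebra_simps)
  have B: "c\<^sup>2 + d\<^sup>2 = - 2 * (u1 * c + u2 * d)"
    using assms(1,3) unfolding c_def d_def by (simp add: power2_eq_square algebra_simps)
  define S T where "S = u1 * a + u2 * b" and "T = u1 * c + u2 * d"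
  have 1: "u1 * (a * d - b * c) = S * d - T * b" "u2 * (a * d - b * c) = T * a - S * c"
    unfolding S_def T_def by (simp_all add: algebra_simps)
  have "n * (a * d - b * c)\<^sup>2 = (u1 * (a * d - b * c))\<^sup>2 + (u2 * (a * d - b * c))\<^sup>2"
    unfolding assms(1)[symmetric] by (simp only: power_mult_distrib distrib_right)
  also have "\<dots> = (S * d - T * b)\<^sup>2 + (T * a - S * c)\<^sup>2" unfolding 1 ..
  also have "\<dots> = S\<^sup>2 * (c\<^sup>2 + d\<^sup>2) + T\<^sup>2 * (a\<^sup>2 + b\<^sup>2) - 2 * S * T * (a * c + b * d)"
    by (simp add: power2_eq_square algebra_simps)
  also have "\<dots> = - 2 * S\<^sup>2 * T - 2 * T\<^sup>2 * S - 2 * S * T * (a * c + b * d)"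
    unfolding A B S_def[symmetric] T_def[symmetric] by (simp add: algebra_simps)
  finally have n: "n * (a * d - b * c)\<^sup>2 = - 2 * S * T * (S + T + (a * c + b * d))"
    by (simp add: power2_eq_square algebra_simps)
  have "(c - a)\<^sup>2 + (d - b)\<^sup>2 = (a\<^sup>2 + b\<^sup>2) + (c\<^sup>2 + d\<^sup>2) - 2 * (a * c + b * d)"
    by (simp add: power2_eq_square algebra_simps)
  also have "\<dots> = - 2 * (S + T + (a * c + b * d))" unfolding A B S_def T_def by simp
  finally have E: "(c - a)\<^sup>2 + (d - b)\<^sup>2 = - 2 * (S + T + (a * c + b * d))" .
  have "(a\<^sup>2 + b\<^sup>2) * (c\<^sup>2 + d\<^sup>2) * ((c - a)\<^sup>2 + (d - b)\<^sup>2) = 4 * (n * (a * d - b * c)\<^sup>2)"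
    unfolding n E A B S_def[symmetric] T_def[symmetric] by (simp add: algebra_simps)
  moreover have "c - a = w1 - v1" "d - b = w2 - v2" by (simp_all add: a_def b_def c_def d_def)
  ultimately show ?thesis unfolding a_def b_def c_def d_def by (simp add: mult.assoc)
qed

text \<open>The bound is uniform in the radius. If \<open>n\<close> is larger than a constant times \<open>L\<^sup>6\<close>, the box contains
at most two points: the determinant of three distinct ones would be a nonzero integer that is too
small for the triangle relation. Otherwise \<open>n\<close> is polynomially bounded in \<open>L\<close> and the divisor bound
applies.\<close>

lemma card_circle_points_box_le:
  fixes \<epsilon> :: real
  assumes "\<epsilon> > 0"
  obtains C where "C \<ge> 1"
    "\<And>n P Q L. 1 \<le> L \<Longrightarrow>
       real (card {(p, q) \<in> circle_points n. \<bar>of_int p - P\<bar> \<le> L \<and> \<bar>of_int q - Q\<bar> \<le> L}) \<le> C * L powr \<epsilon>"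
proof -
  obtain D where D: "D \<ge> 1" "\<And>n. n > 0 \<Longrightarrow> real (num_divisors n) \<le> D * real n powr (\<epsilon> / 12)"
    using num_divisors_le_powr[of "\<epsilon> / 12"] assms by auto
  define C where "C = 10 * D\<^sup>2 * 128 powr (\<epsilon> / 6)"
  have C2: "C \<ge> 2"
  proof -
    have "1 * 1 \<le> D\<^sup>2 * 128 powr (\<epsilon> / 6)"
      using D(1) assms by (intro mult_mono ge_one_powr_ge_zero) auto
    then show ?thesis by (simp add: C_def)
  qed
  show thesis
  proof
    show "C \<ge> 1" using C2 by simp
  next
    fix n :: int and P Q L :: real assume L: "1 \<le> L"
    let ?S = "{(p, q) \<in> circle_points n. \<bar>of_int p - P\<bar> \<le> L \<and> \<bar>of_int q - Q\<bar> \<le> L}"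
    have sub: "?S \<subseteq> circle_points n" by auto
    have L1: "1 \<le> L powr \<epsilon>" using L assms by (intro ge_one_powr_ge_zero) auto
    have few: "real (card ?S) \<le> C * L powr \<epsilon>" if "card ?S \<le> 2"
    proof -
      have "real (card ?S) \<le> 2 * 1" using that by simp
      also have "\<dots> \<le> C * L powr \<epsilon>" using C2 L1 by (intro mult_mono) auto
      finally show ?thesis .
    qed
    show "real (card ?S) \<le> C * L powr \<epsilon>"
    proof (cases "n > 0 \<and> card ?S > 2")
      case False
      have "card (circle_points 0) \<le> 2"
      proof -
        have "circle_points 0 = {(0, 0)}" by (auto simp: circle_points_def sum_power2_eq_zero_iff)
        then show ?thesis by simp
      qed
      moreover have "circle_points n = {}" if "n < 0"
        using that by (auto simp: circle_points_def) (smt (verit) zero_le_power2)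
      moreover have "card ?S \<le> card (circle_points n)"
        using finite_circle_points sub by (rule card_mono)
      ultimately have "card ?S \<le> 2"
        using False by (cases "n = 0"; cases "n < 0") auto
      then show ?thesis by (rule few)
    next
      case True
      then have "3 \<le> card ?S" by simp
      then obtain T where "T \<subseteq> ?S" "card T = 3" by (meson obtain_subset_with_card_n)
      moreover obtain u v w where "T = {u, v, w}" "u \<noteq> v" "u \<noteq> w" "v \<noteq> w"
        using \<open>card T = 3\<close> unfolding card_3_iff by blast
      ultimately have uvw: "u \<in> ?S" "v \<in> ?S" "w \<in> ?S" "u \<noteq> v" "u \<noteq> w" "v \<noteq> w"
        by simp_all
      obtain u1 u2 v1 v2 w1 w2 where eq: "u = (u1, u2)" "v = (v1, v2)" "w = (w1, w2)"
        by (cases u, cases v, cases w)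
      have on: "u1\<^sup>2 + u2\<^sup>2 = n" "v1\<^sup>2 + v2\<^sup>2 = n" "w1\<^sup>2 + w2\<^sup>2 = n"
        using uvw unfolding eq by (auto simp: circle_points_def)
      have dist: "0 < real_of_int ((a - c)\<^sup>2 + (b - d)\<^sup>2) \<and> real_of_int ((a - c)\<^sup>2 + (b - d)\<^sup>2) \<le> 8 * L\<^sup>2"
        if "(a, b) \<in> ?S" "(c, d) \<in> ?S" "(a, b) \<noteq> (c, d)" for a b c d
      proof -
        have "\<bar>real_of_int (a - c)\<bar> \<le> 2 * L" "\<bar>real_of_int (b - d)\<bar> \<le> 2 * L" using that(1,2) by auto
        then have "(real_of_int (a - c))\<^sup>2 \<le> (2 * L)\<^sup>2" "(real_of_int (b - d))\<^sup>2 \<le> (2 * L)\<^sup>2"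
          using power_mono[of "\<bar>real_of_int (a - c)\<bar>" "2 * L" 2]
            power_mono[of "\<bar>real_of_int (b - d)\<bar>" "2 * L" 2] by simp_all
        moreover have "0 < (a - c)\<^sup>2 + (b - d)\<^sup>2" using that(3) by (auto simp: sum_power2_gt_zero_iff)
        then have "0 < real_of_int ((a - c)\<^sup>2 + (b - d)\<^sup>2)" by (simp only: of_int_0_less_iff)
        ultimately show ?thesis by (simp add: power_mult_distrib)
      qed
      define A B E where "A = (v1 - u1)\<^sup>2 + (v2 - u2)\<^sup>2" and "B = (w1 - u1)\<^sup>2 + (w2 - u2)\<^sup>2"
        and "E = (w1 - v1)\<^sup>2 + (w2 - v2)\<^sup>2"
      define F where "F = (v1 - u1) * (w2 - u2) - (v2 - u2) * (w1 - u1)"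
      have ABE: "0 < real_of_int A" "real_of_int A \<le> 8 * L\<^sup>2" "0 < real_of_int B" "real_of_int B \<le> 8 * L\<^sup>2"
        "0 < real_of_int E" "real_of_int E \<le> 8 * L\<^sup>2"
        unfolding A_def B_def E_def
        using dist[OF uvw(2,1)[unfolded eq] uvw(4)[unfolded eq, symmetric]]
          dist[OF uvw(3,1)[unfolded eq] uvw(5)[unfolded eq, symmetric]]
          dist[OF uvw(3,2)[unfolded eq] uvw(6)[unfolded eq, symmetric]] by blast+
      have id: "A * B * E = 4 * n * F\<^sup>2"
        using square_norms_three_points_on_circle[OF on] unfolding A_def B_def E_def F_def .
      have "A * B * E > 0" using ABE by simp
      then have "F \<noteq> 0" using id by auto
      then have "1 \<le> F\<^sup>2" by (simp add: int_one_le_iff_zero_less)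
      then have "4 * n * 1 \<le> A * B * E" unfolding id using True by (intro mult_left_mono) auto
      then have "real_of_int (4 * n) \<le> real_of_int (A * B * E)" by (simp only: of_int_le_iff mult_1_right)
      then have "4 * real_of_int n \<le> real_of_int A * real_of_int B * real_of_int E" by simp
      also have "\<dots> \<le> (8 * L\<^sup>2) * (8 * L\<^sup>2) * (8 * L\<^sup>2)" using ABE by (intro mult_mono) auto
      also have "\<dots> = 4 * (128 * L ^ 6)" by (simp add: power2_eq_square power_numeral_reduce)
      finally have nL: "real_of_int n \<le> 128 * L ^ 6" by simp
      define k where "k = nat n"
      have k: "n = int k" "k > 0" using True by (auto simp: k_def)
      have "real (num_divisors k) \<le> D * real k powr (\<epsilon> / 12)" using D(2) k by blast
      then have "(real (num_divisors k))\<^sup>2 \<le> (D * real k powr (\<epsilon> / 12))\<^sup>2"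
        by (intro power_mono) auto
      also have "\<dots> = D\<^sup>2 * real k powr (\<epsilon> / 6)"
        by (simp add: power_mult_distrib power2_eq_square flip: powr_add)
      also have "\<dots> \<le> D\<^sup>2 * (128 * L ^ 6) powr (\<epsilon> / 6)"
        using nL k assms by (intro mult_left_mono powr_mono2) auto
      also have "(128 * L ^ 6) powr (\<epsilon> / 6) = 128 powr (\<epsilon> / 6) * L powr \<epsilon>"
      proof -
        have "L ^ 6 = L powr 6" using L powr_realpow[of L 6] by simp
        then show ?thesis using L by (simp only: powr_mult powr_powr) (simp add: powr_mult powr_powr)
      qed
      finally have *: "(real (num_divisors k))\<^sup>2 \<le> D\<^sup>2 * (128 powr (\<epsilon> / 6) * L powr \<epsilon>)" .
      have "card ?S \<le> card (circle_points n)" using finite_circle_points sub by (rule card_mono)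
      also have "\<dots> \<le> 10 * (num_divisors k)\<^sup>2" using card_circle_points_le[OF k(2)] k(1) by simp
      finally have "real (card ?S) \<le> real (10 * (num_divisors k)\<^sup>2)" by (rule of_nat_mono)
      also have "\<dots> = 10 * (real (num_divisors k))\<^sup>2" by simp
      also have "\<dots> \<le> C * L powr \<epsilon>" using * by (simp add: C_def)
      finally show ?thesis .
    qed
  qed
qed

section \<open>Integer slices of a thin spherical shell\<close>

lemma arccos_le_twice_sqrt:
  assumes "0 \<le> x" "x \<le> 1"
  shows "arccos x \<le> 2 * sqrt (1 - x\<^sup>2)"
proof -
  define \<theta> where "\<theta> = arccos x"
  have \<theta>: "0 \<le> \<theta>" "\<theta> \<le> pi / 2" "cos \<theta> = x" "sin \<theta> = sqrt (1 - x\<^sup>2)"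
    using assms arccos_le_pi2[of x] arccos_lbound[of x] by (auto simp: \<theta>_def sin_arccos)
  show ?thesis
  proof (cases "x \<le> 1 / 2")
    case True
    have "x\<^sup>2 \<le> (1 / 2)\<^sup>2" using True assms by (intro power_mono) auto
    then have "sqrt ((8/10)\<^sup>2) \<le> sqrt (1 - x\<^sup>2)"
      by (intro real_sqrt_le_mono) (simp add: power2_eq_square)
    then have "8 / 5 \<le> 2 * sqrt (1 - x\<^sup>2)" by simp
    moreover have "\<theta> \<le> 8 / 5" using \<theta>(2) pi_approx by simp
    ultimately show ?thesis by (simp add: \<theta>_def)
  next
    case False
    then have "\<theta> < pi / 2" using \<theta> by (metis cos_pi_half less_eq_real_def not_less zero_less_divide_1_iff zero_less_numeral less_trans)
    then have "\<theta> \<le> tan \<theta>"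
      using abs_tan_ge[of \<theta>] \<theta> \<open>\<theta> < pi / 2\<close> tan_gt_zero[of \<theta>] by (cases "\<theta> = 0") auto
    then have "\<theta> * cos \<theta> \<le> sin \<theta>" using False \<theta>(3) by (simp add: tan_def field_simps)
    moreover have "\<theta> * (1 / 2) \<le> \<theta> * cos \<theta>" using False \<theta> by (intro mult_left_mono) auto
    ultimately show ?thesis using \<theta> by (simp add: \<theta>_def)
  qed
qed

text \<open>The left-hand side is the derivative of \<open>z \<mapsto> arcsin (z / r)\<close> at \<open>x\<close>, which increases with \<open>x\<close>.\<close>

lemma inverse_sqrt_le_arcsin_step:
  assumes r: "0 < r" and x: "0 \<le> x" "x + 1 < r"
  shows "1 / sqrt (r\<^sup>2 - x\<^sup>2) \<le> arcsin ((x + 1) / r) - arcsin (x / r)"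
proof -
  have der: "((\<lambda>z. arcsin (z / r)) has_real_derivative 1 / sqrt (r\<^sup>2 - z\<^sup>2)) (at z)"
    if "x \<le> z" "z \<le> x + 1" for z
  proof -
    have "1 - (z / r)\<^sup>2 = (r\<^sup>2 - z\<^sup>2) / r\<^sup>2" using r by (simp add: field_simps)
    then have e: "inverse (sqrt (1 - (z / r)\<^sup>2)) * (1 / r) = 1 / sqrt (r\<^sup>2 - z\<^sup>2)"
      using r by (simp add: real_sqrt_divide field_simps)
    have "- 1 < z / r" "z / r < 1" using x that r by (auto simp: field_simps)
    then have "(arcsin has_real_derivative inverse (sqrt (1 - (z / r)\<^sup>2))) (at (z / r))"
      by (rule DERIV_arcsin)
    moreover have "((\<lambda>z. z / r) has_real_derivative 1 / r) (at z)"
      using r by (auto intro!: derivative_eq_intros)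
    ultimately show ?thesis
      unfolding e[symmetric] by (rule DERIV_chain2[where f = arcsin and g = "\<lambda>z. z / r"])
  qed
  obtain z where z: "z > x" "z < x + 1"
    "arcsin ((x + 1) / r) - arcsin (x / r) = (x + 1 - x) * (1 / sqrt (r\<^sup>2 - z\<^sup>2))"
    using MVT2[of x "x + 1" "\<lambda>z. arcsin (z / r)" "\<lambda>z. 1 / sqrt (r\<^sup>2 - z\<^sup>2)"] der by auto
  have "z\<^sup>2 < r\<^sup>2" using z x r by (intro power_strict_mono) auto
  moreover have "x\<^sup>2 \<le> z\<^sup>2" using z x by (intro power_mono) auto
  ultimately have "1 / sqrt (r\<^sup>2 - x\<^sup>2) \<le> 1 / sqrt (r\<^sup>2 - z\<^sup>2)"
    by (intro divide_left_mono real_sqrt_le_mono mult_pos_pos) auto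
  then show ?thesis using z(3) by simp
qed

text \<open>All terms except the last are bounded by increments of the arcsine, which telescope to an angle.
The sine of this angle is at most \<open>sqrt (B / Y)\<close>, and the angle is at most twice its sine. The last
term, next to the singularity, is at most \<open>1 / sqrt A\<close>.\<close>

lemma sum_inverse_sqrt_nat_le:
  fixes Q :: "nat set" and A B Y :: real
  assumes fin: "finite Q" and A: "0 < A"
    and Q: "\<And>q. q \<in> Q \<Longrightarrow> A \<le> Y - (real q)\<^sup>2 \<and> Y - (real q)\<^sup>2 \<le> B"
    and Y: "0 < Y" and B: "0 \<le> B"
  shows "(\<Sum>q\<in>Q. 1 / sqrt (Y - (real q)\<^sup>2)) \<le> 1 / sqrt A + 2 * sqrt (B / Y)"
proof (cases "Q = {}")
  case True
  then show ?thesis using A Y B by simp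
next
  case False
  define q0 q1 where "q0 = Min Q" and "q1 = Max Q"
  have q: "q0 \<in> Q" "q1 \<in> Q" "\<And>q. q \<in> Q \<Longrightarrow> q0 \<le> q \<and> q \<le> q1"
    using False fin by (auto simp: q0_def q1_def)
  define r where "r = sqrt Y"
  have r: "0 < r" "r\<^sup>2 = Y" using Y by (auto simp: r_def)
  have q1r: "real q1 < r"
    by (rule power2_less_imp_less) (use Q[OF q(2)] A r in auto)
  have step: "1 / sqrt (Y - (real q)\<^sup>2) \<le> arcsin (real (Suc q) / r) - arcsin (real q / r)" if "q < q1" for q
    using inverse_sqrt_le_arcsin_step[of r "real q"] that q1r r by (simp add: add.commute)
  have nn: "0 \<le> 1 / sqrt (Y - (real q)\<^sup>2)" if "q \<le> q1" for q
  proof -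
    have "(real q)\<^sup>2 \<le> (real q1)\<^sup>2" using that by (intro power_mono) auto
    then have "0 \<le> Y - (real q)\<^sup>2" using Q[OF q(2)] A by linarith
    then show ?thesis by simp
  qed
  have "(\<Sum>q\<in>Q. 1 / sqrt (Y - (real q)\<^sup>2))
      = 1 / sqrt (Y - (real q1)\<^sup>2) + (\<Sum>q\<in>Q - {q1}. 1 / sqrt (Y - (real q)\<^sup>2))"
    using fin q(2) by (rule sum.remove)
  also have "\<dots> \<le> 1 / sqrt A + (\<Sum>q\<in>{q0..<q1}. 1 / sqrt (Y - (real q)\<^sup>2))"
  proof (intro add_mono sum_mono2)
    show "1 / sqrt (Y - (real q1)\<^sup>2) \<le> 1 / sqrt A"
      using A Q[OF q(2)] by (intro divide_left_mono real_sqrt_le_mono mult_pos_pos) auto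
    show "Q - {q1} \<subseteq> {q0..<q1}" using q(3) by (force simp: less_le)
  qed (use nn in auto)
  also have "(\<Sum>q\<in>{q0..<q1}. 1 / sqrt (Y - (real q)\<^sup>2))
      \<le> (\<Sum>q\<in>{q0..<q1}. arcsin (real (Suc q) / r) - arcsin (real q / r))"
    by (intro sum_mono step) auto
  also have "\<dots> = arcsin (real q1 / r) - arcsin (real q0 / r)"
    using q by (intro sum_Suc_diff'[of q0 q1 "\<lambda>q. arcsin (real q / r)"]) auto
  also have "\<dots> \<le> pi / 2 - arcsin (real q0 / r)"
    using arcsin_ubound[of "real q1 / r"] q1r r by (simp add: field_simps)
  also have "\<dots> = arccos (real q0 / r)"
  proof -
    have "real q0 \<le> real q1" using q by auto
    then show ?thesis using r q1r by (subst arccos_arcsin_eq) (auto simp: field_simps)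
  qed
  also have "\<dots> \<le> 2 * sqrt (1 - (real q0 / r)\<^sup>2)"
  proof -
    have "real q0 \<le> real q1" using q by auto
    then show ?thesis using r q1r by (intro arccos_le_twice_sqrt) (auto simp: field_simps)
  qed
  also have "\<dots> \<le> 2 * sqrt (B / Y)"
  proof -
    have "1 - (real q0 / r)\<^sup>2 = (Y - (real q0)\<^sup>2) / Y" using Y r(2) by (simp add: power_divide field_simps)
    also have "\<dots> \<le> B / Y" using Q[OF q(1)] Y by (intro divide_right_mono) auto
    finally show ?thesis by simp
  qed
  finally show ?thesis by simp
qed

lemma sum_inverse_sqrt_int_le:
  fixes Q :: "int set" and A B Y :: real
  assumes fin: "finite Q" and A: "0 < A"
    and Q: "\<And>q. q \<in> Q \<Longrightarrow> A \<le> Y - (real_of_int q)\<^sup>2 \<and> Y - (real_of_int q)\<^sup>2 \<le> B"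
    and "0 < Y" "0 \<le> B"
  shows "(\<Sum>q\<in>Q. 1 / sqrt (Y - (real_of_int q)\<^sup>2)) \<le> 2 * (1 / sqrt A + 2 * sqrt (B / Y))"
proof -
  have half: "(\<Sum>q\<in>T. 1 / sqrt (Y - (real_of_int q)\<^sup>2)) \<le> 1 / sqrt A + 2 * sqrt (B / Y)"
    if T: "T \<subseteq> Q" and s: "\<And>q. q \<in> T \<Longrightarrow> q = s * \<bar>q\<bar>" for T s
  proof -
    have inj: "inj_on (\<lambda>q. nat \<bar>q\<bar>) T"
    proof (rule inj_onI)
      fix x y assume xy: "x \<in> T" "y \<in> T" "nat \<bar>x\<bar> = nat \<bar>y\<bar>"
      then have "\<bar>x\<bar> = \<bar>y\<bar>" by simp
      then show "x = y" using s[OF xy(1)] s[OF xy(2)] by metis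
    qed
    have "(\<Sum>q\<in>T. 1 / sqrt (Y - (real_of_int q)\<^sup>2)) = (\<Sum>q\<in>(\<lambda>q. nat \<bar>q\<bar>) ` T. 1 / sqrt (Y - (real q)\<^sup>2))"
      by (subst sum.reindex[OF inj]) (simp add: o_def)
    also have "\<dots> \<le> 1 / sqrt A + 2 * sqrt (B / Y)"
      using T fin A Q assms(4,5) by (intro sum_inverse_sqrt_nat_le) (auto intro: finite_subset)
    finally show ?thesis .
  qed
  have "(\<Sum>q\<in>Q. 1 / sqrt (Y - (real_of_int q)\<^sup>2))
     = (\<Sum>q\<in>Q \<inter> {0..}. 1 / sqrt (Y - (real_of_int q)\<^sup>2)) + (\<Sum>q\<in>Q \<inter> {..<0}. 1 / sqrt (Y - (real_of_int q)\<^sup>2))"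
    using fin by (subst sum.union_disjoint[symmetric]) (auto intro!: sum.cong)
  also have "\<dots> \<le> (1 / sqrt A + 2 * sqrt (B / Y)) + (1 / sqrt A + 2 * sqrt (B / Y))"
    by (intro add_mono half[of _ 1] half[of _ "- 1"]) auto
  finally show ?thesis by simp
qed

text \<open>The two roots \<open>b\<close> and \<open>a\<close> satisfy \<open>(b - a) (b + a) \<le> 2\<close>.\<close>

lemma emeasure_square_shell_le:
  fixes Z :: real
  assumes "0 < Z"
  shows "emeasure lborel {u::real. Z - 2 \<le> u\<^sup>2 \<and> u\<^sup>2 \<le> Z} \<le> ennreal (4 / sqrt Z)"
proof -
  define b where "b = sqrt Z"
  define a where "a = sqrt (max 0 (Z - 2))"
  have ab: "0 \<le> a" "a \<le> b" "0 < b" "b\<^sup>2 = Z" "a\<^sup>2 = max 0 (Z - 2)"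
    using assms by (auto simp: a_def b_def intro!: real_sqrt_le_mono)
  have "{u::real. Z - 2 \<le> u\<^sup>2 \<and> u\<^sup>2 \<le> Z} \<subseteq> {a..b} \<union> {-b..-a}"
  proof
    fix u :: real assume u: "u \<in> {u::real. Z - 2 \<le> u\<^sup>2 \<and> u\<^sup>2 \<le> Z}"
    have "\<bar>u\<bar> \<le> b" using u ab(3,4) by (intro power2_le_imp_le[of "\<bar>u\<bar>" b]) auto
    moreover have "a \<le> \<bar>u\<bar>" using u ab(5) by (intro power2_le_imp_le[of a "\<bar>u\<bar>"]) auto
    ultimately show "u \<in> {a..b} \<union> {-b..-a}" by auto
  qed
  then have "emeasure lborel {u::real. Z - 2 \<le> u\<^sup>2 \<and> u\<^sup>2 \<le> Z} \<le> emeasure lborel ({a..b} \<union> {-b..-a})"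
    by (intro emeasure_mono) auto
  also have "\<dots> \<le> emeasure lborel {a..b} + emeasure lborel {-b..-a}"
    by (intro emeasure_subadditive) auto
  also have "\<dots> = ennreal (2 * (b - a))" using ab by (simp flip: ennreal_plus)
  also have "\<dots> \<le> ennreal (4 / sqrt Z)"
  proof (intro ennreal_leI)
    have "(b - a) * b \<le> (b - a) * (b + a)" using ab by (intro mult_left_mono) auto
    also have "\<dots> = b\<^sup>2 - a\<^sup>2" by (simp add: power2_eq_square algebra_simps)
    also have "\<dots> \<le> 2" using ab by auto
    finally show "2 * (b - a) \<le> 4 / sqrt Z" using ab by (simp add: b_def[symmetric] field_simps)
  qed
  finally show ?thesis .
qed

lemma emeasure_square_shell_le_2:
  fixes Z :: real
  assumes "Z < 1"
  shows "emeasure lborel {u::real. Z - 2 \<le> u\<^sup>2 \<and> u\<^sup>2 \<le> Z} \<le> ennreal 2"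
proof -
  have "{u::real. Z - 2 \<le> u\<^sup>2 \<and> u\<^sup>2 \<le> Z} \<subseteq> {-1..1}"
  proof
    fix u :: real assume "u \<in> {u::real. Z - 2 \<le> u\<^sup>2 \<and> u\<^sup>2 \<le> Z}"
    then have "\<bar>u\<bar> \<le> 1" using assms by (intro power2_le_imp_le[of "\<bar>u\<bar>" 1]) auto
    then show "u \<in> {-1..1}" by auto
  qed
  then have "emeasure lborel {u::real. Z - 2 \<le> u\<^sup>2 \<and> u\<^sup>2 \<le> Z} \<le> emeasure lborel {-1..1::real}"
    by (intro emeasure_mono) auto
  then show ?thesis by simp
qed

lemma finite_ints_square_le: "finite {q::int. (real_of_int q)\<^sup>2 \<le> Y}"
proof (rule finite_subset)
  show "{q::int. (real_of_int q)\<^sup>2 \<le> Y} \<subseteq> {-\<lceil>\<bar>Y\<bar>\<rceil>..\<lceil>\<bar>Y\<bar>\<rceil>}"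
  proof
    fix q :: int assume q: "q \<in> {q::int. (real_of_int q)\<^sup>2 \<le> Y}"
    have "\<bar>q\<bar> \<le> \<bar>q\<bar> * \<bar>q\<bar>"
      using mult_left_mono[of 1 "\<bar>q\<bar>" "\<bar>q\<bar>"] by (cases "q = 0") auto
    then have "real_of_int \<bar>q\<bar> \<le> real_of_int (\<bar>q\<bar> * \<bar>q\<bar>)" by (simp only: of_int_le_iff)
    also have "\<dots> = (real_of_int q)\<^sup>2" by (simp add: power2_eq_square)
    also have "\<dots> \<le> \<bar>Y\<bar>" using q by simp
    finally have "\<bar>q\<bar> \<le> \<lceil>\<bar>Y\<bar>\<rceil>" by linarith
    then show "q \<in> {-\<lceil>\<bar>Y\<bar>\<rceil>..\<lceil>\<bar>Y\<bar>\<rceil>}" by auto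
  qed
qed simp

lemma nn_integral_count_space_le_sum:
  assumes "finite A" "\<And>x. x \<notin> A \<Longrightarrow> f x = 0" "\<And>x. x \<in> A \<Longrightarrow> f x \<le> ennreal (g x)" "\<And>x. x \<in> A \<Longrightarrow> 0 \<le> g x"
  shows "(\<integral>\<^sup>+x. f x \<partial>count_space UNIV) \<le> ennreal (\<Sum>x\<in>A. g x)"
proof -
  have "(\<integral>\<^sup>+x. f x \<partial>count_space UNIV) = (\<Sum>x\<in>A. f x)"
    using assms by (intro nn_integral_count_space') auto
  also have "\<dots> \<le> (\<Sum>x\<in>A. ennreal (g x))" by (intro sum_mono assms)
  also have "\<dots> = ennreal (\<Sum>x\<in>A. g x)" by (rule sum_ennreal) (use assms in auto)
  finally show ?thesis .
qed

lemma sum_le_nn_integral_count_space: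
  fixes f :: "'a \<Rightarrow> ennreal"
  assumes "finite B"
  shows "(\<Sum>x\<in>B. f x) \<le> (\<integral>\<^sup>+x. f x \<partial>count_space UNIV)"
proof -
  have "(\<integral>\<^sup>+x. f x * indicator B x \<partial>count_space UNIV) = (\<Sum>x\<in>B. f x * indicator B x)"
    using assms by (intro nn_integral_count_space') auto
  moreover have "(\<integral>\<^sup>+x. f x * indicator B x \<partial>count_space UNIV) \<le> (\<integral>\<^sup>+x. f x \<partial>count_space UNIV)"
    by (intro nn_integral_mono) (simp add: indicator_def)
  ultimately show ?thesis by simp
qed

lemma card_ints_square_window_le_2: "card {q::int. Y - 1 < (real_of_int q)\<^sup>2 \<and> (real_of_int q)\<^sup>2 \<le> Y} \<le> 2"
proof (cases "{q::int. Y - 1 < (real_of_int q)\<^sup>2 \<and> (real_of_int q)\<^sup>2 \<le> Y} = {}")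
  case False
  then obtain q0 :: int where q0: "Y - 1 < (real_of_int q0)\<^sup>2" "(real_of_int q0)\<^sup>2 \<le> Y" by auto
  have "{q::int. Y - 1 < (real_of_int q)\<^sup>2 \<and> (real_of_int q)\<^sup>2 \<le> Y} \<subseteq> {q0, - q0}"
  proof
    fix q :: int assume q: "q \<in> {q::int. Y - 1 < (real_of_int q)\<^sup>2 \<and> (real_of_int q)\<^sup>2 \<le> Y}"
    have "real_of_int (q\<^sup>2) < real_of_int (q0\<^sup>2 + 1)" "real_of_int (q0\<^sup>2) < real_of_int (q\<^sup>2 + 1)"
      using q q0 by auto
    then have "q\<^sup>2 < q0\<^sup>2 + 1" "q0\<^sup>2 < q\<^sup>2 + 1" by (simp_all only: of_int_less_iff)
    then have "q\<^sup>2 = q0\<^sup>2" by simp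
    then show "q \<in> {q0, - q0}" by (simp add: power2_eq_iff)
  qed
  then have "card {q::int. Y - 1 < (real_of_int q)\<^sup>2 \<and> (real_of_int q)\<^sup>2 \<le> Y} \<le> card {q0, - q0}"
    by (intro card_mono) auto
  also have "\<dots> \<le> 2" by (simp add: card_insert_if)
  finally show ?thesis .
next
  case True
  show ?thesis unfolding True by simp
qed

text \<open>A circular shell that is thin in the squared radius has bounded area, and this persists when one
coordinate is an integer. The columns at \<open>q\<^sup>2 \<le> Y - 1\<close> are summed with the arcsine bound; at most
two integers \<open>q\<close> remain, next to the tangent points, and their columns are short.\<close>

lemma circle_shell_le:
  fixes X :: real
  shows "(\<integral>\<^sup>+q. emeasure lborel {u::real. X \<le> (real_of_int q)\<^sup>2 + u\<^sup>2 \<and> (real_of_int q)\<^sup>2 + u\<^sup>2 \<le> X + 2}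
     \<partial>count_space (UNIV :: int set)) \<le> 28"
proof -
  define Y where "Y = X + 2"
  let ?f = "\<lambda>q::int. emeasure lborel {u::real. X \<le> (real_of_int q)\<^sup>2 + u\<^sup>2 \<and> (real_of_int q)\<^sup>2 + u\<^sup>2 \<le> X + 2}"
  have shift: "{u::real. X \<le> (real_of_int q)\<^sup>2 + u\<^sup>2 \<and> (real_of_int q)\<^sup>2 + u\<^sup>2 \<le> X + 2}
      = {u. (Y - (real_of_int q)\<^sup>2) - 2 \<le> u\<^sup>2 \<and> u\<^sup>2 \<le> Y - (real_of_int q)\<^sup>2}" for q
    by (auto simp: Y_def)
  define A where "A = {q::int. (real_of_int q)\<^sup>2 \<le> Y - 1}"
  define B where "B = {q::int. Y - 1 < (real_of_int q)\<^sup>2 \<and> (real_of_int q)\<^sup>2 \<le> Y}"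
  define g where "g q = (if q \<in> A then 4 / sqrt (Y - (real_of_int q)\<^sup>2) else 2)" for q :: int
  have fin: "finite A" "finite B" unfolding A_def B_def
    by (rule finite_ints_square_le, rule finite_subset[OF _ finite_ints_square_le[of Y]]) auto
  have "(\<integral>\<^sup>+q. ?f q \<partial>count_space UNIV) \<le> ennreal (\<Sum>q\<in>A \<union> B. g q)"
  proof (rule nn_integral_count_space_le_sum)
    show "?f q = 0" if "q \<notin> A \<union> B" for q
    proof -
      have "Y < (real_of_int q)\<^sup>2" using that by (auto simp: A_def B_def)
      then have "{u. (Y - (real_of_int q)\<^sup>2) - 2 \<le> u\<^sup>2 \<and> u\<^sup>2 \<le> Y - (real_of_int q)\<^sup>2} = {}"
        by (auto simp: not_le) (smt (verit) zero_le_power2)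
      then show ?thesis unfolding shift by (simp only: emeasure_empty)
    qed
    show "?f q \<le> ennreal (g q)" if "q \<in> A \<union> B" for q
      unfolding shift g_def using that
      using emeasure_square_shell_le_2[of "Y - (real_of_int q)\<^sup>2"]
      by (auto simp: A_def B_def intro!: emeasure_square_shell_le)
  qed (use fin in \<open>auto simp: g_def A_def\<close>)
  moreover have "(\<Sum>q\<in>A \<union> B. g q) = (\<Sum>q\<in>A. g q) + (\<Sum>q\<in>B. g q)"
    using fin by (intro sum.union_disjoint) (auto simp: A_def B_def)
  moreover have "(\<Sum>q\<in>A. g q) + (\<Sum>q\<in>B. g q) \<le> 24 + 4"
  proof (intro add_mono)
    have "(\<Sum>q\<in>B. g q) = 2 * card B" by (simp add: g_def A_def B_def)
    then show "(\<Sum>q\<in>B. g q) \<le> 4" using card_ints_square_window_le_2[of Y] by (simp add: B_def)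
    show "(\<Sum>q\<in>A. g q) \<le> 24"
    proof (cases "A = {}")
      case False
      then obtain q where "(real_of_int q)\<^sup>2 \<le> Y - 1" by (auto simp: A_def)
      then have Y: "1 \<le> Y" by (smt (verit) zero_le_power2)
      have "(\<Sum>q\<in>A. g q) = 4 * (\<Sum>q\<in>A. 1 / sqrt (Y - (real_of_int q)\<^sup>2))"
        by (simp add: g_def sum_distrib_left)
      also have "\<dots> \<le> 4 * (2 * (1 / sqrt 1 + 2 * sqrt (Y / Y)))"
        using Y fin by (intro mult_left_mono sum_inverse_sqrt_int_le) (auto simp: A_def)
      also have "\<dots> = 24" using Y by simp
      finally show ?thesis .
    qed simp
  qed
  ultimately have "(\<integral>\<^sup>+q. ?f q \<partial>count_space UNIV) \<le> ennreal 28"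
    by (elim order_trans) (simp add: ennreal_leI flip: ennreal_numeral)
  then show ?thesis by simp
qed

text \<open>At height at least \<open>U0\<close> a column has length \<open>O(1 / U0)\<close>, and the height restriction \<open>U\<close>
confines \<open>q\<close> to an arc of angle \<open>O(U / sqrt Y)\<close>; this is the sum bound with \<open>A = U0\<^sup>2\<close> and
\<open>B = U\<^sup>2 + 2\<close>.\<close>

lemma circle_shell_away_le:
  fixes X U0 U :: real
  assumes U: "1 \<le> U0" "U0 \<le> U"
  shows "(\<integral>\<^sup>+q. emeasure lborel {u::real. U0 \<le> \<bar>u\<bar> \<and> \<bar>u\<bar> \<le> U \<and> X \<le> (real_of_int q)\<^sup>2 + u\<^sup>2 \<and> (real_of_int q)\<^sup>2 + u\<^sup>2 \<le> X + 2}
     \<partial>count_space (UNIV :: int set)) \<le> ennreal (if U0\<^sup>2 \<le> X + 2 then 8 / U0 + 32 * U / sqrt (X + 2) else 0)"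
proof -
  define Y where "Y = X + 2"
  define E where "E q = {u::real. U0 \<le> \<bar>u\<bar> \<and> \<bar>u\<bar> \<le> U \<and> X \<le> (real_of_int q)\<^sup>2 + u\<^sup>2 \<and> (real_of_int q)\<^sup>2 + u\<^sup>2 \<le> X + 2}" for q :: int
  define A where "A = {q::int. U0\<^sup>2 \<le> Y - (real_of_int q)\<^sup>2 \<and> Y - (real_of_int q)\<^sup>2 \<le> U\<^sup>2 + 2}"
  have U02: "1 \<le> U0\<^sup>2" using U by (simp add: one_le_power)
  have inA: "q \<in> A" if "u \<in> E q" for q u
  proof -
    have "U0\<^sup>2 \<le> \<bar>u\<bar>\<^sup>2" "\<bar>u\<bar>\<^sup>2 \<le> U\<^sup>2" using that U by (intro power_mono; simp add: E_def)+
    then show ?thesis using that by (auto simp: A_def E_def Y_def)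
  qed
  have fin: "finite A" unfolding A_def
    by (rule finite_subset[OF _ finite_ints_square_le[of Y]]) (use U02 in auto)
  have "(\<integral>\<^sup>+q. emeasure lborel (E q) \<partial>count_space UNIV) \<le> ennreal (\<Sum>q\<in>A. 4 / sqrt (Y - (real_of_int q)\<^sup>2))"
  proof (rule nn_integral_count_space_le_sum[OF fin])
    show "emeasure lborel (E q) = 0" if "q \<notin> A" for q
    proof -
      have "E q = {}" using inA that by auto
      then show ?thesis by simp
    qed
    show "emeasure lborel (E q) \<le> ennreal (4 / sqrt (Y - (real_of_int q)\<^sup>2))" if "q \<in> A" for q
    proof -
      have "emeasure lborel (E q) \<le> emeasure lborel {u. (Y - (real_of_int q)\<^sup>2) - 2 \<le> u\<^sup>2 \<and> u\<^sup>2 \<le> Y - (real_of_int q)\<^sup>2}"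
        by (intro emeasure_mono) (auto simp: E_def Y_def)
      also have "\<dots> \<le> ennreal (4 / sqrt (Y - (real_of_int q)\<^sup>2))"
        using that U02 by (intro emeasure_square_shell_le) (auto simp: A_def)
      finally show ?thesis .
    qed
    show "0 \<le> 4 / sqrt (Y - (real_of_int q)\<^sup>2)" if "q \<in> A" for q
      using that U02 by (auto simp: A_def)
  qed
  also have "\<dots> \<le> ennreal (if U0\<^sup>2 \<le> Y then 8 / U0 + 32 * U / sqrt Y else 0)"
  proof (cases "U0\<^sup>2 \<le> Y")
    case True
    have "(\<Sum>q\<in>A. 4 / sqrt (Y - (real_of_int q)\<^sup>2)) = 4 * (\<Sum>q\<in>A. 1 / sqrt (Y - (real_of_int q)\<^sup>2))"
      by (simp add: sum_distrib_left)
    also have "\<dots> \<le> 4 * (2 * (1 / sqrt (U0\<^sup>2) + 2 * sqrt ((U\<^sup>2 + 2) / Y)))"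
      using True U02 fin by (intro mult_left_mono sum_inverse_sqrt_int_le) (auto simp: A_def)
    also have "\<dots> = 8 / U0 + 16 * (sqrt (U\<^sup>2 + 2) / sqrt Y)" using U by (simp add: real_sqrt_divide)
    also have "\<dots> \<le> 8 / U0 + 16 * (2 * U / sqrt Y)"
    proof -
      have "1 \<le> U\<^sup>2" using U by (simp add: one_le_power)
      then have "sqrt (U\<^sup>2 + 2) \<le> sqrt ((2 * U)\<^sup>2)" by (intro real_sqrt_le_mono) (simp add: power_mult_distrib)
      also have "\<dots> = 2 * U" using U by (simp only: real_sqrt_abs abs_of_nonneg)
      finally show ?thesis using True U02 by (intro add_left_mono mult_left_mono divide_right_mono) auto
    qed
    finally show ?thesis using True by (simp add: ennreal_leI)
  next
    case False
    then have "A = {}" by (auto simp: A_def) (smt (verit) zero_le_power2)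
    then show ?thesis using False by simp
  qed
  finally show ?thesis unfolding E_def Y_def .
qed

lemma card_ints_ball_le:
  assumes "0 \<le> H"
  shows "finite {p::int. \<bar>of_int p - P\<bar> \<le> H}" "real (card {p::int. \<bar>of_int p - P\<bar> \<le> H}) \<le> 2 * H + 1"
proof -
  have eq: "{p::int. \<bar>of_int p - P\<bar> \<le> H} = {\<lceil>P - H\<rceil>..\<lfloor>P + H\<rfloor>}"
    by (auto simp: abs_le_iff ceiling_le_iff le_floor_iff)
  show "finite {p::int. \<bar>of_int p - P\<bar> \<le> H}" unfolding eq by simp
  have "real_of_int \<lfloor>P + H\<rfloor> \<le> P + H" "P - H \<le> real_of_int \<lceil>P - H\<rceil>" by simp_all
  then show "real (card {p::int. \<bar>of_int p - P\<bar> \<le> H}) \<le> 2 * H + 1"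
    unfolding eq using assms by (cases "\<lfloor>P + H\<rfloor> - \<lceil>P - H\<rceil> + 1 \<ge> 0") (simp_all, linarith)
qed

text \<open>A pair of frequencies with sum \<open>(\<eta>, p)\<close> and difference \<open>(u, q)\<close> satisfies
\<open>2 (|\<xi>|\<^sup>2 + |\<zeta>|\<^sup>2) = \<eta>\<^sup>2 + p\<^sup>2 + q\<^sup>2 + u\<^sup>2\<close>; the thickness \<open>2\<close> corresponds to a unit interval for
\<open>|\<xi>|\<^sup>2 + |\<zeta>|\<^sup>2\<close>.\<close>

definition shell_slice :: "real \<Rightarrow> real \<Rightarrow> int \<Rightarrow> int \<Rightarrow> real set" where
  "shell_slice R U p q = {u. \<bar>u\<bar> \<le> U \<and> R \<le> (of_int p)\<^sup>2 + (of_int q)\<^sup>2 + u\<^sup>2 \<and> (of_int p)\<^sup>2 + (of_int q)\<^sup>2 + u\<^sup>2 \<le> R + 2}"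

lemma shell_slice_measurable [measurable, simp]: "shell_slice R U p q \<in> sets borel"
  unfolding shell_slice_def by measurable

lemma shell_slice_row_le:
  "(\<integral>\<^sup>+q. emeasure lborel (shell_slice R U p q) \<partial>count_space UNIV) \<le> 28"
proof -
  have "(\<integral>\<^sup>+q. emeasure lborel (shell_slice R U p q) \<partial>count_space UNIV)
    \<le> (\<integral>\<^sup>+q. emeasure lborel {u::real. R - (of_int p)\<^sup>2 \<le> (real_of_int q)\<^sup>2 + u\<^sup>2 \<and> (real_of_int q)\<^sup>2 + u\<^sup>2 \<le> (R - (of_int p)\<^sup>2) + 2}
      \<partial>count_space UNIV)"
    by (intro nn_integral_mono emeasure_mono) (auto simp: shell_slice_def)
  also have "\<dots> \<le> 28" by (rule circle_shell_le)
  finally show ?thesis .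
qed

lemma shell_slice_rows_le:
  assumes "finite A"
  shows "(\<Sum>p\<in>A. \<integral>\<^sup>+q. emeasure lborel (shell_slice R U p q) \<partial>count_space UNIV) \<le> ennreal (28 * real (card A))"
proof -
  have "(\<Sum>p\<in>A. \<integral>\<^sup>+q. emeasure lborel (shell_slice R U p q) \<partial>count_space UNIV) \<le> (\<Sum>p\<in>A. ennreal 28)"
    using shell_slice_row_le by (intro sum_mono) simp
  also have "\<dots> = ennreal (28 * real (card A))"
    by (simp add: ennreal_mult mult.commute ennreal_of_nat_eq_real_of_nat)
  finally show ?thesis .
qed

text \<open>Here \<open>u\<close> is fixed first: then \<open>p\<^sup>2 + q\<^sup>2\<close> lies in an interval of length \<open>2\<close>, which contains at
most three integers, and integrating over \<open>|u| \<le> U\<close> costs \<open>2 U\<close>.\<close>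

lemma shell_slices_near_le:
  assumes count: "\<And>n. real (card {(p, q) \<in> circle_points n. p \<in> A \<and> q \<in> B}) \<le> K"
    and fin: "finite A" "finite B" and U: "0 \<le> U"
  shows "(\<Sum>p\<in>A. \<Sum>q\<in>B. emeasure lborel (shell_slice R U p q)) \<le> ennreal (6 * K * U)"
proof -
  have K: "0 \<le> K" using count[of 0] by (rule order_trans[rotated]) simp
  define E where "E = (\<lambda>(p, q). shell_slice R U p q)"
  have E[measurable, simp]: "E z \<in> sets borel" for z unfolding E_def by (cases z) simp
  have pt: "(\<Sum>z\<in>A \<times> B. indicator (E z) u) \<le> ennreal (3 * K) * indicator {-U..U} u" for u
  proof (cases "u \<in> {-U..U}")
    case False
    then have "indicator (E z) u = (0::ennreal)" for z
      by (cases z) (auto simp: E_def shell_slice_def indicator_def)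
    then show ?thesis by simp
  next
    case True
    define T where "T = R - u\<^sup>2"
    define J where "J = {\<lceil>T\<rceil>..\<lceil>T\<rceil> + 2}"
    let ?F = "\<lambda>n. {(p, q) \<in> circle_points n. p \<in> A \<and> q \<in> B}"
    have sub: "{z \<in> A \<times> B. u \<in> E z} \<subseteq> (\<Union>n\<in>J. ?F n)"
    proof
      fix z assume z: "z \<in> {z \<in> A \<times> B. u \<in> E z}"
      obtain p q where pq: "z = (p, q)" by (cases z)
      have m: "p \<in> A" "q \<in> B" "T \<le> real_of_int (p\<^sup>2 + q\<^sup>2)" "real_of_int (p\<^sup>2 + q\<^sup>2) \<le> T + 2"
        using z unfolding pq T_def E_def shell_slice_def by auto
      have "real_of_int (p\<^sup>2 + q\<^sup>2) \<le> real_of_int (\<lceil>T\<rceil> + 2)"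
        using m(4) le_of_int_ceiling[of T] by (simp only: of_int_add of_int_numeral)
      then have "p\<^sup>2 + q\<^sup>2 \<le> \<lceil>T\<rceil> + 2" by (simp only: of_int_le_iff)
      moreover have "\<lceil>T\<rceil> \<le> p\<^sup>2 + q\<^sup>2" using m(3) by (simp only: ceiling_le_iff)
      ultimately have "p\<^sup>2 + q\<^sup>2 \<in> J" unfolding J_def by simp
      then show "z \<in> (\<Union>n\<in>J. ?F n)" using m unfolding pq circle_points_def by auto
    qed
    have finF: "finite (?F n)" for n by (rule finite_subset[of _ "A \<times> B"]) (use fin in auto)
    have "real (card {z \<in> A \<times> B. u \<in> E z}) \<le> real (card (\<Union>n\<in>J. ?F n))"
      using sub finF by (intro of_nat_mono card_mono) (auto simp: J_def)
    also have "\<dots> \<le> real (\<Sum>n\<in>J. card (?F n))"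
      by (intro of_nat_mono card_UN_le) (simp add: J_def)
    also have "\<dots> = (\<Sum>n\<in>J. real (card (?F n)))" by simp
    also have "\<dots> \<le> (\<Sum>n\<in>J. K)" by (intro sum_mono count)
    also have "\<dots> = 3 * K" by (simp add: J_def)
    finally have c: "real (card {z \<in> A \<times> B. u \<in> E z}) \<le> 3 * K" .
    have "(\<Sum>z\<in>A \<times> B. indicator (E z) u) = (\<Sum>z\<in>{z \<in> A \<times> B. u \<in> E z}. 1::ennreal)"
      using fin by (simp add: sum.inter_filter indicator_def of_bool_def del: sum_constant)
    also have "\<dots> = ennreal (real (card {z \<in> A \<times> B. u \<in> E z}))"
      by (simp add: ennreal_of_nat_eq_real_of_nat)
    also have "\<dots> \<le> ennreal (3 * K)" using c by (rule ennreal_leI)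
    finally show ?thesis using True by simp
  qed
  have "(\<Sum>p\<in>A. \<Sum>q\<in>B. emeasure lborel (shell_slice R U p q)) = (\<Sum>z\<in>A \<times> B. emeasure lborel (E z))"
    by (simp add: sum.cartesian_product E_def case_prod_beta)
  also have "\<dots> = (\<Sum>z\<in>A \<times> B. \<integral>\<^sup>+u. indicator (E z) u \<partial>lborel)"
    by (simp add: nn_integral_indicator)
  also have "\<dots> = (\<integral>\<^sup>+u. (\<Sum>z\<in>A \<times> B. indicator (E z) u) \<partial>lborel)"
    by (rule nn_integral_sum[symmetric]) measurable
  also have "\<dots> \<le> (\<integral>\<^sup>+u. ennreal (3 * K) * indicator {-U..U} u \<partial>lborel)"
    by (intro nn_integral_mono pt)
  also have "\<dots> = ennreal (3 * K) * ennreal (2 * U)"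
    using U by (subst nn_integral_cmult_indicator) auto
  also have "\<dots> = ennreal (6 * K * U)" using K U by (simp flip: ennreal_mult)
  finally show ?thesis .
qed

text \<open>The rows are summed by a second use of the arcsine bound, now in the variable \<open>p\<close>: the sum of
\<open>1 / sqrt (Y - p\<^sup>2)\<close> over the rows that are reached is bounded.\<close>

lemma shell_slices_away_le:
  fixes U0 U :: real
  assumes U: "1 \<le> U0" "U0 \<le> U" and fin: "finite A"
  shows "(\<Sum>p\<in>A. \<integral>\<^sup>+q. emeasure lborel (shell_slice R U p q \<inter> {u. U0 \<le> \<bar>u\<bar>}) \<partial>count_space UNIV)
    \<le> ennreal (8 * real (card A) / U0 + 192 * U)"
proof -
  define Y where "Y = R + 2"
  define g where "g p = (if U0\<^sup>2 \<le> Y - (of_int p)\<^sup>2 then 8 / U0 + 32 * U / sqrt (Y - (of_int p)\<^sup>2) else 0)" for p :: int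
  have U02: "1 \<le> U0\<^sup>2" using U by (simp add: one_le_power)
  have g0: "0 \<le> g p" for p
  proof -
    have "0 \<le> Y - (of_int p)\<^sup>2" if "U0\<^sup>2 \<le> Y - (real_of_int p)\<^sup>2" using that U02 by linarith
    then show ?thesis unfolding g_def using U by simp
  qed
  have "(\<Sum>p\<in>A. \<integral>\<^sup>+q. emeasure lborel (shell_slice R U p q \<inter> {u. U0 \<le> \<bar>u\<bar>}) \<partial>count_space UNIV) \<le> (\<Sum>p\<in>A. ennreal (g p))"
  proof (rule sum_mono)
    fix p assume "p \<in> A"
    have "(\<integral>\<^sup>+q. emeasure lborel (shell_slice R U p q \<inter> {u. U0 \<le> \<bar>u\<bar>}) \<partial>count_space UNIV)
      \<le> (\<integral>\<^sup>+q. emeasure lborel {u::real. U0 \<le> \<bar>u\<bar> \<and> \<bar>u\<bar> \<le> U \<and> R - (of_int p)\<^sup>2 \<le> (real_of_int q)\<^sup>2 + u\<^sup>2 \<and> (real_of_int q)\<^sup>2 + u\<^sup>2 \<le> (R - (of_int p)\<^sup>2) + 2}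
      \<partial>count_space UNIV)"
      by (intro nn_integral_mono emeasure_mono) (auto simp: shell_slice_def)
    also have "\<dots> \<le> ennreal (g p)"
    proof -
      have "R - (real_of_int p)\<^sup>2 + 2 = Y - (real_of_int p)\<^sup>2" by (simp add: Y_def)
      then show ?thesis
        using circle_shell_away_le[OF U, of "R - (of_int p)\<^sup>2"] unfolding g_def by (simp only:)
    qed
    finally show "(\<integral>\<^sup>+q. emeasure lborel (shell_slice R U p q \<inter> {u. U0 \<le> \<bar>u\<bar>}) \<partial>count_space UNIV) \<le> ennreal (g p)" .
  qed
  also have "\<dots> = ennreal (\<Sum>p\<in>A. g p)" using g0 by (rule sum_ennreal)
  also have "\<dots> \<le> ennreal (8 * real (card A) / U0 + 192 * U)"
  proof (rule ennreal_leI)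
    define A' where "A' = {p \<in> A. U0\<^sup>2 \<le> Y - (of_int p)\<^sup>2}"
    have fin': "finite A'" using fin by (simp add: A'_def)
    have "(\<Sum>p\<in>A. g p) = (\<Sum>p\<in>A'. 8 / U0 + 32 * U / sqrt (Y - (of_int p)\<^sup>2))"
      unfolding g_def A'_def using fin by (subst sum.inter_filter) auto
    also have "\<dots> = 8 * real (card A') / U0 + 32 * U * (\<Sum>p\<in>A'. 1 / sqrt (Y - (of_int p)\<^sup>2))"
      by (simp add: sum.distrib sum_distrib_left mult.commute)
    also have "\<dots> \<le> 8 * real (card A) / U0 + 32 * U * 6"
    proof (intro add_mono mult_left_mono divide_right_mono)
      show "real (card A') \<le> real (card A)" using fin by (auto simp: A'_def intro!: card_mono)
      show "(\<Sum>p\<in>A'. 1 / sqrt (Y - (of_int p)\<^sup>2)) \<le> 6"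
      proof (cases "A' = {}")
        case False
        then obtain p where "U0\<^sup>2 \<le> Y - (real_of_int p)\<^sup>2" by (auto simp: A'_def)
        then have Y: "1 \<le> Y" using U02 by (smt (verit) zero_le_power2)
        have "(\<Sum>p\<in>A'. 1 / sqrt (Y - (of_int p)\<^sup>2)) \<le> 2 * (1 / sqrt 1 + 2 * sqrt (Y / Y))"
          using fin' Y U02 by (intro sum_inverse_sqrt_int_le) (auto simp: A'_def)
        also have "\<dots> = 6" using Y by simp
        finally show ?thesis .
      qed simp
    qed (use U in auto)
    finally show "(\<Sum>p\<in>A. g p) \<le> 8 * real (card A) / U0 + 192 * U" by simp
  qed
  finally show ?thesis .
qed

text \<open>The shell is cut at height \<open>sqrt L\<close>. Below it the arithmetic bound gives \<open>L\<^bsup>1/2 + \<epsilon>\<^esup>\<close>, and above it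
the \<open>O(L)\<close> rows contribute \<open>O(1 / sqrt L)\<close> each, apart from the term \<open>O(U)\<close>: this height balances
the two.\<close>

lemma shell_box_le:
  fixes \<epsilon> :: real
  assumes \<epsilon>: "\<epsilon> > 0"
  obtains C where "C > 0"
    "\<And>R U P L. 1 \<le> L \<Longrightarrow> 0 \<le> U \<Longrightarrow>
      (\<Sum>p\<in>{p. \<bar>of_int p - P\<bar> \<le> L}. \<Sum>q\<in>{q. \<bar>of_int q\<bar> \<le> L}. emeasure lborel (shell_slice R U p q))
        \<le> ennreal (C * (L powr (1 / 2 + \<epsilon>) + U))"
proof -
  obtain D where D: "D \<ge> 1" "\<And>n P Q L. 1 \<le> L \<Longrightarrow>
       real (card {(p, q) \<in> circle_points n. \<bar>of_int p - P\<bar> \<le> L \<and> \<bar>of_int q - Q\<bar> \<le> L}) \<le> D * L powr \<epsilon>"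
    using card_circle_points_box_le[OF \<epsilon>] by blast
  show thesis
  proof
    \<comment> \<open>\<open>6 D\<close> is for the part below height \<open>sqrt L\<close>; \<open>192\<close> is for the part above, where it also covers the
      \<open>24 sqrt L\<close> that the rows cost.\<close>
    show "6 * D + 192 > 0" using D by simp
    fix R U P L :: real assume L: "1 \<le> L" and U: "0 \<le> U"
    define A where "A = {p::int. \<bar>of_int p - P\<bar> \<le> L}"
    define B where "B = {q::int. \<bar>of_int q\<bar> \<le> L}"
    have fin: "finite A" "finite B" and cA: "real (card A) \<le> 2 * L + 1"
      using card_ints_ball_le[of L P] card_ints_ball_le[of L 0] L by (simp_all add: A_def B_def)
    have cnt: "real (card {(p, q) \<in> circle_points n. p \<in> A \<and> q \<in> B}) \<le> D * L powr \<epsilon>" for n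
      using D(2)[OF L, of n P 0] by (simp add: A_def B_def)
    have sq: "1 \<le> sqrt L" "sqrt L = L powr (1/2)" using L by (simp_all add: powr_half_sqrt)
    have near: "(\<Sum>p\<in>A. \<Sum>q\<in>B. emeasure lborel (shell_slice R (sqrt L) p q)) \<le> ennreal (6 * D * L powr (1 / 2 + \<epsilon>))"
      using shell_slices_near_le[OF cnt fin, of "sqrt L" R] L
      unfolding sq(2) by (simp add: powr_add mult_ac)
    have pw: "sqrt L \<le> L powr (1 / 2 + \<epsilon>)" unfolding sq(2) using L \<epsilon> by (intro powr_mono) auto
    show "(\<Sum>p\<in>A. \<Sum>q\<in>B. emeasure lborel (shell_slice R U p q)) \<le> ennreal ((6 * D + 192) * (L powr (1 / 2 + \<epsilon>) + U))"
    proof (cases "U \<le> sqrt L")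
      case True
      have "(\<Sum>p\<in>A. \<Sum>q\<in>B. emeasure lborel (shell_slice R U p q)) \<le> (\<Sum>p\<in>A. \<Sum>q\<in>B. emeasure lborel (shell_slice R (sqrt L) p q))"
        using True by (intro sum_mono emeasure_mono) (auto simp: shell_slice_def)
      also note near
      also have "ennreal (6 * D * L powr (1 / 2 + \<epsilon>)) \<le> ennreal ((6 * D + 192) * (L powr (1 / 2 + \<epsilon>) + U))"
        using D U by (intro ennreal_leI mult_mono) auto
      finally show ?thesis .
    next
      case False
      have meas: "shell_slice R U p q \<inter> {u. sqrt L \<le> \<bar>u\<bar>} \<in> sets lborel" for p q by measurable
      have "(\<Sum>p\<in>A. \<Sum>q\<in>B. emeasure lborel (shell_slice R U p q))
        \<le> (\<Sum>p\<in>A. \<Sum>q\<in>B. emeasure lborel (shell_slice R (sqrt L) p q) + emeasure lborel (shell_slice R U p q \<inter> {u. sqrt L \<le> \<bar>u\<bar>}))"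
      proof (intro sum_mono)
        fix p q
        have "emeasure lborel (shell_slice R U p q) \<le> emeasure lborel (shell_slice R (sqrt L) p q \<union> (shell_slice R U p q \<inter> {u. sqrt L \<le> \<bar>u\<bar>}))"
          using meas[of p q] by (intro emeasure_mono) (auto simp: shell_slice_def)
        also have "\<dots> \<le> emeasure lborel (shell_slice R (sqrt L) p q) + emeasure lborel (shell_slice R U p q \<inter> {u. sqrt L \<le> \<bar>u\<bar>})"
          using meas[of p q] by (intro emeasure_subadditive) auto
        finally show "emeasure lborel (shell_slice R U p q) \<le> emeasure lborel (shell_slice R (sqrt L) p q) + emeasure lborel (shell_slice R U p q \<inter> {u. sqrt L \<le> \<bar>u\<bar>})" .
      qed
      also have "\<dots> = (\<Sum>p\<in>A. \<Sum>q\<in>B. emeasure lborel (shell_slice R (sqrt L) p q)) + (\<Sum>p\<in>A. \<Sum>q\<in>B. emeasure lborel (shell_slice R U p q \<inter> {u. sqrt L \<le> \<bar>u\<bar>}))"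
        by (simp add: sum.distrib)
      also have "(\<Sum>p\<in>A. \<Sum>q\<in>B. emeasure lborel (shell_slice R U p q \<inter> {u. sqrt L \<le> \<bar>u\<bar>}))
        \<le> (\<Sum>p\<in>A. \<integral>\<^sup>+q. emeasure lborel (shell_slice R U p q \<inter> {u. sqrt L \<le> \<bar>u\<bar>}) \<partial>count_space UNIV)"
      proof (intro sum_mono)
        fix p
        show "(\<Sum>q\<in>B. emeasure lborel (shell_slice R U p q \<inter> {u. sqrt L \<le> \<bar>u\<bar>}))
          \<le> (\<integral>\<^sup>+q. emeasure lborel (shell_slice R U p q \<inter> {u. sqrt L \<le> \<bar>u\<bar>}) \<partial>count_space UNIV)"
          by (rule sum_le_nn_integral_count_space[OF fin(2)])
      qed
      also have "\<dots> \<le> ennreal (8 * real (card A) / sqrt L + 192 * U)"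
        using False sq fin by (intro shell_slices_away_le) auto
      also note near
      also have "ennreal (6 * D * L powr (1 / 2 + \<epsilon>)) + ennreal (8 * real (card A) / sqrt L + 192 * U)
        = ennreal (6 * D * L powr (1 / 2 + \<epsilon>) + (8 * real (card A) / sqrt L + 192 * U))"
        using D U L by (intro ennreal_plus[symmetric]) auto
      also have "\<dots> \<le> ennreal ((6 * D + 192) * (L powr (1 / 2 + \<epsilon>) + U))"
      proof (rule ennreal_leI)
        have "8 * real (card A) / sqrt L \<le> 8 * (3 * L) / sqrt L"
          using cA L by (intro divide_right_mono) auto
        also have "\<dots> = 24 * (L / sqrt L)" by simp
        also have "L / sqrt L = sqrt L" using L by (simp only: real_div_sqrt)
        also have "24 * sqrt L \<le> 24 * L powr (1 / 2 + \<epsilon>)" using pw by simp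
        finally have "8 * real (card A) / sqrt L \<le> 24 * L powr (1 / 2 + \<epsilon>)" .
        moreover have "0 \<le> D * U" using D U by simp
        moreover have "0 \<le> L powr (1 / 2 + \<epsilon>)" by simp
        ultimately show "6 * D * L powr (1 / 2 + \<epsilon>) + (8 * real (card A) / sqrt L + 192 * U) \<le> (6 * D + 192) * (L powr (1 / 2 + \<epsilon>) + U)"
          by (simp only: distrib_left distrib_right)
      qed
      finally show ?thesis by (simp add: add_mono)
    qed
  qed
qed

section \<open>Pairs of frequencies in a truncated strip\<close>

text \<open>Up to a bounded error in \<open>|\<xi>|\<^sup>2 + |\<zeta>|\<^sup>2\<close>, the pairs with the same \<open>\<eta>\<close> are those that interact
in the fourth moment; \<open>m\<close> and \<open>p - m\<close> are the integer coordinates of the two frequencies.\<close>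

definition pair_slice :: "(real \<times> int) set \<Rightarrow> real \<Rightarrow> real \<Rightarrow> int \<Rightarrow> int \<Rightarrow> real set" where
  "pair_slice S W \<eta> p m = {x. (x, m) \<in> S \<and> (\<eta> - x, p - m) \<in> S \<and>
     W \<le> (norm (freq_vec (x, m)))\<^sup>2 + (norm (freq_vec (\<eta> - x, p - m)))\<^sup>2 \<and>
     (norm (freq_vec (x, m)))\<^sup>2 + (norm (freq_vec (\<eta> - x, p - m)))\<^sup>2 \<le> W + 1}"

lemma norm_freq_vec_squared: "(norm (freq_vec (x, m)))\<^sup>2 = x\<^sup>2 + (of_int m)\<^sup>2"
  by (simp add: freq_vec_def norm_Pair)

lemma emeasure_lborel_affine_preimage_le:
  assumes [measurable]: "S \<in> sets borel"
  shows "emeasure lborel {x::real. 2 * x - \<eta> \<in> S} \<le> emeasure lborel S"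
proof -
  have [measurable]: "{x::real. 2 * x - \<eta> \<in> S} \<in> sets borel" by measurable
  have "emeasure lborel S = (\<integral>\<^sup>+x. indicator S x \<partial>lborel)" by simp
  also have "\<dots> = ennreal \<bar>2\<bar> * (\<integral>\<^sup>+x. indicator S (- \<eta> + 2 * x) \<partial>lborel)"
    by (rule nn_integral_real_affine) auto
  also have "(\<integral>\<^sup>+x. indicator S (- \<eta> + 2 * x) \<partial>lborel) = (\<integral>\<^sup>+x. indicator {x. 2 * x - \<eta> \<in> S} x \<partial>lborel)"
    by (intro nn_integral_cong) (auto simp: indicator_def)
  also have "\<dots> = emeasure lborel {x::real. 2 * x - \<eta> \<in> S}" by simp
  finally have e: "emeasure lborel S = 2 * emeasure lborel {x::real. 2 * x - \<eta> \<in> S}" by simp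
  show ?thesis unfolding e by (subst mult_2) simp
qed

lemma nn_integral_count_space_inj_le:
  fixes g :: "'b \<Rightarrow> ennreal"
  assumes "inj f"
  shows "(\<integral>\<^sup>+x. g (f x) \<partial>count_space UNIV) \<le> (\<integral>\<^sup>+y. g y \<partial>count_space UNIV)"
proof -
  have "(\<integral>\<^sup>+x. g (f x) \<partial>count_space UNIV) = (\<integral>\<^sup>+y. g y \<partial>count_space (range f))"
    by (rule nn_integral_bij_count_space) (use assms in \<open>rule inj_on_imp_bij_betw\<close>)
  also have "\<dots> = (\<integral>\<^sup>+y. g y * indicator (range f) y \<partial>count_space UNIV)"
    by (cases "range f = UNIV") (auto simp: nn_integral_count_space_indicator)
  also have "\<dots> \<le> (\<integral>\<^sup>+y. g y \<partial>count_space UNIV)"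
    by (intro nn_integral_mono) (simp add: indicator_def)
  finally show ?thesis .
qed

text \<open>The substitution \<open>u = 2 x - \<eta>\<close>, \<open>q = 2 m - p\<close>. Not every \<open>q\<close> has the parity of \<open>p\<close>, so this only
enlarges the set.\<close>

lemma pair_slices_le_shell_slices:
  assumes fin: "finite A"
    and S: "\<And>x m p. (x, m) \<in> S \<Longrightarrow> (\<eta> - x, p - m) \<in> S \<Longrightarrow>
      p \<in> A \<and> \<bar>2 * x - \<eta>\<bar> \<le> U \<and> \<bar>of_int (2 * m - p)\<bar> \<le> L"
  shows "(\<integral>\<^sup>+p. (\<integral>\<^sup>+m. emeasure lborel (pair_slice S W \<eta> p m) \<partial>count_space UNIV) \<partial>count_space UNIV)
    \<le> (\<Sum>p\<in>A. \<integral>\<^sup>+q. emeasure lborel (shell_slice (2 * W - \<eta>\<^sup>2) U p q) * indicator {q. \<bar>of_int q\<bar> \<le> L} q \<partial>count_space UNIV)"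
proof -
  define R where "R = 2 * W - \<eta>\<^sup>2"
  define G where "G p q = emeasure lborel (shell_slice R U p q) * indicator {q. \<bar>of_int q\<bar> \<le> L} q" for p q
  have pt: "emeasure lborel (pair_slice S W \<eta> p m) \<le> G p (2 * m - p) * indicator A p" for p m
  proof (cases "pair_slice S W \<eta> p m = {}")
    case False
    then obtain x where "(x, m) \<in> S" "(\<eta> - x, p - m) \<in> S" by (auto simp: pair_slice_def)
    then have pA: "p \<in> A" and qL: "\<bar>of_int (2 * m - p)\<bar> \<le> L" using S by blast+
    have "pair_slice S W \<eta> p m \<subseteq> {x. 2 * x - \<eta> \<in> shell_slice R U p (2 * m - p)}"
    proof
      fix x assume x: "x \<in> pair_slice S W \<eta> p m"
      then have "\<bar>2 * x - \<eta>\<bar> \<le> U" using S unfolding pair_slice_def by blast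
      moreover have "(of_int p)\<^sup>2 + (of_int (2 * m - p))\<^sup>2 + (2 * x - \<eta>)\<^sup>2
        = 2 * (x\<^sup>2 + (of_int m)\<^sup>2 + ((\<eta> - x)\<^sup>2 + (of_int (p - m))\<^sup>2)) - \<eta>\<^sup>2"
        by (simp add: power2_eq_square algebra_simps)
      ultimately show "x \<in> {x. 2 * x - \<eta> \<in> shell_slice R U p (2 * m - p)}"
        using x unfolding pair_slice_def shell_slice_def norm_freq_vec_squared R_def by simp
    qed
    then have "emeasure lborel (pair_slice S W \<eta> p m) \<le> emeasure lborel {x. 2 * x - \<eta> \<in> shell_slice R U p (2 * m - p)}"
      by (intro emeasure_mono) measurable
    also have "\<dots> \<le> emeasure lborel (shell_slice R U p (2 * m - p))"
      by (rule emeasure_lborel_affine_preimage_le) simp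
    finally show ?thesis using pA qL by (simp add: G_def)
  qed simp
  have "(\<integral>\<^sup>+p. (\<integral>\<^sup>+m. emeasure lborel (pair_slice S W \<eta> p m) \<partial>count_space UNIV) \<partial>count_space UNIV)
    \<le> (\<integral>\<^sup>+p. (\<integral>\<^sup>+m. G p (2 * m - p) * indicator A p \<partial>count_space UNIV) \<partial>count_space UNIV)"
    by (intro nn_integral_mono pt)
  also have "\<dots> = (\<Sum>p\<in>A. \<integral>\<^sup>+m. G p (2 * m - p) * indicator A p \<partial>count_space UNIV)"
    using fin by (intro nn_integral_count_space') auto
  also have "\<dots> \<le> (\<Sum>p\<in>A. \<integral>\<^sup>+q. G p q \<partial>count_space UNIV)"
  proof (rule sum_mono)
    fix p assume "p \<in> A"
    then have "(\<integral>\<^sup>+m. G p (2 * m - p) * indicator A p \<partial>count_space UNIV) = (\<integral>\<^sup>+m. G p (2 * m - p) \<partial>count_space UNIV)" by simp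
    also have "\<dots> \<le> (\<integral>\<^sup>+q. G p q \<partial>count_space UNIV)"
      by (rule nn_integral_count_space_inj_le) (simp add: inj_def)
    finally show "(\<integral>\<^sup>+m. G p (2 * m - p) * indicator A p \<partial>count_space UNIV) \<le> \<dots>" .
  qed
  finally show ?thesis by (simp add: G_def R_def)
qed

text \<open>The last two bounds are the sum and the difference of the strip conditions for the two
frequencies: one restricts \<open>p\<close> alone, the other ties \<open>2 x - \<eta>\<close> to \<open>2 m - p\<close>.\<close>

lemma freq_region_pair_bounds:
  assumes "(x, m) \<in> freq_region M N a c \<xi>0" "(\<eta> - x, p - m) \<in> freq_region M N a c \<xi>0"
  shows "\<bar>of_int p - 2 * of_int (snd \<xi>0)\<bar> \<le> 2 * N" "\<bar>of_int (2 * m - p)\<bar> \<le> 2 * N" "\<bar>2 * x - \<eta>\<bar> \<le> 2 * N"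
    "\<bar>fst a * \<eta> + snd a * of_int p - 2 * c\<bar> \<le> 2 * M" "\<bar>fst a * (2 * x - \<eta>) + snd a * of_int (2 * m - p)\<bar> \<le> 2 * M"
proof -
  have b: "\<bar>y - fst \<xi>0\<bar> \<le> N \<and> \<bar>of_int k - of_int (snd \<xi>0)\<bar> \<le> N \<and> \<bar>fst a * y + snd a * of_int k - c\<bar> \<le> M"
    if "(y, k) \<in> freq_region M N a c \<xi>0" for y k
  proof -
    have n: "norm (freq_vec (y, k) - freq_vec \<xi>0) \<le> N" and i: "\<bar>a \<bullet> freq_vec (y, k) - c\<bar> \<le> M"
      using that by (auto simp: freq_region_def)
    have "\<bar>y - fst \<xi>0\<bar> \<le> N"
      using norm_fst_le[of "y - fst \<xi>0" "real_of_int k - of_int (snd \<xi>0)"] n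
      by (simp add: freq_vec_def)
    moreover have "\<bar>of_int k - of_int (snd \<xi>0)\<bar> \<le> N"
      using norm_snd_le[of "real_of_int k - of_int (snd \<xi>0)" "y - fst \<xi>0"] n
      by (simp add: freq_vec_def)
    ultimately show ?thesis using i by (simp add: inner_prod_def freq_vec_def)
  qed
  note b1 = b[OF assms(1)] and b2 = b[OF assms(2)]
  show "\<bar>of_int p - 2 * of_int (snd \<xi>0)\<bar> \<le> 2 * N" "\<bar>of_int (2 * m - p)\<bar> \<le> 2 * N" "\<bar>2 * x - \<eta>\<bar> \<le> 2 * N"
    using b1 b2 by auto
  define X Y where "X = fst a * x + snd a * of_int m" and "Y = fst a * (\<eta> - x) + snd a * of_int (p - m)"
  have XY: "\<bar>X - c\<bar> \<le> M" "\<bar>Y - c\<bar> \<le> M" using b1 b2 by (auto simp: X_def Y_def)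
  have "fst a * \<eta> + snd a * of_int p - 2 * c = X + Y - 2 * c"
    "fst a * (2 * x - \<eta>) + snd a * of_int (2 * m - p) = X - Y"
    by (simp_all add: X_def Y_def algebra_simps)
  then show "\<bar>fst a * \<eta> + snd a * of_int p - 2 * c\<bar> \<le> 2 * M"
    "\<bar>fst a * (2 * x - \<eta>) + snd a * of_int (2 * m - p)\<bar> \<le> 2 * M"
    using XY by linarith+
qed

text \<open>The threshold \<open>|a\<^sub>2|\<^sup>2 = M / N\<close> balances the number \<open>O(M / |a\<^sub>2| + 1)\<close> of rows that meet the
strip against the height \<open>O(M + |a\<^sub>2| N)\<close> to which the strip confines the shell when \<open>|a\<^sub>1|\<close> is
bounded below. Both are \<open>O((MN)\<^bsup>1/2\<^esup>)\<close>.\<close>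

lemma freq_region_pair_count:
  fixes \<delta> :: real
  assumes \<delta>: "0 < \<delta>" "\<delta> < 1 / 8"
  obtains C where "C > 0"
    "\<And>M N a c \<xi>0 W \<eta>. 1 \<le> M \<Longrightarrow> M \<le> N \<Longrightarrow> norm a = 1 \<Longrightarrow>
      (\<integral>\<^sup>+p. (\<integral>\<^sup>+m. emeasure lborel (pair_slice (freq_region M N a c \<xi>0) W \<eta> p m) \<partial>count_space UNIV) \<partial>count_space UNIV)
        \<le> ennreal (C * ((M / N) powr (4 * \<delta>) * N))"
proof -
  define \<epsilon> where "\<epsilon> = 1 / 2 - 4 * \<delta>"
  have \<epsilon>: "\<epsilon> > 0" using \<delta> by (simp add: \<epsilon>_def)
  obtain D where D: "D > 0" "\<And>R U P L. 1 \<le> L \<Longrightarrow> 0 \<le> U \<Longrightarrow>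
      (\<Sum>p\<in>{p. \<bar>of_int p - P\<bar> \<le> L}. \<Sum>q\<in>{q. \<bar>of_int q\<bar> \<le> L}. emeasure lborel (shell_slice R U p q))
        \<le> ennreal (D * (L powr (1 / 2 + \<epsilon>) + U))"
    using shell_box_le[OF \<epsilon>] by blast
  show thesis
  proof
    \<comment> \<open>The two cases that count rows cost \<open>28 \<cdot> 5\<close> and \<open>28 \<cdot> 10\<close>; the case of bounded height costs \<open>8 D\<close>.\<close>
    show "0 < 280 + 8 * D" using D by simp
    fix M N c W \<eta> :: real and a :: "real \<times> real" and \<xi>0 :: "real \<times> int"
    assume M: "1 \<le> M" and MN: "M \<le> N" and a: "norm a = 1"
    define S where "S = freq_region M N a c \<xi>0"
    define I where "I = (\<integral>\<^sup>+p. (\<integral>\<^sup>+m. emeasure lborel (pair_slice S W \<eta> p m) \<partial>count_space UNIV) \<partial>count_space UNIV)"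
    define R where "R = 2 * W - \<eta>\<^sup>2"
    define H where "H = (M / N) powr (4 * \<delta>) * N"
    have N: "1 \<le> N" using M MN by simp
    note bounds = freq_region_pair_bounds[of _ _ M N a c \<xi>0, folded S_def]
    have a2: "(fst a)\<^sup>2 + (snd a)\<^sup>2 = 1" using a by (simp add: norm_prod_def)
    have sMN: "sqrt (M * N) \<le> H"
    proof -
      have "sqrt (M * N) = sqrt (M / N) * N" using N M by (simp add: real_sqrt_divide real_sqrt_mult field_simps)
      also have "\<dots> = (M / N) powr (1 / 2) * N" using N M by (simp add: powr_half_sqrt)
      also have "\<dots> \<le> (M / N) powr (4 * \<delta>) * N"
        using N M MN \<delta> by (intro mult_right_mono powr_mono') auto
      finally show ?thesis by (simp add: H_def)
    qed
    have Nle: "(2 * N) powr (1 / 2 + \<epsilon>) \<le> 2 * H"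
    proof -
      have "(2 * N) powr (1 / 2 + \<epsilon>) = 2 powr (1 - 4 * \<delta>) * N powr (1 - 4 * \<delta>)"
        using N by (simp add: \<epsilon>_def powr_mult)
      also have "\<dots> \<le> 2 powr 1 * ((M / N) powr (4 * \<delta>) * N)"
      proof (intro mult_mono)
        have "N powr (1 - 4 * \<delta>) = (1 / N) powr (4 * \<delta>) * N"
          using N by (simp add: powr_diff powr_divide)
        also have "\<dots> \<le> (M / N) powr (4 * \<delta>) * N"
          using N M \<delta> by (intro mult_right_mono powr_mono2 divide_right_mono) auto
        finally show "N powr (1 - 4 * \<delta>) \<le> (M / N) powr (4 * \<delta>) * N" .
      qed (use \<delta> N powr_mono[of "1 - 4 * \<delta>" 1 2] in auto)
      finally show ?thesis by (simp add: H_def)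
    qed
    have sq1: "1 \<le> sqrt (M * N)" using M N by (simp add: mult_ge1_I)
    have "1 \<le> H" using sq1 sMN by (rule order_trans)
    then have DH: "0 \<le> D * H" "1 \<le> H" using D(1) by simp_all
    have rows: "I \<le> ennreal (28 * real (card A))"
      if fin: "finite A" and A: "\<And>x m p. (x, m) \<in> S \<Longrightarrow> (\<eta> - x, p - m) \<in> S \<Longrightarrow> p \<in> A" for A
    proof -
      have "I \<le> (\<Sum>p\<in>A. \<integral>\<^sup>+q. emeasure lborel (shell_slice R (2 * N) p q) * indicator {q. \<bar>of_int q\<bar> \<le> 2 * N} q \<partial>count_space UNIV)"
        unfolding I_def R_def using A bounds by (intro pair_slices_le_shell_slices fin) blast
      also have "\<dots> \<le> (\<Sum>p\<in>A. \<integral>\<^sup>+q. emeasure lborel (shell_slice R (2 * N) p q) \<partial>count_space UNIV)"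
        by (intro sum_mono nn_integral_mono) (simp add: indicator_def)
      also have "\<dots> \<le> ennreal (28 * real (card A))" by (rule shell_slice_rows_le[OF fin])
      finally show ?thesis .
    qed
    have "I \<le> ennreal ((280 + 8 * D) * H)"
    proof (cases "M \<le> N * (snd a)\<^sup>2")
      case True
      have sa: "\<bar>snd a\<bar> > 0" using True M by (cases "snd a = 0") auto
      define A where "A = {p. \<bar>of_int p - (2 * c - fst a * \<eta>) / snd a\<bar> \<le> 2 * M / \<bar>snd a\<bar>}"
      have "M / \<bar>snd a\<bar> \<le> sqrt (M * N)"
      proof -
        have "(M / \<bar>snd a\<bar>)\<^sup>2 = M * (M / (snd a)\<^sup>2)" by (simp add: power_divide power2_eq_square)
        also have "\<dots> \<le> M * N" using True M sa by (intro mult_left_mono) (auto simp: pos_divide_le_eq)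
        finally have "sqrt ((M / \<bar>snd a\<bar>)\<^sup>2) \<le> sqrt (M * N)" by (rule real_sqrt_le_mono)
        then show ?thesis using M sa by simp
      qed
      moreover have "finite A" and "real (card A) \<le> 2 * (2 * M / \<bar>snd a\<bar>) + 1"
        unfolding A_def using M sa by (intro card_ints_ball_le; simp)+
      moreover have "2 * (2 * M / \<bar>snd a\<bar>) = 4 * (M / \<bar>snd a\<bar>)" by simp
      ultimately have cA: "real (card A) \<le> 5 * sqrt (M * N)" using sq1 by linarith
      have "I \<le> ennreal (28 * real (card A))"
      proof (rule rows[OF \<open>finite A\<close>])
        fix x m p assume "(x, m) \<in> S" "(\<eta> - x, p - m) \<in> S"
        then have "\<bar>fst a * \<eta> + snd a * of_int p - 2 * c\<bar> \<le> 2 * M" by (rule bounds(4))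
        moreover have "of_int p - (2 * c - fst a * \<eta>) / snd a = (fst a * \<eta> + snd a * of_int p - 2 * c) / snd a"
          using sa by (simp add: field_simps)
        ultimately show "p \<in> A" unfolding A_def using sa by (simp add: abs_divide divide_right_mono)
      qed
      also have "\<dots> \<le> ennreal ((280 + 8 * D) * H)"
      proof (rule ennreal_leI)
        have "28 * real (card A) \<le> 28 * (5 * H)" using cA sMN by simp
        also have "\<dots> \<le> (280 + 8 * D) * H" using DH by (simp add: algebra_simps)
        finally show "28 * real (card A) \<le> (280 + 8 * D) * H" .
      qed
      finally show ?thesis .
    next
      case False
      define A where "A = {p::int. \<bar>of_int p - 2 * of_int (snd \<xi>0)\<bar> \<le> 2 * N}"
      have fin: "finite A" and cA: "real (card A) \<le> 2 * (2 * N) + 1"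
        unfolding A_def using N by (intro card_ints_ball_le; simp)+
      show ?thesis
      proof (cases "N \<le> 2 * M")
        case True
        have "I \<le> ennreal (28 * real (card A))"
          using bounds(1) by (intro rows fin) (auto simp: A_def)
        also have "\<dots> \<le> ennreal ((280 + 8 * D) * H)"
        proof (rule ennreal_leI)
          have "N * N \<le> (2 * M) * N" using True N by (intro mult_right_mono) auto
          also have "\<dots> \<le> 4 * (M * N)" using M N by simp
          finally have "sqrt (N * N) \<le> sqrt (4 * (M * N))" by (rule real_sqrt_le_mono)
          then have "N \<le> 2 * sqrt (M * N)" using N by (simp add: real_sqrt_mult)
          then have "28 * real (card A) \<le> 280 * H" using cA N sMN by simp
          also have "\<dots> \<le> (280 + 8 * D) * H" using DH by (simp add: algebra_simps)
          finally show "28 * real (card A) \<le> (280 + 8 * D) * H" .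
        qed
        finally show ?thesis .
      next
        case nle: False
        define B where "B = {q::int. \<bar>of_int q\<bar> \<le> 2 * N}"
        have finB: "finite B" using card_ints_ball_le(1)[of "2 * N" 0] N by (simp add: B_def)
        have a1: "2 / 3 \<le> \<bar>fst a\<bar>"
        proof -
          have "N * (snd a)\<^sup>2 \<le> N * (1 / 2)" using False nle by simp
          then have "(snd a)\<^sup>2 \<le> 1 / 2" using N by simp
          then have "(2 / 3)\<^sup>2 \<le> \<bar>fst a\<bar>\<^sup>2" using a2 by (simp add: power2_eq_square)
          then show ?thesis by (rule power2_le_imp_le) simp
        qed
        have sa: "\<bar>snd a\<bar> * N \<le> sqrt (M * N)"
        proof -
          have "(\<bar>snd a\<bar> * N)\<^sup>2 = (N * (snd a)\<^sup>2) * N" by (simp add: power2_eq_square)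
          also have "\<dots> \<le> M * N" using False N by (intro mult_right_mono) auto
          finally have "sqrt ((\<bar>snd a\<bar> * N)\<^sup>2) \<le> sqrt (M * N)" by (rule real_sqrt_le_mono)
          then show ?thesis using N by simp
        qed
        have MsMN: "M \<le> sqrt (M * N)"
        proof -
          have "sqrt (M * M) \<le> sqrt (M * N)" using M MN by (intro real_sqrt_le_mono mult_left_mono) auto
          then show ?thesis using M by simp
        qed
        have U: "\<bar>2 * x - \<eta>\<bar> \<le> 6 * sqrt (M * N)" if "(x, m) \<in> S" "(\<eta> - x, p - m) \<in> S" for x m p
        proof -
          have "2 / 3 * \<bar>2 * x - \<eta>\<bar> \<le> \<bar>fst a\<bar> * \<bar>2 * x - \<eta>\<bar>" using a1 by (intro mult_right_mono) auto
          also have "\<dots> = \<bar>(fst a * (2 * x - \<eta>) + snd a * of_int (2 * m - p)) - snd a * of_int (2 * m - p)\<bar>"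
            by (simp add: abs_mult)
          also have "\<dots> \<le> \<bar>fst a * (2 * x - \<eta>) + snd a * of_int (2 * m - p)\<bar> + \<bar>snd a * of_int (2 * m - p)\<bar>"
            by (rule abs_triangle_ineq4)
          also have "\<dots> \<le> 2 * M + \<bar>snd a\<bar> * (2 * N)"
            unfolding abs_mult using bounds(2,5)[OF that] by (intro add_mono mult_left_mono) auto
          also have "\<dots> \<le> 4 * sqrt (M * N)" using sa MsMN by simp
          finally show ?thesis by simp
        qed
        have "I \<le> (\<Sum>p\<in>A. \<integral>\<^sup>+q. emeasure lborel (shell_slice R (6 * sqrt (M * N)) p q) * indicator {q. \<bar>of_int q\<bar> \<le> 2 * N} q \<partial>count_space UNIV)"
          unfolding I_def R_def using U bounds by (intro pair_slices_le_shell_slices fin) (auto simp: A_def)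
        also have "\<dots> = (\<Sum>p\<in>A. \<Sum>q\<in>B. emeasure lborel (shell_slice R (6 * sqrt (M * N)) p q))"
        proof (intro sum.cong refl)
          fix p
          have "(\<integral>\<^sup>+q. emeasure lborel (shell_slice R (6 * sqrt (M * N)) p q) * indicator B q \<partial>count_space UNIV)
            = (\<Sum>q\<in>B. emeasure lborel (shell_slice R (6 * sqrt (M * N)) p q) * indicator B q)"
            using finB by (intro nn_integral_count_space') auto
          then show "(\<integral>\<^sup>+q. emeasure lborel (shell_slice R (6 * sqrt (M * N)) p q) * indicator {q. \<bar>of_int q\<bar> \<le> 2 * N} q \<partial>count_space UNIV)
            = (\<Sum>q\<in>B. emeasure lborel (shell_slice R (6 * sqrt (M * N)) p q))"
            by (simp add: B_def)
        qed
        also have "\<dots> \<le> ennreal (D * ((2 * N) powr (1 / 2 + \<epsilon>) + 6 * sqrt (M * N)))"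
          unfolding A_def B_def using N sq1 by (intro D(2)) auto
        also have "\<dots> \<le> ennreal ((280 + 8 * D) * H)"
        proof (rule ennreal_leI)
          have "D * ((2 * N) powr (1 / 2 + \<epsilon>) + 6 * sqrt (M * N)) \<le> D * (8 * H)"
            using Nle sMN D by (intro mult_left_mono) auto
          also have "\<dots> \<le> (280 + 8 * D) * H" using DH by (simp add: algebra_simps)
          finally show "D * ((2 * N) powr (1 / 2 + \<epsilon>) + 6 * sqrt (M * N)) \<le> (280 + 8 * D) * H" .
        qed
        finally show ?thesis .
      qed
    qed
    then show "(\<integral>\<^sup>+p. (\<integral>\<^sup>+m. emeasure lborel (pair_slice (freq_region M N a c \<xi>0) W \<eta> p m) \<partial>count_space UNIV) \<partial>count_space UNIV)
        \<le> ennreal ((280 + 8 * D) * ((M / N) powr (4 * \<delta>) * N))"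
      unfolding I_def S_def H_def .
  qed
qed

section \<open>Gaussian integrals and a Schur test for extension operators\<close>

text \<open>The characteristic function of the standard normal distribution, rescaled.\<close>

lemma integral_gauss_iexp:
  fixes \<epsilon> b :: real
  assumes \<epsilon>: "0 < \<epsilon>"
  shows "(LINT x|lborel. exp (- \<epsilon> * x\<^sup>2) *\<^sub>R exp (\<i> * of_real (b * x)))
    = complex_of_real (sqrt (pi / \<epsilon>) * exp (- b\<^sup>2 / (4 * \<epsilon>)))"
proof -
  define s where "s = sqrt (2 * \<epsilon>)"
  have s: "0 < s" "s\<^sup>2 = 2 * \<epsilon>" using \<epsilon> by (auto simp: s_def)
  define t where "t = b / s"
  have "complex_of_real (exp (- t\<^sup>2 / 2)) = char std_normal_distribution t"
    by (simp add: char_std_normal_distribution)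
  also have "\<dots> = (LINT x|lborel. std_normal_density x *\<^sub>R exp (\<i> * of_real (t * x)))"
    unfolding char_def by (subst integral_density) auto
  also have "\<dots> = \<bar>s\<bar> *\<^sub>R (LINT x|lborel. std_normal_density (0 + s * x) *\<^sub>R exp (\<i> * of_real (t * (0 + s * x))))"
    using s by (intro lborel_integral_real_affine) auto
  also have "(\<lambda>x. std_normal_density (0 + s * x) *\<^sub>R exp (\<i> * of_real (t * (0 + s * x))))
    = (\<lambda>x. (1 / sqrt (2 * pi)) *\<^sub>R (exp (- \<epsilon> * x\<^sup>2) *\<^sub>R exp (\<i> * of_real (b * x))))"
  proof
    fix x
    have 1: "- (s * x)\<^sup>2 / 2 = - \<epsilon> * x\<^sup>2" using s by (simp add: power_mult_distrib)
    have 2: "t * (s * x) = b * x" using s by (simp add: t_def)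
    show "std_normal_density (0 + s * x) *\<^sub>R exp (\<i> * of_real (t * (0 + s * x)))
      = (1 / sqrt (2 * pi)) *\<^sub>R (exp (- \<epsilon> * x\<^sup>2) *\<^sub>R exp (\<i> * of_real (b * x)))"
      unfolding std_normal_density_def add_0 1 2 by simp
  qed
  also have "(LINT x|lborel. (1 / sqrt (2 * pi)) *\<^sub>R (exp (- \<epsilon> * x\<^sup>2) *\<^sub>R exp (\<i> * of_real (b * x))))
    = (1 / sqrt (2 * pi)) *\<^sub>R (LINT x|lborel. exp (- \<epsilon> * x\<^sup>2) *\<^sub>R exp (\<i> * of_real (b * x)))"
    by (rule integral_scaleR_right)
  finally have e: "complex_of_real (exp (- t\<^sup>2 / 2)) = (s / sqrt (2 * pi)) *\<^sub>R (LINT x|lborel. exp (- \<epsilon> * x\<^sup>2) *\<^sub>R exp (\<i> * of_real (b * x)))"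
    using s by simp
  have c: "sqrt (pi / \<epsilon>) * (s / sqrt (2 * pi)) = 1"
    using \<epsilon> by (simp add: s_def real_sqrt_mult real_sqrt_divide)
  have "(LINT x|lborel. exp (- \<epsilon> * x\<^sup>2) *\<^sub>R exp (\<i> * of_real (b * x)))
    = sqrt (pi / \<epsilon>) *\<^sub>R ((s / sqrt (2 * pi)) *\<^sub>R (LINT x|lborel. exp (- \<epsilon> * x\<^sup>2) *\<^sub>R exp (\<i> * of_real (b * x))))"
    by (simp only: scaleR_scaleR c scaleR_one)
  also have "\<dots> = sqrt (pi / \<epsilon>) *\<^sub>R complex_of_real (exp (- t\<^sup>2 / 2))" unfolding e ..
  also have "- t\<^sup>2 / 2 = - b\<^sup>2 / (4 * \<epsilon>)" using s by (simp add: t_def power_divide)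
  finally show ?thesis by (simp add: scaleR_conv_of_real)
qed

text \<open>A function that is not integrable has Bochner integral \<open>0\<close>, whereas the integral just computed is
not \<open>0\<close>.\<close>

lemma integrable_gauss:
  fixes \<epsilon> :: real
  assumes \<epsilon>: "0 < \<epsilon>"
  shows "integrable lborel (\<lambda>x. exp (- \<epsilon> * x\<^sup>2))"
proof (rule ccontr)
  assume "\<not> integrable lborel (\<lambda>x. exp (- \<epsilon> * x\<^sup>2))"
  then have "\<not> integrable lborel (\<lambda>x. complex_of_real (exp (- \<epsilon> * x\<^sup>2)))"
    using complex_of_real_integrable_eq by blast
  then have "(LINT x|lborel. complex_of_real (exp (- \<epsilon> * x\<^sup>2))) = 0" by (rule not_integrable_integral_eq)
  moreover have "(LINT x|lborel. complex_of_real (exp (- \<epsilon> * x\<^sup>2))) = complex_of_real (sqrt (pi / \<epsilon>))"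
    using integral_gauss_iexp[OF \<epsilon>, of 0] by (simp add: scaleR_conv_of_real)
  ultimately show False using \<epsilon> by simp
qed

lemma integral_gauss:
  fixes \<epsilon> :: real
  assumes \<epsilon>: "0 < \<epsilon>"
  shows "(LINT x|lborel. exp (- \<epsilon> * x\<^sup>2)) = sqrt (pi / \<epsilon>)"
proof -
  have "complex_of_real (LINT x|lborel. exp (- \<epsilon> * x\<^sup>2)) = (LINT x|lborel. complex_of_real (exp (- \<epsilon> * x\<^sup>2)))"
    by simp
  also have "\<dots> = complex_of_real (sqrt (pi / \<epsilon>))"
    using integral_gauss_iexp[OF \<epsilon>, of 0] by (simp add: scaleR_conv_of_real)
  finally show ?thesis by (simp only: of_real_eq_iff)
qed

lemma nn_integral_gauss_shift:
  fixes \<epsilon> c :: real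
  assumes \<epsilon>: "0 < \<epsilon>"
  shows "(\<integral>\<^sup>+x. ennreal (exp (- \<epsilon> * (c - x)\<^sup>2)) \<partial>lborel) = ennreal (sqrt (pi / \<epsilon>))"
proof -
  have "(\<integral>\<^sup>+x. ennreal (exp (- \<epsilon> * (c - x)\<^sup>2)) \<partial>lborel)
    = ennreal \<bar>- 1\<bar> * (\<integral>\<^sup>+x. ennreal (exp (- \<epsilon> * (c - (c + - 1 * x))\<^sup>2)) \<partial>lborel)"
    by (rule nn_integral_real_affine) auto
  also have "\<dots> = (\<integral>\<^sup>+x. ennreal (exp (- \<epsilon> * x\<^sup>2)) \<partial>lborel)" by simp
  also have "\<dots> = ennreal (LINT x|lborel. exp (- \<epsilon> * x\<^sup>2))"
    using integrable_gauss[OF \<epsilon>] by (intro nn_integral_eq_integral) auto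
  finally show ?thesis by (simp only: integral_gauss[OF \<epsilon>])
qed

lemma borel_measurable_cnj [measurable (raw)]:
  "f \<in> borel_measurable M \<Longrightarrow> (\<lambda>x. cnj (f x)) \<in> borel_measurable M"
  by (rule measurable_compose[OF _ borel_measurable_continuous_onI]) (auto intro: continuous_intros)

text \<open>The \<open>T T*\<close> argument. Expanding the square and integrating over \<open>\<theta>\<close> first gives a quadratic form in
\<open>h\<close> with the kernel that \<open>k\<close> dominates; then \<open>2 |h(y) h(y')| \<le> |h(y)|\<^sup>2 + |h(y')|\<^sup>2\<close> reduces it to
the integrals of \<open>k\<close> in one variable. Only the part of the kernel over the set where \<open>h\<close> does not
vanish is integrated: this is how the localization of the frequencies enters.\<close>

lemma schur_extension_bound:
  fixes \<mu> :: "'b measure" and \<nu> :: "'c measure" and e :: "'c \<Rightarrow> 'b \<Rightarrow> complex"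
    and w :: "'c \<Rightarrow> real" and h :: "'b \<Rightarrow> complex" and k :: "'b \<Rightarrow> 'b \<Rightarrow> ennreal"
  assumes "sigma_finite_measure \<mu>" "sigma_finite_measure \<nu>"
    and e_meas [measurable]: "(\<lambda>(\<theta>, y). e \<theta> y) \<in> borel_measurable (\<nu> \<Otimes>\<^sub>M \<mu>)"
    and e_le: "\<And>\<theta> y. norm (e \<theta> y) \<le> 1"
    and w: "integrable \<nu> w" "\<And>\<theta>. 0 \<le> w \<theta>"
    and h: "integrable \<mu> h"
    and k_meas [measurable]: "(\<lambda>(y, y'). k y y') \<in> borel_measurable (\<mu> \<Otimes>\<^sub>M \<mu>)"
    and k_sym: "\<And>y y'. k y y' = k y' y"
    and k: "\<And>y y'. ennreal (norm (LINT \<theta>|\<nu>. w \<theta> *\<^sub>R (e \<theta> y * cnj (e \<theta> y')))) \<le> k y y'"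
    and A: "\<And>y. (\<integral>\<^sup>+y'. k y y' * indicator {y'. h y' \<noteq> 0} y' \<partial>\<mu>) \<le> A"
  shows "(\<integral>\<^sup>+\<theta>. ennreal (w \<theta> * (norm (LINT y|\<mu>. e \<theta> y * h y))\<^sup>2) \<partial>\<nu>)
    \<le> A * (\<integral>\<^sup>+y. ennreal ((norm (h y))\<^sup>2) \<partial>\<mu>)"
proof -
  let ?P = "\<mu> \<Otimes>\<^sub>M \<mu>"
  interpret \<mu>: sigma_finite_measure \<mu> by fact
  interpret \<nu>: sigma_finite_measure \<nu> by fact
  interpret \<mu>\<mu>: pair_sigma_finite \<mu> \<mu> ..
  have P: "sigma_finite_measure ?P" ..
  interpret P: sigma_finite_measure "\<mu> \<Otimes>\<^sub>M \<mu>" by (rule P)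
  interpret \<nu>P: pair_sigma_finite \<nu> "\<mu> \<Otimes>\<^sub>M \<mu>" ..
  have h_meas [measurable]: "h \<in> borel_measurable \<mu>" using h by auto
  have w_meas [measurable]: "w \<in> borel_measurable \<nu>" using w by auto
  have h1: "(\<integral>\<^sup>+y. ennreal (norm (h y)) \<partial>\<mu>) < \<infinity>" using h by (simp add: integrable_iff_bounded)
  have w1: "(\<integral>\<^sup>+\<theta>. ennreal (w \<theta>) \<partial>\<nu>) < \<infinity>" using w by (simp add: integrable_iff_bounded)
  define F where "F \<theta> = (LINT y|\<mu>. e \<theta> y * h y)" for \<theta>
  have e_meas1 [measurable]: "e \<theta> \<in> borel_measurable \<mu>" if "\<theta> \<in> space \<nu>" for \<theta>
    using measurable_Pair2[OF e_meas that] by simp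
  have eh: "integrable \<mu> (\<lambda>y. e \<theta> y * h y)" if "\<theta> \<in> space \<nu>" for \<theta>
    using that by (intro Bochner_Integration.integrable_bound[OF h])
      (auto simp: norm_mult intro!: mult_left_le_one_le e_le)
  have F_meas [measurable]: "F \<in> borel_measurable \<nu>" unfolding F_def by measurable
  define G where "G \<theta> z = w \<theta> *\<^sub>R ((e \<theta> (fst z) * h (fst z)) * cnj (e \<theta> (snd z) * h (snd z)))" for \<theta> and z :: "'b \<times> 'b"
  have G_meas [measurable]: "(\<lambda>(\<theta>, z). G \<theta> z) \<in> borel_measurable (\<nu> \<Otimes>\<^sub>M ?P)"
    unfolding G_def by measurable
  have G_le: "norm (G \<theta> z) \<le> w \<theta> * (norm (h (fst z)) * norm (h (snd z)))" for \<theta> z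
  proof -
    have "norm (e \<theta> (fst z)) * norm (e \<theta> (snd z)) \<le> 1 * 1" by (intro mult_mono e_le) auto
    then have "w \<theta> * (norm (h (fst z)) * norm (h (snd z))) * (norm (e \<theta> (fst z)) * norm (e \<theta> (snd z)))
       \<le> w \<theta> * (norm (h (fst z)) * norm (h (snd z))) * 1"
      using w(2) by (intro mult_left_mono) auto
    then show ?thesis using w(2) by (simp add: G_def norm_mult mult_ac)
  qed
  have hh: "(\<integral>\<^sup>+z. ennreal (norm (h (fst z)) * norm (h (snd z))) \<partial>?P)
    = (\<integral>\<^sup>+y. ennreal (norm (h y)) \<partial>\<mu>) * (\<integral>\<^sup>+y. ennreal (norm (h y)) \<partial>\<mu>)"
    by (subst \<mu>.nn_integral_fst[symmetric])
       (simp_all add: ennreal_mult nn_integral_cmult nn_integral_multc)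
  have G_int: "integrable (\<nu> \<Otimes>\<^sub>M ?P) (\<lambda>(\<theta>, z). G \<theta> z)"
  proof (rule integrableI_bounded)
    have "(\<integral>\<^sup>+x. ennreal (norm (case x of (\<theta>, z) \<Rightarrow> G \<theta> z)) \<partial>(\<nu> \<Otimes>\<^sub>M ?P))
      \<le> (\<integral>\<^sup>+x. ennreal (w (fst x) * (norm (h (fst (snd x))) * norm (h (snd (snd x))))) \<partial>(\<nu> \<Otimes>\<^sub>M ?P))"
    proof (intro nn_integral_mono ennreal_leI)
      fix x :: "'c \<times> 'b \<times> 'b"
      show "norm (case x of (\<theta>, z) \<Rightarrow> G \<theta> z) \<le> w (fst x) * (norm (h (fst (snd x))) * norm (h (snd (snd x))))"
        using G_le[of "fst x" "snd x"] by (simp add: case_prod_beta)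
    qed
    also have "\<dots> = (\<integral>\<^sup>+\<theta>. ennreal (w \<theta>) \<partial>\<nu>) * (\<integral>\<^sup>+z. ennreal (norm (h (fst z)) * norm (h (snd z))) \<partial>?P)"
      using w(2) by (subst sigma_finite_measure.nn_integral_fst[OF P, symmetric])
         (simp_all add: ennreal_mult' nn_integral_cmult nn_integral_multc)
    also have "\<dots> < \<infinity>" unfolding hh using w1 h1 by (simp add: ennreal_mult_less_top)
    finally show "(\<integral>\<^sup>+x. ennreal (norm (case x of (\<theta>, z) \<Rightarrow> G \<theta> z)) \<partial>(\<nu> \<Otimes>\<^sub>M ?P)) < \<infinity>" .
  qed measurable
  have G_eq: "(LINT z|?P. G \<theta> z) = of_real (w \<theta> * (norm (F \<theta>))\<^sup>2)" if \<theta>: "\<theta> \<in> space \<nu>" for \<theta>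
  proof -
    have i: "integrable ?P (\<lambda>(y, y'). G \<theta> (y, y'))"
    proof (rule integrableI_bounded)
      show "(\<lambda>(y, y'). G \<theta> (y, y')) \<in> borel_measurable ?P"
        using measurable_Pair2[OF G_meas \<theta>] by simp
      have "(\<integral>\<^sup>+x. ennreal (norm (case x of (y, y') \<Rightarrow> G \<theta> (y, y'))) \<partial>?P)
        \<le> (\<integral>\<^sup>+z. ennreal (w \<theta>) * ennreal (norm (h (fst z)) * norm (h (snd z))) \<partial>?P)"
      proof (intro nn_integral_mono)
        fix x :: "'b \<times> 'b"
        show "ennreal (norm (case x of (y, y') \<Rightarrow> G \<theta> (y, y'))) \<le> ennreal (w \<theta>) * ennreal (norm (h (fst x)) * norm (h (snd x)))"
          using G_le[of \<theta> x] w(2) by (simp add: case_prod_beta ennreal_leI flip: ennreal_mult')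
      qed
      also have "\<dots> < \<infinity>" using h1 by (subst nn_integral_cmult) (auto simp: hh ennreal_mult_less_top)
      finally show "(\<integral>\<^sup>+x. ennreal (norm (case x of (y, y') \<Rightarrow> G \<theta> (y, y'))) \<partial>?P) < \<infinity>" .
    qed
    have "(LINT z|?P. G \<theta> z) = (LINT y|\<mu>. LINT y'|\<mu>. G \<theta> (y, y'))"
      using \<mu>\<mu>.integral_fst[OF i] by (simp add: case_prod_beta')
    also have "\<dots> = (LINT y|\<mu>. w \<theta> *\<^sub>R ((e \<theta> y * h y) * (LINT y'|\<mu>. cnj (e \<theta> y' * h y'))))"
      using eh[OF \<theta>] by (simp add: G_def)
    also have "\<dots> = w \<theta> *\<^sub>R (F \<theta> * cnj (F \<theta>))"
    proof -
      have "(LINT y'|\<mu>. cnj (e \<theta> y' * h y')) = cnj (F \<theta>)" unfolding F_def by (rule Bochner_Integration.integral_cnj)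
      then show ?thesis by (simp only: integral_scaleR_right integral_mult_left_zero F_def)
    qed
    finally show ?thesis by (simp add: complex_mult_cnj cmod_power2 scaleR_conv_of_real)
  qed
  have wF: "integrable \<nu> (\<lambda>\<theta>. complex_of_real (w \<theta> * (norm (F \<theta>))\<^sup>2))"
    using \<nu>P.integrable_fst[OF G_int] by (rule Bochner_Integration.integrable_cong[THEN iffD1, rotated 2]) (simp_all add: G_eq)
  define K where "K z = (LINT \<theta>|\<nu>. w \<theta> *\<^sub>R (e \<theta> (fst z) * cnj (e \<theta> (snd z))))" for z
  have GK: "(LINT \<theta>|\<nu>. G \<theta> z) = h (fst z) * cnj (h (snd z)) * K z" for z
  proof -
    have "(\<lambda>\<theta>. G \<theta> z) = (\<lambda>\<theta>. (h (fst z) * cnj (h (snd z))) * (w \<theta> *\<^sub>R (e \<theta> (fst z) * cnj (e \<theta> (snd z)))))"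
      by (simp add: G_def fun_eq_iff mult_ac)
    then show ?thesis unfolding K_def by (simp only: integral_mult_right_zero)
  qed
  have GKi: "integrable ?P (\<lambda>z. h (fst z) * cnj (h (snd z)) * K z)"
    using \<nu>P.integrable_snd[OF G_int] by (simp add: GK)
  have fub: "complex_of_real (LINT \<theta>|\<nu>. w \<theta> * (norm (F \<theta>))\<^sup>2) = (LINT z|?P. h (fst z) * cnj (h (snd z)) * K z)"
  proof -
    have "complex_of_real (LINT \<theta>|\<nu>. w \<theta> * (norm (F \<theta>))\<^sup>2) = (LINT \<theta>|\<nu>. complex_of_real (w \<theta> * (norm (F \<theta>))\<^sup>2))"
      by (rule integral_complex_of_real[symmetric])
    also have "\<dots> = (LINT \<theta>|\<nu>. LINT z|?P. G \<theta> z)"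
      by (intro Bochner_Integration.integral_cong refl) (simp add: G_eq)
    also have "\<dots> = (LINT z|?P. LINT \<theta>|\<nu>. G \<theta> z)"
      by (rule \<nu>P.Fubini_integral[symmetric, OF G_int])
    finally show ?thesis unfolding GK .
  qed
  define B where "B = {y. h y \<noteq> 0}"
  have B_meas [measurable]: "Measurable.pred \<mu> (\<lambda>y. y \<in> B)" unfolding B_def by measurable
  let ?H = "\<lambda>y. ennreal ((norm (h y))\<^sup>2 / 2)"
  have "(\<integral>\<^sup>+\<theta>. ennreal (w \<theta> * (norm (F \<theta>))\<^sup>2) \<partial>\<nu>) = ennreal (LINT \<theta>|\<nu>. w \<theta> * (norm (F \<theta>))\<^sup>2)"
    using wF w(2) by (intro nn_integral_eq_integral) (simp_all only: complex_of_real_integrable_eq, simp)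
  also have "\<dots> \<le> ennreal (norm (LINT z|?P. h (fst z) * cnj (h (snd z)) * K z))"
    unfolding fub[symmetric] by (intro ennreal_leI) simp
  also have "\<dots> \<le> (\<integral>\<^sup>+z. ennreal (norm (h (fst z) * cnj (h (snd z)) * K z)) \<partial>?P)"
    by (rule integral_norm_bound_ennreal[OF GKi])
  also have "\<dots> \<le> (\<integral>\<^sup>+z. ?H (fst z) * (k (fst z) (snd z) * indicator B (snd z))
      + ?H (snd z) * (k (snd z) (fst z) * indicator B (fst z)) \<partial>?P)"
  proof (intro nn_integral_mono)
    fix z :: "'b \<times> 'b"
    obtain y y' where z: "z = (y, y')" by (cases z)
    show "ennreal (norm (h (fst z) * cnj (h (snd z)) * K z)) \<le> ?H (fst z) * (k (fst z) (snd z) * indicator B (snd z))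
      + ?H (snd z) * (k (snd z) (fst z) * indicator B (fst z))"
    proof (cases "y \<in> B \<and> y' \<in> B")
      case False
      then show ?thesis by (auto simp: z B_def)
    next
      case True
      have "norm (h y) * norm (h y') \<le> (norm (h y))\<^sup>2 / 2 + (norm (h y'))\<^sup>2 / 2"
        using sum_squares_bound[of "norm (h y)" "norm (h y')"] by simp
      then have "ennreal (norm (h y * cnj (h y') * K z)) \<le> ennreal (((norm (h y))\<^sup>2 / 2 + (norm (h y'))\<^sup>2 / 2) * norm (K z))"
        by (intro ennreal_leI) (simp add: norm_mult mult_right_mono)
      also have "\<dots> = (?H y + ?H y') * ennreal (norm (K z))" by (simp add: ennreal_mult')
      also have "\<dots> \<le> (?H y + ?H y') * k y y'"
        using k[of y y'] by (intro mult_left_mono) (simp_all add: K_def z)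
      also have "\<dots> = ?H y * k y y' + ?H y' * k y' y" by (simp add: distrib_right k_sym[of y' y])
      finally show ?thesis using True by (simp add: z)
    qed
  qed
  also have "\<dots> = (\<integral>\<^sup>+z. ?H (fst z) * (k (fst z) (snd z) * indicator B (snd z)) \<partial>?P)
      + (\<integral>\<^sup>+z. ?H (snd z) * (k (snd z) (fst z) * indicator B (fst z)) \<partial>?P)"
    by (rule nn_integral_add) measurable
  also have "(\<integral>\<^sup>+z. ?H (fst z) * (k (fst z) (snd z) * indicator B (snd z)) \<partial>?P)
    = (\<integral>\<^sup>+y. ?H y * (\<integral>\<^sup>+y'. k y y' * indicator B y' \<partial>\<mu>) \<partial>\<mu>)"
    by (subst \<mu>.nn_integral_fst[symmetric]) (auto intro!: nn_integral_cong simp: nn_integral_cmult)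
  also have "(\<integral>\<^sup>+z. ?H (snd z) * (k (snd z) (fst z) * indicator B (fst z)) \<partial>?P)
    = (\<integral>\<^sup>+y. ?H y * (\<integral>\<^sup>+y'. k y y' * indicator B y' \<partial>\<mu>) \<partial>\<mu>)"
    by (subst \<mu>\<mu>.nn_integral_snd[symmetric]) (auto intro!: nn_integral_cong simp: nn_integral_cmult)
  also have "(\<integral>\<^sup>+y. ?H y * (\<integral>\<^sup>+y'. k y y' * indicator B y' \<partial>\<mu>) \<partial>\<mu>)
      + (\<integral>\<^sup>+y. ?H y * (\<integral>\<^sup>+y'. k y y' * indicator B y' \<partial>\<mu>) \<partial>\<mu>)
    \<le> (\<integral>\<^sup>+y. ?H y * A \<partial>\<mu>) + (\<integral>\<^sup>+y. ?H y * A \<partial>\<mu>)"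
    using A unfolding B_def by (intro add_mono nn_integral_mono mult_left_mono) auto
  also have "\<dots> = A * ((\<integral>\<^sup>+y. ?H y \<partial>\<mu>) + (\<integral>\<^sup>+y. ?H y \<partial>\<mu>))"
  proof -
    have "(\<integral>\<^sup>+y. ?H y * A \<partial>\<mu>) = (\<integral>\<^sup>+y. ?H y \<partial>\<mu>) * A" by (rule nn_integral_multc) measurable
    then show ?thesis by (simp add: distrib_left mult.commute)
  qed
  also have "(\<integral>\<^sup>+y. ?H y \<partial>\<mu>) + (\<integral>\<^sup>+y. ?H y \<partial>\<mu>) = (\<integral>\<^sup>+y. ennreal ((norm (h y))\<^sup>2) \<partial>\<mu>)"
    by (subst nn_integral_add[symmetric]) (auto intro!: nn_integral_cong simp flip: ennreal_plus)
  finally show ?thesis unfolding F_def .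
qed

section \<open>The Plancherel inequality on the cylinder\<close>

definition period_measure :: "real measure" where
  "period_measure = restrict_space lborel {0..<2 * pi}"

lemma cyl_measure_eq: "cyl_measure = lborel \<Otimes>\<^sub>M period_measure"
  by (simp add: cyl_measure_def period_measure_def)

lemma finite_period_measure: "finite_measure period_measure"
  by (rule finite_measureI) (simp add: period_measure_def space_restrict_space emeasure_restrict_space)

lemma sigma_finite_cyl: "pair_sigma_finite lborel period_measure"
proof -
  interpret finite_measure period_measure by (rule finite_period_measure)
  show ?thesis ..
qed

lemma sigma_finite_cyl_measure: "sigma_finite_measure cyl_measure"
proof -
  interpret pair_sigma_finite lborel period_measure by (rule sigma_finite_cyl)
  show ?thesis unfolding cyl_measure_eq ..
qed

lemma pair_sigma_finite_freq: "pair_sigma_finite lborel (count_space (UNIV :: int set))"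
proof -
  interpret sigma_finite_measure "count_space (UNIV :: int set)"
    by (rule sigma_finite_measure_count_space)
  show ?thesis ..
qed

lemma sigma_finite_freq_measure: "sigma_finite_measure freq_measure"
proof -
  interpret pair_sigma_finite lborel "count_space (UNIV :: int set)" by (rule pair_sigma_finite_freq)
  show ?thesis unfolding freq_measure_def ..
qed

lemma id_measurable_period: "(\<lambda>x. x) \<in> borel_measurable period_measure"
  unfolding period_measure_def by (intro measurable_restrict_space1) simp

lemma integrable_of_in_L1:
  assumes "in_Lp 1 M f"
  shows "integrable M f"
  using assms integrable_norm_iff[of f M] by (simp add: in_Lp_def)

lemma fourier_cyl_eq:
  assumes "in_Lp_cyl 1 f"
  shows "fourier_cyl f \<xi> = 1 / (4 * pi\<^sup>2) * (LINT z|cyl_measure. exp (- (\<i> * of_real (freq_vec \<xi> \<bullet> z))) * f z)"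
proof -
  interpret pair_sigma_finite lborel period_measure by (rule sigma_finite_cyl)
  have f_meas [measurable]: "f \<in> borel_measurable (lborel \<Otimes>\<^sub>M period_measure)"
    using assms by (simp add: in_Lp_cyl_def in_Lp_def cyl_measure_eq)
  note id_measurable_period [measurable]
  have f_int: "integrable (lborel \<Otimes>\<^sub>M period_measure) f"
    using assms unfolding in_Lp_cyl_def cyl_measure_eq by (intro integrable_of_in_L1) simp
  define A where "A x2 = (LINT x1|lborel. f (x1, x2) * exp (- (\<i> * of_real (freq_vec \<xi> \<bullet> (x1, x2)))))" for x2
  have freq: "freq_vec \<xi> \<bullet> (x1, x2) = fst \<xi> * x1 + of_int (snd \<xi>) * x2" for x1 x2
    by (simp add: freq_vec_def inner_prod_def)
  have A_meas: "A \<in> borel_measurable period_measure" unfolding A_def freq by measurable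
  have int: "integrable (lborel \<Otimes>\<^sub>M period_measure) (\<lambda>(x1, x2). f (x1, x2) * exp (- (\<i> * of_real (freq_vec \<xi> \<bullet> (x1, x2)))))"
    by (rule Bochner_Integration.integrable_bound[OF f_int]) (auto simp: freq norm_mult)
  have "(LINT x2:{0..2 * pi}|lborel. A x2) = (LINT x2|lborel. indicator {0..<2 * pi} x2 *\<^sub>R A x2)"
    unfolding set_lebesgue_integral_def
  proof (rule integral_cong_AE)
    have m: "(\<lambda>x. indicator {0..<2 * pi} x *\<^sub>R A x) \<in> borel_measurable lborel"
      using A_meas unfolding period_measure_def by (subst (asm) borel_measurable_restrict_space_iff) auto
    then show "(\<lambda>x. indicator {0..<2 * pi} x *\<^sub>R A x) \<in> borel_measurable lborel" .
    have "(\<lambda>x. indicator {0..2 * pi} x *\<^sub>R A x) = (\<lambda>x. indicator {0..<2 * pi} x *\<^sub>R A x + indicator {2 * pi} x *\<^sub>R A (2 * pi))"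
      by (auto simp: fun_eq_iff indicator_def)
    also have "\<dots> \<in> borel_measurable lborel" using m by measurable
    finally show "(\<lambda>x. indicator {0..2 * pi} x *\<^sub>R A x) \<in> borel_measurable lborel" .
    \<comment> \<open>The closed interval of the transform and the half-open period differ in one point.\<close>
    have "AE x in lborel. x \<noteq> 2 * pi" by (rule AE_lborel_singleton)
    then show "AE x in lborel. indicator {0..2 * pi} x *\<^sub>R A x = indicator {0..<2 * pi} x *\<^sub>R A x"
      by eventually_elim (auto simp: indicator_def)
  qed
  also have "\<dots> = (LINT x2|period_measure. A x2)"
    unfolding period_measure_def by (rule integral_restrict_space[symmetric]) auto
  also have "\<dots> = (LINT z|(lborel \<Otimes>\<^sub>M period_measure). (case z of (x1, x2) \<Rightarrow> f (x1, x2) * exp (- (\<i> * of_real (freq_vec \<xi> \<bullet> (x1, x2))))))"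
    unfolding A_def by (rule integral_snd[OF int])
  also have "\<dots> = (LINT z|cyl_measure. exp (- (\<i> * of_real (freq_vec \<xi> \<bullet> z))) * f z)"
    unfolding cyl_measure_eq by (intro Bochner_Integration.integral_cong) (auto simp: mult.commute)
  finally show ?thesis unfolding fourier_cyl_def A_def by simp
qed

lemma integral_period_iexp:
  fixes n :: int and c :: real
  shows "(LINT y|period_measure. exp (\<i> * of_real (of_int n * (c - y)))) = (if n = 0 then 2 * pi else 0)"
proof (cases "n = 0")
  case True
  interpret finite_measure period_measure by (rule finite_period_measure)
  have "measure period_measure (space period_measure) = 2 * pi"
    by (simp add: period_measure_def space_restrict_space measure_restrict_space)
  then show ?thesis using True by (simp add: scaleR_conv_of_real)
next
  case False
  define F where "F y = exp (\<i> * of_real (of_int n * (c - y))) * (\<i> / of_int n)" for y :: real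
  have der: "(F has_vector_derivative exp (\<i> * of_real (of_int n * (c - y)))) (at y within {0..2 * pi})" for y
    unfolding F_def
    by (rule has_vector_derivative_real_field derivative_eq_intros
      | (simp add: False field_simps))+
  have "(LINT y:{0..2 * pi}|lborel. exp (\<i> * of_real (of_int n * (c - y)))) = F (2 * pi) - F 0"
    unfolding set_lebesgue_integral_def
  proof (rule integral_FTC_Icc)
    show "continuous_on {0..2 * pi} (\<lambda>y. exp (\<i> * complex_of_real (of_int n * (c - y))))"
      by (intro continuous_intros)
  qed (simp, rule der)
  also have "F (2 * pi) = F 0"
  proof -
    have "\<i> * complex_of_real (of_int n * (c - 2 * pi)) = \<i> * of_real (of_int n * c) - 2 * of_int n * of_real pi * \<i>"
      by (simp add: algebra_simps)
    then have "exp (\<i> * complex_of_real (of_int n * (c - 2 * pi))) = exp (\<i> * of_real (of_int n * c)) / exp (2 * of_int n * of_real pi * \<i>)"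
      by (simp only: exp_diff)
    also have "exp (2 * of_int n * of_real pi * \<i>) = 1" unfolding exp_eq_1 by (auto intro!: exI[of _ n])
    finally show ?thesis by (simp add: F_def)
  qed
  finally have "(LINT y:{0..2 * pi}|lborel. exp (\<i> * of_real (of_int n * (c - y)))) = 0" by simp
  moreover have "(LINT y|period_measure. exp (\<i> * of_real (of_int n * (c - y)))) = (LINT y:{0..2 * pi}|lborel. exp (\<i> * of_real (of_int n * (c - y))))"
  proof -
        have "AE y in lborel. indicator {0..<2 * pi} y *\<^sub>R exp (\<i> * complex_of_real (of_int n * (c - y)))
      = indicator {0..2 * pi} y *\<^sub>R exp (\<i> * complex_of_real (of_int n * (c - y)))"
      using AE_lborel_singleton[of "2 * pi"] by eventually_elim (auto simp: indicator_def)
    then have "(LINT y|lborel. indicator {0..<2 * pi} y *\<^sub>R exp (\<i> * complex_of_real (of_int n * (c - y))))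
      = (LINT y|lborel. indicator {0..2 * pi} y *\<^sub>R exp (\<i> * complex_of_real (of_int n * (c - y))))"
      by (intro integral_cong_AE) measurable
    then show ?thesis
      unfolding period_measure_def set_lebesgue_integral_def by (subst integral_restrict_space) auto
  qed
  ultimately show ?thesis using False by simp
qed

definition dirichlet_sum :: "int set \<Rightarrow> real \<Rightarrow> complex" where
  "dirichlet_sum J t = (\<Sum>j\<in>J. exp (\<i> * of_real (of_int j * t)))"

lemma dirichlet_sum_square:
  "complex_of_real ((norm (dirichlet_sum J t))\<^sup>2) = (\<Sum>j\<in>J. \<Sum>k\<in>J. exp (\<i> * of_real (of_int (j - k) * t)))"
proof -
  have "complex_of_real ((norm (dirichlet_sum J t))\<^sup>2) = dirichlet_sum J t * cnj (dirichlet_sum J t)"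
    by (simp add: complex_norm_square[symmetric])
  also have "\<dots> = (\<Sum>j\<in>J. \<Sum>k\<in>J. exp (\<i> * of_real (of_int j * t)) * cnj (exp (\<i> * of_real (of_int k * t))))"
    unfolding dirichlet_sum_def cnj_sum by (rule sum_product)
  also have "\<dots> = (\<Sum>j\<in>J. \<Sum>k\<in>J. exp (\<i> * of_real (of_int (j - k) * t)))"
    by (intro sum.cong refl) (simp add: exp_cnj algebra_simps flip: exp_add)
  finally show ?thesis .
qed

lemma dirichlet_sum_minus: "dirichlet_sum J (- t) = cnj (dirichlet_sum J t)"
  by (simp add: dirichlet_sum_def exp_cnj)

lemma dirichlet_sum_measurable [measurable]: "dirichlet_sum J \<in> borel_measurable borel"
  unfolding dirichlet_sum_def by measurable

lemma nn_integral_dirichlet_sum: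
  assumes "finite J"
  shows "(\<integral>\<^sup>+y. ennreal ((norm (dirichlet_sum J (c - y)))\<^sup>2) \<partial>period_measure) = ennreal (2 * pi * real (card J))"
proof -
  interpret finite_measure period_measure by (rule finite_period_measure)
  note id_measurable_period [measurable]
  have i: "integrable period_measure (\<lambda>y. exp (\<i> * complex_of_real (of_int n * (c - y))))" for n
    by (rule integrable_const_bound[where B = 1]) auto
  have i2: "integrable period_measure (\<lambda>y. complex_of_real ((norm (dirichlet_sum J (c - y)))\<^sup>2))"
    unfolding dirichlet_sum_square by (intro Bochner_Integration.integrable_sum i)
  then have i3: "integrable period_measure (\<lambda>y. (norm (dirichlet_sum J (c - y)))\<^sup>2)"
    by (simp only: complex_of_real_integrable_eq)
  have "complex_of_real (LINT y|period_measure. (norm (dirichlet_sum J (c - y)))\<^sup>2)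
    = (LINT y|period_measure. complex_of_real ((norm (dirichlet_sum J (c - y)))\<^sup>2))"
    by (rule integral_complex_of_real[symmetric])
  also have "\<dots> = (\<Sum>j\<in>J. \<Sum>k\<in>J. LINT y|period_measure. exp (\<i> * of_real (of_int (j - k) * (c - y))))"
    unfolding dirichlet_sum_square
    by (subst Bochner_Integration.integral_sum, intro Bochner_Integration.integrable_sum i)
       (intro sum.cong refl Bochner_Integration.integral_sum i)
  also have "\<dots> = (\<Sum>j\<in>J. \<Sum>k\<in>J. if j = k then complex_of_real (2 * pi) else 0)"
    unfolding integral_period_iexp by (intro sum.cong refl) simp
  also have "\<dots> = complex_of_real (2 * pi * real (card J))"
    using assms by simp
  finally have "(LINT y|period_measure. (norm (dirichlet_sum J (c - y)))\<^sup>2) = 2 * pi * real (card J)"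
    by (simp only: of_real_eq_iff)
  then show ?thesis using i3 by (subst nn_integral_eq_integral) auto
qed

text \<open>Fatou's lemma, in the form that removes the regularizing weights below.\<close>

lemma nn_integral_le_of_tendsto:
  fixes f :: "nat \<Rightarrow> 'a \<Rightarrow> ennreal"
  assumes [measurable]: "\<And>n. f n \<in> borel_measurable M"
    and lim: "\<And>x. x \<in> space M \<Longrightarrow> (\<lambda>n. f n x) \<longlonglongrightarrow> g x"
    and le: "\<And>n. (\<integral>\<^sup>+x. f n x \<partial>M) \<le> C"
  shows "(\<integral>\<^sup>+x. g x \<partial>M) \<le> C"
proof -
  have "(\<integral>\<^sup>+x. g x \<partial>M) = (\<integral>\<^sup>+x. liminf (\<lambda>n. f n x) \<partial>M)"
    by (intro nn_integral_cong lim_imp_Liminf[symmetric] lim) auto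
  also have "\<dots> \<le> liminf (\<lambda>n. \<integral>\<^sup>+x. f n x \<partial>M)" by (rule nn_integral_liminf) measurable
  also have "\<dots> \<le> C" by (intro Liminf_le) (simp_all add: le)
  finally show ?thesis .
qed

text \<open>Every \<open>n\<close> in \<open>{-L..<L}\<close> is the difference of at least \<open>L\<close> pairs, namely \<open>(n + k, k)\<close> with
\<open>0 \<le> k < L\<close>. A sharp cut-off in \<open>n\<close> would lead to the Dirichlet kernel, whose \<open>L\<^sup>1\<close> norm is
unbounded; averaging over pairs leads to the nonnegative Fejer kernel.\<close>

lemma sum_fejer_ge:
  fixes H :: "int \<Rightarrow> ennreal" and L :: int
  assumes "0 < L"
  shows "of_nat (nat L) * (\<Sum>n\<in>{-L..<L}. H n) \<le> (\<Sum>(j, k)\<in>{-L..<2 * L} \<times> {-L..<2 * L}. H (j - k))"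
proof -
  let ?\<Phi> = "\<lambda>(n, k). (n + k, k) :: int \<times> int"
  have inj: "inj_on ?\<Phi> ({-L..<L} \<times> {0..<L})" by (auto simp: inj_on_def)
  have "of_nat (nat L) * (\<Sum>n\<in>{-L..<L}. H n) = (\<Sum>n\<in>{-L..<L}. \<Sum>k\<in>{0..<L}. H n)"
    using assms by (simp add: sum_distrib_left)
  also have "\<dots> = (\<Sum>(j, k)\<in>?\<Phi> ` ({-L..<L} \<times> {0..<L}). H (j - k))"
    by (subst sum.reindex[OF inj]) (simp only: sum.cartesian_product case_prod_beta' o_def fst_conv snd_conv add_diff_cancel_right')
  also have "\<dots> \<le> (\<Sum>(j, k)\<in>{-L..<2 * L} \<times> {-L..<2 * L}. H (j - k))"
    by (rule sum_mono2) auto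
  finally show ?thesis .
qed

text \<open>The Schur test with the parameter \<open>\<theta> = (x, (j, k))\<close>, which stands for the frequency \<open>(x, j - k)\<close>,
and with the weight \<open>exp (- \<epsilon> x\<^sup>2) / L\<close>. The kernel is the product of a Gaussian of total mass
\<open>2 \<pi>\<close> and of \<open>|D|\<^sup>2 / L\<close>, where \<open>D\<close> is a sum of \<open>3 L\<close> exponentials; the latter has mass
\<open>2 \<pi> \<cdot> 3\<close> over a period. Neither mass depends on \<open>\<epsilon>\<close> or \<open>L\<close>.\<close>

lemma regularized_plancherel_cyl_le:
  fixes \<epsilon> :: real and L :: int
  assumes \<epsilon>: "0 < \<epsilon>" and L: "0 < L" and h: "integrable cyl_measure h"
  defines "\<Phi> \<equiv> \<lambda>\<xi>. (LINT z|cyl_measure. exp (- (\<i> * of_real (freq_vec \<xi> \<bullet> z))) * h z)"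
  shows "(\<Sum>n\<in>{-L..<L}. \<integral>\<^sup>+x. ennreal (exp (- \<epsilon> * x\<^sup>2) * (norm (\<Phi> (x, n)))\<^sup>2) \<partial>lborel)
    \<le> ennreal (12 * pi\<^sup>2) * (\<integral>\<^sup>+z. ennreal ((norm (h z))\<^sup>2) \<partial>cyl_measure)"
proof -
  interpret C: pair_sigma_finite lborel period_measure by (rule sigma_finite_cyl)
  define J where "J = {-L..<2 * L}"
  have J: "finite J" "card J = nat (3 * L)" using L by (auto simp: J_def)
  define \<nu> where "\<nu> = (lborel :: real measure) \<Otimes>\<^sub>M count_space (J \<times> J)"
  interpret N: pair_sigma_finite "lborel :: real measure" "count_space (J \<times> J)"
  proof -
    interpret finite_measure "count_space (J \<times> J)" using J by (intro finite_measure_count_space) auto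
    show "pair_sigma_finite (lborel :: real measure) (count_space (J \<times> J))" ..
  qed
  have sf_\<nu>: "sigma_finite_measure \<nu>" unfolding \<nu>_def ..
  define e where "e \<theta> z = exp (- (\<i> * of_real (freq_vec (fst \<theta>, fst (snd \<theta>) - snd (snd \<theta>)) \<bullet> z)))"
    for \<theta> :: "real \<times> int \<times> int" and z
  have e_eq: "e \<theta> z = exp (- (\<i> * of_real (fst \<theta> * fst z + of_int (fst (snd \<theta>) - snd (snd \<theta>)) * snd z)))" for \<theta> z
    by (simp add: e_def freq_vec_def inner_prod_def)
  have jk [measurable]: "(\<lambda>\<theta>. real_of_int (fst (snd \<theta>) - snd (snd \<theta>))) \<in> borel_measurable \<nu>"
    unfolding \<nu>_def by (rule measurable_compose[OF measurable_snd]) simp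
  have fst_\<nu> [measurable]: "(\<lambda>\<theta>. fst \<theta>) \<in> borel_measurable \<nu>" unfolding \<nu>_def by measurable
  have fst_cyl [measurable]: "(\<lambda>z. fst z) \<in> borel_measurable cyl_measure" unfolding cyl_measure_eq by measurable
  have snd_cyl [measurable]: "(\<lambda>z. snd z) \<in> borel_measurable cyl_measure"
    unfolding cyl_measure_eq by (rule measurable_compose[OF measurable_snd id_measurable_period])
  
  note comps [measurable] = measurable_compose[OF measurable_fst jk] measurable_compose[OF measurable_fst fst_\<nu>]
    measurable_compose[OF measurable_snd fst_cyl] measurable_compose[OF measurable_snd snd_cyl]
    measurable_compose[OF measurable_fst fst_cyl] measurable_compose[OF measurable_fst snd_cyl]
  have e_meas [measurable]: "(\<lambda>\<theta>. e \<theta> z) \<in> borel_measurable \<nu>" for z unfolding e_eq by measurable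
  have e_meas2 [measurable]: "(\<lambda>x. e (fst x) (snd x)) \<in> borel_measurable (\<nu> \<Otimes>\<^sub>M cyl_measure)"
    unfolding e_eq by measurable
  define w where "w \<theta> = exp (- \<epsilon> * (fst \<theta>)\<^sup>2) / L" for \<theta> :: "real \<times> int \<times> int"
  have w0: "0 \<le> w \<theta>" for \<theta> using L by (simp add: w_def)
  have w_int: "integrable \<nu> w"
  proof -
    have "integrable \<nu> (\<lambda>(x, jk). exp (- \<epsilon> * x\<^sup>2) / L)"
      unfolding \<nu>_def
    proof (rule N.Fubini_integrable)
      show "integrable lborel (\<lambda>x. LINT jk|count_space (J \<times> J). norm (case (x, jk) of (x, jk) \<Rightarrow> exp (- \<epsilon> * x\<^sup>2) / real_of_int L))"
        using J integrable_gauss[OF \<epsilon>] by (simp add: lebesgue_integral_count_space_finite)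
    qed (use J in \<open>auto intro!: integrable_count_space\<close>)
    then show ?thesis by (simp add: w_def[abs_def] case_prod_beta')
  qed
  define k where "k z z' = ennreal (sqrt (pi / \<epsilon>) * exp (- (1 / (4 * \<epsilon>)) * (fst z - fst z')\<^sup>2) * ((norm (dirichlet_sum J (snd z - snd z')))\<^sup>2 / L))"
    for z z' :: "real \<times> real"
  have kernel: "(LINT \<theta>|\<nu>. w \<theta> *\<^sub>R (e \<theta> z * cnj (e \<theta> z')))
    = complex_of_real (sqrt (pi / \<epsilon>) * exp (- (1 / (4 * \<epsilon>)) * (fst z - fst z')\<^sup>2) * ((norm (dirichlet_sum J (snd z - snd z')))\<^sup>2 / L))"
    for z z'
  proof -
    define b t where "b = - (fst z - fst z')" and "t = - (snd z - snd z')"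
    have e2: "w (x, jk) *\<^sub>R (e (x, jk) z * cnj (e (x, jk) z'))
      = (exp (\<i> * of_real (of_int (fst jk - snd jk) * t)) / L) * (exp (- \<epsilon> * x\<^sup>2) *\<^sub>R exp (\<i> * of_real (b * x)))" for x jk
      unfolding e_eq w_def b_def t_def
      by (simp add: exp_cnj scaleR_conv_of_real algebra_simps flip: exp_add)
    have i: "integrable (lborel \<Otimes>\<^sub>M count_space (J \<times> J)) (\<lambda>(x, jk). w (x, jk) *\<^sub>R (e (x, jk) z * cnj (e (x, jk) z')))"
    proof (rule Bochner_Integration.integrable_bound[OF w_int[unfolded \<nu>_def]])
      have "(\<lambda>\<theta>. w \<theta> *\<^sub>R (e \<theta> z * cnj (e \<theta> z'))) \<in> borel_measurable \<nu>"
        using borel_measurable_integrable[OF w_int] by measurable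
      then show "(\<lambda>(x, jk). w (x, jk) *\<^sub>R (e (x, jk) z * cnj (e (x, jk) z'))) \<in> borel_measurable (lborel \<Otimes>\<^sub>M count_space (J \<times> J))"
        by (simp add: \<nu>_def case_prod_beta')
    qed (auto simp: e_eq norm_mult w0)
    have "(LINT \<theta>|\<nu>. w \<theta> *\<^sub>R (e \<theta> z * cnj (e \<theta> z'))) = (LINT jk|count_space (J \<times> J). LINT x|lborel. w (x, jk) *\<^sub>R (e (x, jk) z * cnj (e (x, jk) z')))"
      using N.integral_snd[OF i] by (simp add: \<nu>_def case_prod_beta')
    also have "\<dots> = (\<Sum>jk\<in>J \<times> J. LINT x|lborel. w (x, jk) *\<^sub>R (e (x, jk) z * cnj (e (x, jk) z')))"
      using J by (intro lebesgue_integral_count_space_finite) auto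
    also have "\<dots> = (\<Sum>jk\<in>J \<times> J. (exp (\<i> * of_real (of_int (fst jk - snd jk) * t)) / L) * complex_of_real (sqrt (pi / \<epsilon>) * exp (- b\<^sup>2 / (4 * \<epsilon>))))"
      unfolding e2 integral_mult_right_zero integral_gauss_iexp[OF \<epsilon>] ..
    also have "\<dots> = ((\<Sum>jk\<in>J \<times> J. exp (\<i> * of_real (of_int (fst jk - snd jk) * t))) / L) * complex_of_real (sqrt (pi / \<epsilon>) * exp (- b\<^sup>2 / (4 * \<epsilon>)))"
      by (simp only: sum_distrib_right sum_divide_distrib)
    also have "(\<Sum>jk\<in>J \<times> J. exp (\<i> * of_real (of_int (fst jk - snd jk) * t))) = complex_of_real ((norm (dirichlet_sum J t))\<^sup>2)"
      unfolding dirichlet_sum_square by (simp add: sum.cartesian_product case_prod_beta)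
    also have "norm (dirichlet_sum J t) = norm (dirichlet_sum J (snd z - snd z'))"
      unfolding t_def dirichlet_sum_minus by simp
    also have "- b\<^sup>2 / (4 * \<epsilon>) = - (1 / (4 * \<epsilon>)) * (fst z - fst z')\<^sup>2" by (simp add: b_def power2_commute)
    finally show ?thesis by simp
  qed
  have "(\<integral>\<^sup>+\<theta>. ennreal (w \<theta> * (norm (LINT z|cyl_measure. e \<theta> z * h z))\<^sup>2) \<partial>\<nu>)
    \<le> ennreal (12 * pi\<^sup>2) * (\<integral>\<^sup>+z. ennreal ((norm (h z))\<^sup>2) \<partial>cyl_measure)"
  proof (rule schur_extension_bound[OF sigma_finite_cyl_measure sf_\<nu> _ _ w_int w0 h, where k = k])
    show "(\<lambda>(\<theta>, y). e \<theta> y) \<in> borel_measurable (\<nu> \<Otimes>\<^sub>M cyl_measure)"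
      using e_meas2 by (simp add: case_prod_beta')
    show "norm (e \<theta> y) \<le> 1" for \<theta> y by (simp add: e_eq)
    show "(\<lambda>(y, y'). k y y') \<in> borel_measurable (cyl_measure \<Otimes>\<^sub>M cyl_measure)"
      unfolding k_def by measurable
    show "k y y' = k y' y" for y y'
    proof -
      have "norm (dirichlet_sum J (snd y - snd y')) = norm (dirichlet_sum J (snd y' - snd y))"
        using dirichlet_sum_minus[of J "snd y - snd y'"] by simp
      then show ?thesis by (simp add: k_def power2_commute)
    qed
    show "ennreal (norm (LINT \<theta>|\<nu>. w \<theta> *\<^sub>R (e \<theta> y * cnj (e \<theta> y')))) \<le> k y y'" for y y'
      unfolding kernel k_def norm_of_real using \<epsilon> L by (simp add: abs_mult)
    show "(\<integral>\<^sup>+y'. k y y' * indicator {y'. h y' \<noteq> 0} y' \<partial>cyl_measure) \<le> ennreal (12 * pi\<^sup>2)" for y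
    proof -
      have "(\<integral>\<^sup>+y'. k y y' * indicator {y'. h y' \<noteq> 0} y' \<partial>cyl_measure) \<le> (\<integral>\<^sup>+y'. k y y' \<partial>cyl_measure)"
        by (intro nn_integral_mono) (simp add: indicator_def)
      also have "\<dots> = (\<integral>\<^sup>+x. \<integral>\<^sup>+s. k y (x, s) \<partial>period_measure \<partial>lborel)"
        unfolding cyl_measure_eq
      proof (rule C.M2.nn_integral_fst[symmetric])
        have "(\<lambda>y'. k y y') \<in> borel_measurable cyl_measure" unfolding k_def by measurable
        then show "k y \<in> borel_measurable (lborel \<Otimes>\<^sub>M period_measure)" by (simp add: cyl_measure_eq)
      qed
      also have "\<dots> = (\<integral>\<^sup>+x. ennreal (sqrt (pi / \<epsilon>) * exp (- (1 / (4 * \<epsilon>)) * (fst y - x)\<^sup>2) / L) * ennreal (2 * pi * real (card J)) \<partial>lborel)"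
      proof (intro nn_integral_cong)
        fix x :: real
        have "(\<integral>\<^sup>+s. k y (x, s) \<partial>period_measure)
          = (\<integral>\<^sup>+s. ennreal (sqrt (pi / \<epsilon>) * exp (- (1 / (4 * \<epsilon>)) * (fst y - x)\<^sup>2) / L) * ennreal ((norm (dirichlet_sum J (snd y - s)))\<^sup>2) \<partial>period_measure)"
          using \<epsilon> L by (intro nn_integral_cong) (simp add: k_def flip: ennreal_mult')
        also have "\<dots> = ennreal (sqrt (pi / \<epsilon>) * exp (- (1 / (4 * \<epsilon>)) * (fst y - x)\<^sup>2) / L) * (\<integral>\<^sup>+s. ennreal ((norm (dirichlet_sum J (snd y - s)))\<^sup>2) \<partial>period_measure)"
          using id_measurable_period by (intro nn_integral_cmult) measurable
        finally show "(\<integral>\<^sup>+s. k y (x, s) \<partial>period_measure) = ennreal (sqrt (pi / \<epsilon>) * exp (- (1 / (4 * \<epsilon>)) * (fst y - x)\<^sup>2) / L) * ennreal (2 * pi * real (card J))"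
          using J by (simp only: nn_integral_dirichlet_sum)
      qed
      also have "\<dots> = (\<integral>\<^sup>+x. ennreal (sqrt (pi / \<epsilon>) / L * (2 * pi * real (card J))) * ennreal (exp (- (1 / (4 * \<epsilon>)) * (fst y - x)\<^sup>2)) \<partial>lborel)"
        using \<epsilon> L by (intro nn_integral_cong) (simp flip: ennreal_mult' ennreal_mult'')
      also have "\<dots> = ennreal (sqrt (pi / \<epsilon>) / L * (2 * pi * real (card J))) * ennreal (sqrt (pi / (1 / (4 * \<epsilon>))))"
      proof -
        have "0 < 1 / (4 * \<epsilon>)" using \<epsilon> by simp
        then show ?thesis
          unfolding nn_integral_gauss_shift[OF \<open>0 < 1 / (4 * \<epsilon>)\<close>, of "fst y", symmetric]
          by (intro nn_integral_cmult) measurable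
      qed
      also have "\<dots> = ennreal (12 * pi\<^sup>2)"
      proof -
        have "sqrt (pi / \<epsilon>) * sqrt (pi / (1 / (4 * \<epsilon>))) = sqrt (4 * pi\<^sup>2)"
          using \<epsilon> by (simp add: real_sqrt_mult[symmetric] power2_eq_square)
        also have "\<dots> = 2 * pi" by (simp add: real_sqrt_mult)
        finally have "sqrt (pi / \<epsilon>) / L * (2 * pi * real (card J)) * sqrt (pi / (1 / (4 * \<epsilon>))) = 2 * pi * (2 * pi * real (card J)) / L"
          by (simp add: field_simps)
        also have "\<dots> = 12 * pi\<^sup>2" using L J by (simp add: power2_eq_square)
        finally show ?thesis using \<epsilon> L by (simp flip: ennreal_mult')
      qed
      finally show ?thesis .
    qed
  qed
  moreover have "(\<Sum>n\<in>{-L..<L}. \<integral>\<^sup>+x. ennreal (exp (- \<epsilon> * x\<^sup>2) * (norm (\<Phi> (x, n)))\<^sup>2) \<partial>lborel)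
    \<le> (\<integral>\<^sup>+\<theta>. ennreal (w \<theta> * (norm (LINT z|cyl_measure. e \<theta> z * h z))\<^sup>2) \<partial>\<nu>)"
  proof -
    define H where "H n = (\<integral>\<^sup>+x. ennreal (exp (- \<epsilon> * x\<^sup>2) * (norm (\<Phi> (x, n)))\<^sup>2) \<partial>lborel)" for n
    have \<Phi>e: "(LINT z|cyl_measure. e (x, j, k) z * h z) = \<Phi> (x, j - k)" for x j k
      by (simp add: e_def \<Phi>_def)
    have \<Phi>_meas [measurable]: "(\<lambda>x. \<Phi> (x, n)) \<in> borel_measurable lborel" for n
    proof -
      interpret sigma_finite_measure cyl_measure by (rule sigma_finite_cyl_measure)
      have [measurable]: "h \<in> borel_measurable cyl_measure" using h by simp
      have "(\<lambda>(x, z). exp (- (\<i> * of_real (freq_vec (x, n) \<bullet> z))) * h z) \<in> borel_measurable (lborel \<Otimes>\<^sub>M cyl_measure)"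
        unfolding freq_vec_def inner_prod_def fst_conv snd_conv by measurable
      then show ?thesis unfolding \<Phi>_def by (rule borel_measurable_lebesgue_integral)
    qed
    have "ennreal (1 / L) * (of_nat (nat L) * (\<Sum>n\<in>{-L..<L}. H n)) = (ennreal (1 / L) * ennreal L) * (\<Sum>n\<in>{-L..<L}. H n)"
      using L by (simp add: mult.assoc ennreal_of_nat_eq_real_of_nat)
    also have "ennreal (1 / L) * ennreal L = 1" using L by (simp flip: ennreal_mult')
    finally have "(\<Sum>n\<in>{-L..<L}. H n) = ennreal (1 / L) * (of_nat (nat L) * (\<Sum>n\<in>{-L..<L}. H n))" by simp
    also have "\<dots> \<le> ennreal (1 / L) * (\<Sum>(j, k)\<in>J \<times> J. H (j - k))"
      unfolding J_def by (intro mult_left_mono sum_fejer_ge L) simp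
    also have "\<dots> = (\<Sum>jk\<in>J \<times> J. ennreal (1 / L) * H (fst jk - snd jk))"
      by (simp add: sum_distrib_left case_prod_beta)
    also have "\<dots> = (\<Sum>jk\<in>J \<times> J. \<integral>\<^sup>+x. ennreal (w (x, jk) * (norm (\<Phi> (x, fst jk - snd jk)))\<^sup>2) \<partial>lborel)"
      unfolding H_def w_def using L
      by (intro sum.cong refl, subst nn_integral_cmult[symmetric])
         (auto intro!: nn_integral_cong simp flip: ennreal_mult')
    also have "\<dots> = (\<integral>\<^sup>+jk. \<integral>\<^sup>+x. ennreal (w (x, jk) * (norm (LINT z|cyl_measure. e (x, jk) z * h z))\<^sup>2) \<partial>lborel \<partial>count_space (J \<times> J))"
      using J by (subst nn_integral_count_space_finite) (auto simp: \<Phi>e intro!: sum.cong)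
    also have "\<dots> = (\<integral>\<^sup>+\<theta>. ennreal (w \<theta> * (norm (LINT z|cyl_measure. e \<theta> z * h z))\<^sup>2) \<partial>\<nu>)"
    proof -
      interpret sigma_finite_measure cyl_measure by (rule sigma_finite_cyl_measure)
      have [measurable]: "h \<in> borel_measurable cyl_measure" using h by simp
      have "(\<lambda>(\<theta>, z). e \<theta> z * h z) \<in> borel_measurable (\<nu> \<Otimes>\<^sub>M cyl_measure)"
        unfolding case_prod_beta' by measurable
      then have "(\<lambda>\<theta>. LINT z|cyl_measure. e \<theta> z * h z) \<in> borel_measurable \<nu>" by (rule borel_measurable_lebesgue_integral)
      then have "(\<lambda>\<theta>. ennreal (w \<theta> * (norm (LINT z|cyl_measure. e \<theta> z * h z))\<^sup>2)) \<in> borel_measurable \<nu>"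
        using borel_measurable_integrable[OF w_int] by measurable
      then show ?thesis unfolding \<nu>_def by (rule N.nn_integral_snd)
    qed
    finally show ?thesis unfolding H_def .
  qed
  ultimately show ?thesis by (rule order_trans[rotated])
qed

text \<open>The cut-offs tend to \<open>1\<close>. With the normalization \<open>1 / (4 \<pi>\<^sup>2)\<close> of the transform the constant
\<open>12 \<pi>\<^sup>2\<close> becomes \<open>12 \<pi>\<^sup>2 / (4 \<pi>\<^sup>2)\<^sup>2\<close>, which is less than \<open>1\<close>.\<close>

lemma plancherel_cyl_le:
  assumes "in_Lp_cyl 1 f"
  shows "(\<integral>\<^sup>+\<xi>. ennreal ((norm (fourier_cyl f \<xi>))\<^sup>2) \<partial>freq_measure) \<le> (\<integral>\<^sup>+z. ennreal ((norm (f z))\<^sup>2) \<partial>cyl_measure)"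
proof -
  interpret N: pair_sigma_finite lborel "count_space (UNIV :: int set)" by (rule pair_sigma_finite_freq)
  interpret sigma_finite_measure cyl_measure by (rule sigma_finite_cyl_measure)
  define \<Phi> where "\<Phi> \<xi> = (LINT z|cyl_measure. exp (- (\<i> * of_real (freq_vec \<xi> \<bullet> z))) * f z)" for \<xi>
  have f_int: "integrable cyl_measure f"
    using assms unfolding in_Lp_cyl_def by (intro integrable_of_in_L1) simp
  have f_meas [measurable]: "f \<in> borel_measurable cyl_measure" using f_int by simp
  have \<Phi>_meas [measurable]: "\<Phi> \<in> borel_measurable freq_measure"
  proof -
    
    have fst_cyl [measurable]: "(\<lambda>z. fst z) \<in> borel_measurable cyl_measure" unfolding cyl_measure_eq by measurable
    have snd_cyl [measurable]: "(\<lambda>z. snd z) \<in> borel_measurable cyl_measure"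
      unfolding cyl_measure_eq by (rule measurable_compose[OF measurable_snd id_measurable_period])
    note [measurable] = measurable_compose[OF measurable_snd fst_cyl] measurable_compose[OF measurable_snd snd_cyl]
    have "(\<lambda>(\<xi>, z). exp (- (\<i> * of_real (freq_vec \<xi> \<bullet> z))) * f z) \<in> borel_measurable (freq_measure \<Otimes>\<^sub>M cyl_measure)"
      unfolding freq_vec_def inner_prod_def fst_conv snd_conv freq_measure_def case_prod_beta' by measurable
    then show ?thesis unfolding \<Phi>_def[abs_def] by (rule borel_measurable_lebesgue_integral)
  qed
  define F where "F N \<xi> = ennreal (exp (- (1 / real (Suc N)) * (fst \<xi>)\<^sup>2) * (norm (\<Phi> \<xi>))\<^sup>2) * indicator {- int (Suc N)..<int (Suc N)} (snd \<xi>)" for N \<xi>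
  have "(\<integral>\<^sup>+\<xi>. ennreal ((norm (\<Phi> \<xi>))\<^sup>2) \<partial>freq_measure) \<le> ennreal (12 * pi\<^sup>2) * (\<integral>\<^sup>+z. ennreal ((norm (f z))\<^sup>2) \<partial>cyl_measure)"
  proof (rule nn_integral_le_of_tendsto)
    have snd_f: "(\<lambda>\<xi>. indicator {- int (Suc N)..<int (Suc N)} (snd \<xi>) :: ennreal) \<in> borel_measurable freq_measure" for N
      unfolding freq_measure_def by (rule measurable_compose[OF measurable_snd]) simp
    have fst_f: "(\<lambda>\<xi>. fst \<xi>) \<in> borel_measurable freq_measure" unfolding freq_measure_def by measurable
    show F_meas: "F N \<in> borel_measurable freq_measure" for N
      unfolding F_def[abs_def] using snd_f[of N] fst_f by measurable
    show "(\<lambda>N. F N \<xi>) \<longlonglongrightarrow> ennreal ((norm (\<Phi> \<xi>))\<^sup>2)" for \<xi>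
    proof -
      have "(\<lambda>N. - (1 / real (Suc N)) * (fst \<xi>)\<^sup>2) \<longlonglongrightarrow> - 0 * (fst \<xi>)\<^sup>2"
        by (intro tendsto_intros LIMSEQ_Suc lim_1_over_n)
      from tendsto_mult[OF tendsto_exp[OF this] tendsto_const[of "(norm (\<Phi> \<xi>))\<^sup>2"]]
      have "(\<lambda>N. exp (- (1 / real (Suc N)) * (fst \<xi>)\<^sup>2) * (norm (\<Phi> \<xi>))\<^sup>2) \<longlonglongrightarrow> exp (- 0 * (fst \<xi>)\<^sup>2) * (norm (\<Phi> \<xi>))\<^sup>2" .
      then have "(\<lambda>N. ennreal (exp (- (1 / real (Suc N)) * (fst \<xi>)\<^sup>2) * (norm (\<Phi> \<xi>))\<^sup>2)) \<longlonglongrightarrow> ennreal ((norm (\<Phi> \<xi>))\<^sup>2)"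
        by (intro tendsto_ennrealI) simp
      moreover have "\<forall>\<^sub>F N in sequentially. ennreal (exp (- (1 / real (Suc N)) * (fst \<xi>)\<^sup>2) * (norm (\<Phi> \<xi>))\<^sup>2) = F N \<xi>"
        using eventually_ge_at_top[of "nat \<bar>snd \<xi>\<bar>"] by eventually_elim (auto simp: F_def indicator_def)
      ultimately show ?thesis by (rule Lim_transform_eventually)
    qed
    show "(\<integral>\<^sup>+\<xi>. F N \<xi> \<partial>freq_measure) \<le> ennreal (12 * pi\<^sup>2) * (\<integral>\<^sup>+z. ennreal ((norm (f z))\<^sup>2) \<partial>cyl_measure)" for N
    proof -
      let ?J = "{- int (Suc N)..<int (Suc N)}"
      have x_meas: "(\<lambda>x. \<Phi> (x, n)) \<in> borel_measurable lborel" for n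
        using measurable_compose[OF measurable_Pair2'[of n "count_space UNIV" lborel] \<Phi>_meas[unfolded freq_measure_def]] by simp
      have "(\<integral>\<^sup>+\<xi>. F N \<xi> \<partial>freq_measure) = (\<integral>\<^sup>+n. \<integral>\<^sup>+x. F N (x, n) \<partial>lborel \<partial>count_space UNIV)"
        using F_meas unfolding freq_measure_def by (rule N.nn_integral_snd[symmetric])
      also have "\<dots> = (\<integral>\<^sup>+n. (\<integral>\<^sup>+x. ennreal (exp (- (1 / real (Suc N)) * x\<^sup>2) * (norm (\<Phi> (x, n)))\<^sup>2) \<partial>lborel) * indicator ?J n \<partial>count_space UNIV)"
        unfolding F_def fst_conv snd_conv using x_meas[measurable] by (intro nn_integral_cong nn_integral_multc) measurable
      also have "\<dots> = (\<Sum>n\<in>?J. (\<integral>\<^sup>+x. ennreal (exp (- (1 / real (Suc N)) * x\<^sup>2) * (norm (\<Phi> (x, n)))\<^sup>2) \<partial>lborel) * indicator ?J n)"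
        by (intro nn_integral_count_space') auto
      also have "\<dots> = (\<Sum>n\<in>?J. (\<integral>\<^sup>+x. ennreal (exp (- (1 / real (Suc N)) * x\<^sup>2) * (norm (\<Phi> (x, n)))\<^sup>2) \<partial>lborel))"
        by (intro sum.cong) auto
      also have "\<dots> \<le> ennreal (12 * pi\<^sup>2) * (\<integral>\<^sup>+z. ennreal ((norm (f z))\<^sup>2) \<partial>cyl_measure)"
        unfolding \<Phi>_def by (rule regularized_plancherel_cyl_le[OF _ _ f_int]) auto
      finally show ?thesis .
    qed
  qed
  note main = this
  have c: "(1 / (4 * pi\<^sup>2))\<^sup>2 * (12 * pi\<^sup>2) \<le> 1"
  proof -
    have "1 * 1 \<le> pi * pi" using pi_gt3 by (intro mult_mono) auto
    then show ?thesis by (simp add: field_simps power2_eq_square)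
  qed
  have "(\<integral>\<^sup>+\<xi>. ennreal ((norm (fourier_cyl f \<xi>))\<^sup>2) \<partial>freq_measure) = (\<integral>\<^sup>+\<xi>. ennreal ((1 / (4 * pi\<^sup>2))\<^sup>2) * ennreal ((norm (\<Phi> \<xi>))\<^sup>2) \<partial>freq_measure)"
    unfolding fourier_cyl_eq[OF assms] \<Phi>_def[symmetric]
    by (intro nn_integral_cong) (simp add: norm_mult norm_divide power_mult_distrib power_divide norm_power flip: ennreal_mult')
  also have "\<dots> = ennreal ((1 / (4 * pi\<^sup>2))\<^sup>2) * (\<integral>\<^sup>+\<xi>. ennreal ((norm (\<Phi> \<xi>))\<^sup>2) \<partial>freq_measure)"
    by (rule nn_integral_cmult) measurable
  also have "\<dots> \<le> ennreal ((1 / (4 * pi\<^sup>2))\<^sup>2) * (ennreal (12 * pi\<^sup>2) * (\<integral>\<^sup>+z. ennreal ((norm (f z))\<^sup>2) \<partial>cyl_measure))"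
    by (intro mult_left_mono main) simp
  also have "\<dots> = ennreal ((1 / (4 * pi\<^sup>2))\<^sup>2 * (12 * pi\<^sup>2)) * (\<integral>\<^sup>+z. ennreal ((norm (f z))\<^sup>2) \<partial>cyl_measure)"
    by (simp add: mult.assoc ennreal_mult')
  also have "\<dots> \<le> 1 * (\<integral>\<^sup>+z. ennreal ((norm (f z))\<^sup>2) \<partial>cyl_measure)"
    using ennreal_leI[OF c] by (intro mult_right_mono) simp_all
  finally show ?thesis by simp
qed

lemma nn_integral_square_eq_Lp_norm:
  assumes "integrable M (\<lambda>x. norm (f x) powr 2)"
  shows "(\<integral>\<^sup>+x. ennreal ((norm (f x))\<^sup>2) \<partial>M) = ennreal ((Lp_norm 2 M f)\<^sup>2)"
proof -
  have p: "(\<lambda>x. norm (f x) powr 2) = (\<lambda>x. (norm (f x))\<^sup>2)" by simp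
  have 0: "0 \<le> (LINT x|M. (norm (f x))\<^sup>2)" by simp
  have "(\<integral>\<^sup>+x. ennreal ((norm (f x))\<^sup>2) \<partial>M) = ennreal (LINT x|M. (norm (f x))\<^sup>2)"
    using assms unfolding p by (intro nn_integral_eq_integral) auto
  also have "(LINT x|M. (norm (f x))\<^sup>2) = (Lp_norm 2 M f)\<^sup>2"
    unfolding Lp_norm_def p using 0 by (simp add: powr_half_sqrt)
  finally show ?thesis .
qed

lemma in_L2_diff:
  assumes "in_Lp 2 M f" "in_Lp 2 M g"
  shows "in_Lp 2 M (\<lambda>x. f x - g x)"
proof -
  have m [measurable]: "f \<in> borel_measurable M" "g \<in> borel_measurable M"
    and i: "integrable M (\<lambda>x. norm (f x) powr 2)" "integrable M (\<lambda>x. norm (g x) powr 2)"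
    using assms by (auto simp: in_Lp_def)
  have "integrable M (\<lambda>x. norm (f x - g x) powr 2)"
  proof (rule Bochner_Integration.integrable_bound)
    show "integrable M (\<lambda>x. 2 * norm (f x) powr 2 + 2 * norm (g x) powr 2)" using i by auto
    have "(norm (f x - g x))\<^sup>2 \<le> 2 * (norm (f x))\<^sup>2 + 2 * (norm (g x))\<^sup>2" for x
    proof -
      have "(norm (f x - g x))\<^sup>2 \<le> (norm (f x) + norm (g x))\<^sup>2"
        by (intro power_mono norm_triangle_ineq4) auto
      also have "\<dots> \<le> 2 * (norm (f x))\<^sup>2 + 2 * (norm (g x))\<^sup>2"
        using sum_squares_bound[of "norm (f x)" "norm (g x)"] by (simp add: power2_sum)
      finally show ?thesis .
    qed
    then show "AE x in M. norm (norm (f x - g x) powr 2) \<le> norm (2 * norm (f x) powr 2 + 2 * norm (g x) powr 2)"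
      by (intro AE_I2) simp
  qed measurable
  then show ?thesis by (simp add: in_Lp_def)
qed

lemma L2_norm_square_le:
  assumes "in_Lp 2 M f" "in_Lp 2 M g"
  shows "(Lp_norm 2 M f)\<^sup>2 \<le> 2 * (Lp_norm 2 M (\<lambda>x. g x - f x))\<^sup>2 + 2 * (Lp_norm 2 M g)\<^sup>2"
proof -
  have m [measurable]: "f \<in> borel_measurable M" "g \<in> borel_measurable M"
    using assms by (auto simp: in_Lp_def)
  have i: "integrable M (\<lambda>x. norm (f x) powr 2)" "integrable M (\<lambda>x. norm (g x) powr 2)" "integrable M (\<lambda>x. norm (g x - f x) powr 2)"
    using assms in_L2_diff[OF assms(2,1)] by (auto simp: in_Lp_def)
  have "ennreal ((Lp_norm 2 M f)\<^sup>2) = (\<integral>\<^sup>+x. ennreal ((norm (f x))\<^sup>2) \<partial>M)"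
    by (rule nn_integral_square_eq_Lp_norm[OF i(1), symmetric])
  also have "\<dots> \<le> (\<integral>\<^sup>+x. 2 * ennreal ((norm (g x - f x))\<^sup>2) + 2 * ennreal ((norm (g x))\<^sup>2) \<partial>M)"
  proof (intro nn_integral_mono)
    fix x
    have "norm (f x) \<le> norm (g x - f x) + norm (g x)"
      using norm_triangle_ineq4[of "g x" "g x - f x"] by simp
    then have "(norm (f x))\<^sup>2 \<le> (norm (g x - f x) + norm (g x))\<^sup>2" by (intro power_mono) auto
    also have "\<dots> \<le> 2 * (norm (g x - f x))\<^sup>2 + 2 * (norm (g x))\<^sup>2"
      using sum_squares_bound[of "norm (g x - f x)" "norm (g x)"] by (simp add: power2_sum)
    finally have "ennreal ((norm (f x))\<^sup>2) \<le> ennreal (2 * (norm (g x - f x))\<^sup>2 + 2 * (norm (g x))\<^sup>2)"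
      by (rule ennreal_leI)
    also have "\<dots> = 2 * ennreal ((norm (g x - f x))\<^sup>2) + 2 * ennreal ((norm (g x))\<^sup>2)"
      by (simp add: ennreal_mult')
    finally show "ennreal ((norm (f x))\<^sup>2) \<le> 2 * ennreal ((norm (g x - f x))\<^sup>2) + 2 * ennreal ((norm (g x))\<^sup>2)" .
  qed
  also have "\<dots> = 2 * ennreal ((Lp_norm 2 M (\<lambda>x. g x - f x))\<^sup>2) + 2 * ennreal ((Lp_norm 2 M g)\<^sup>2)"
    unfolding nn_integral_square_eq_Lp_norm[OF i(2), symmetric] nn_integral_square_eq_Lp_norm[OF i(3), symmetric]
    by (simp add: nn_integral_add nn_integral_cmult)
  also have "\<dots> = ennreal (2 * (Lp_norm 2 M (\<lambda>x. g x - f x))\<^sup>2 + 2 * (Lp_norm 2 M g)\<^sup>2)"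
    by (simp add: ennreal_mult')
  finally show ?thesis by (subst (asm) ennreal_le_iff) auto
qed

text \<open>The inequality for the approximants passes to the limit. The factor \<open>4\<close> comes from using
\<open>|v + w|\<^sup>2 \<le> 2 |v|\<^sup>2 + 2 |w|\<^sup>2\<close> twice in place of Minkowski's inequality.\<close>

lemma fourier_L2_norm_le:
  assumes "is_fourier_L2 f g"
  shows "(Lp_norm 2 freq_measure g)\<^sup>2 \<le> 4 * (Lp_norm 2 cyl_measure f)\<^sup>2"
proof -
  obtain F where F1: "\<And>n::nat. in_Lp_cyl 1 (F n)" and F2: "\<And>n. in_Lp_cyl 2 (F n)"
    and Ff: "\<And>n. in_Lp 2 freq_measure (fourier_cyl (F n))"
    and l1: "(\<lambda>n. Lp_norm 2 cyl_measure (\<lambda>x. F n x - f x)) \<longlonglongrightarrow> 0"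
    and l2: "(\<lambda>n. Lp_norm 2 freq_measure (\<lambda>\<xi>. fourier_cyl (F n) \<xi> - g \<xi>)) \<longlonglongrightarrow> 0"
    and f: "in_Lp 2 cyl_measure f" and g: "in_Lp 2 freq_measure g"
    using assms unfolding is_fourier_L2_def in_Lp_cyl_def by blast
  have F2': "in_Lp 2 cyl_measure (F n)" for n using F2 by (simp add: in_Lp_cyl_def)
  define a where "a n = 2 * (Lp_norm 2 freq_measure (\<lambda>\<xi>. fourier_cyl (F n) \<xi> - g \<xi>))\<^sup>2
    + 2 * (2 * (Lp_norm 2 cyl_measure (\<lambda>x. F n x - f x))\<^sup>2 + 2 * (Lp_norm 2 cyl_measure f)\<^sup>2)" for n
  have "(Lp_norm 2 freq_measure g)\<^sup>2 \<le> a n" for n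
  proof -
    have "ennreal ((Lp_norm 2 freq_measure (fourier_cyl (F n)))\<^sup>2) \<le> ennreal ((Lp_norm 2 cyl_measure (F n))\<^sup>2)"
      using plancherel_cyl_le[OF F1[of n]] Ff[of n] F2'[of n]
      by (simp add: nn_integral_square_eq_Lp_norm in_Lp_def)
    then have 1: "(Lp_norm 2 freq_measure (fourier_cyl (F n)))\<^sup>2 \<le> (Lp_norm 2 cyl_measure (F n))\<^sup>2"
      by (subst (asm) ennreal_le_iff) auto
    have "Lp_norm 2 cyl_measure (\<lambda>x. f x - F n x) = Lp_norm 2 cyl_measure (\<lambda>x. F n x - f x)"
      by (simp add: Lp_norm_def norm_minus_commute)
    then have 2: "(Lp_norm 2 cyl_measure (F n))\<^sup>2 \<le> 2 * (Lp_norm 2 cyl_measure (\<lambda>x. F n x - f x))\<^sup>2 + 2 * (Lp_norm 2 cyl_measure f)\<^sup>2"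
      using L2_norm_square_le[OF F2' f, of n] by simp
    have "G \<le> 2 * X + 2 * (2 * W + 2 * V)" if "G \<le> 2 * X + 2 * Y" "Y \<le> Z" "Z \<le> 2 * W + 2 * V" for G X Y Z W V :: real
      by (rule order_trans[OF that(1)] add_left_mono mult_left_mono order_trans[OF that(2) that(3)])+ simp
    from this[OF L2_norm_square_le[OF g Ff[of n]] 1 2] show ?thesis unfolding a_def .
  qed
  moreover have "a \<longlonglongrightarrow> 2 * 0\<^sup>2 + 2 * (2 * 0\<^sup>2 + 2 * (Lp_norm 2 cyl_measure f)\<^sup>2)"
    unfolding a_def by (intro tendsto_intros l1 l2)
  ultimately have "(Lp_norm 2 freq_measure g)\<^sup>2 \<le> 2 * 0\<^sup>2 + 2 * (2 * 0\<^sup>2 + 2 * (Lp_norm 2 cyl_measure f)\<^sup>2)"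
    by (intro LIMSEQ_le_const) auto
  then show ?thesis by simp
qed

section \<open>Fourth moments of the extension under a Gaussian weight\<close>

text \<open>The complement of the essential support is covered by countably many of the open null sets that
define it, since products of rational intervals and singletons form a base.\<close>

lemma AE_eq_0_off_ess_supp:
  "AE \<xi> in freq_measure. \<xi> \<notin> ess_supp freq_measure f \<longrightarrow> f \<xi> = 0"
proof -
  define I where "I = {(r, s, n). r \<in> \<rat> \<and> s \<in> \<rat> \<and> (AE y in freq_measure. y \<in> {r<..<s} \<times> {n} \<longrightarrow> f y = 0)}"
  have "countable I"
    by (rule countable_subset[of _ "\<rat> \<times> \<rat> \<times> (UNIV :: int set)"]) (auto simp: I_def intro!: countable_SIGMA countable_rat)
  then have "AE y in freq_measure. \<forall>i\<in>I. y \<in> {fst i<..<fst (snd i)} \<times> {snd (snd i)} \<longrightarrow> f y = 0"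
    by (subst AE_ball_countable) (auto simp: I_def)
  then show ?thesis
  proof eventually_elim
    case (elim \<xi>)
    show ?case
    proof
      assume "\<xi> \<notin> ess_supp freq_measure f"
      then obtain U where U: "open U" "\<xi> \<in> U" "AE y in freq_measure. y \<in> U \<longrightarrow> f y = 0"
        unfolding ess_supp_def by blast
      obtain A B where AB: "open A" "open B" "\<xi> \<in> A \<times> B" "A \<times> B \<subseteq> U"
        using open_prod_elim[OF U(1,2)] by metis
      obtain e where e: "0 < e" "ball (fst \<xi>) e \<subseteq> A" using AB(1,3) unfolding open_contains_ball mem_Times_iff by blast
      obtain r where r: "r \<in> \<rat>" "fst \<xi> - e < r" "r < fst \<xi>" using Rats_dense_in_real[of "fst \<xi> - e" "fst \<xi>"] e by auto
      obtain s where s: "s \<in> \<rat>" "fst \<xi> < s" "s < fst \<xi> + e" using Rats_dense_in_real[of "fst \<xi>" "fst \<xi> + e"] e by auto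
      have "{r<..<s} \<times> {snd \<xi>} \<subseteq> U"
      proof -
        have "{r<..<s} \<subseteq> ball (fst \<xi>) e" using r s by (auto simp: dist_real_def)
        then have "{r<..<s} \<subseteq> A" using e(2) by (rule order_trans)
        then have "{r<..<s} \<times> {snd \<xi>} \<subseteq> A \<times> B"
          using AB(3) by (intro Sigma_mono) (auto simp: mem_Times_iff)
        then show ?thesis using AB(4) by (rule order_trans)
      qed
      then have "AE y in freq_measure. y \<in> {r<..<s} \<times> {snd \<xi>} \<longrightarrow> f y = 0"
        using U(3) by (auto elim!: AE_mp)
      then have "(r, s, snd \<xi>) \<in> I" using r s by (simp add: I_def)
      moreover have "\<xi> \<in> {r<..<s} \<times> {snd \<xi>}" using r s by (cases \<xi>) auto
      ultimately show "f \<xi> = 0" using elim by force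
    qed
  qed
qed

lemma nn_integral_freq_fst:
  assumes "f \<in> borel_measurable freq_measure"
  shows "(\<integral>\<^sup>+\<xi>. f \<xi> \<partial>freq_measure) = (\<integral>\<^sup>+x. \<integral>\<^sup>+n. f (x, n) \<partial>count_space UNIV \<partial>lborel)"
proof -
  interpret pair_sigma_finite lborel "count_space (UNIV :: int set)" by (rule pair_sigma_finite_freq)
  show ?thesis using assms unfolding freq_measure_def by (rule M2.nn_integral_fst[symmetric])
qed

lemma nn_integral_freq_snd:
  assumes "f \<in> borel_measurable freq_measure"
  shows "(\<integral>\<^sup>+\<xi>. f \<xi> \<partial>freq_measure) = (\<integral>\<^sup>+n. \<integral>\<^sup>+x. f (x, n) \<partial>lborel \<partial>count_space UNIV)"
proof -
  interpret pair_sigma_finite lborel "count_space (UNIV :: int set)" by (rule pair_sigma_finite_freq)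
  show ?thesis using assms unfolding freq_measure_def by (rule nn_integral_snd[symmetric])
qed

lemma measurable_into_freq:
  assumes [measurable]: "f \<in> borel_measurable M" "(\<lambda>x. real_of_int (g x)) \<in> borel_measurable M"
  shows "(\<lambda>x. (f x, g x)) \<in> measurable M freq_measure"
proof -
  have "g \<in> measurable M (count_space UNIV)"
  proof (subst measurable_count_space_eq2_countable, intro conjI ballI)
    fix n :: int
    have "g -` {n} \<inter> space M = {x \<in> space M. real_of_int (g x) = of_int n}" by auto
    also have "\<dots> \<in> sets M" by measurable
    finally show "g -` {n} \<inter> space M \<in> sets M" .
  qed auto
  then show ?thesis unfolding freq_measure_def using assms(1) by (intro measurable_Pair) auto
qed

lemma measurable_freq_coords [measurable]:
  "(\<lambda>\<xi>. fst \<xi>) \<in> borel_measurable freq_measure" "(\<lambda>\<xi>. real_of_int (snd \<xi>)) \<in> borel_measurable freq_measure"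
  unfolding freq_measure_def by (rule measurable_compose[OF measurable_fst], simp) (rule measurable_compose[OF measurable_snd], simp)

lemma space_freq_measure [simp]: "space freq_measure = UNIV"
  by (simp add: freq_measure_def space_pair_measure)

lemma nn_integral_freq_shift:
  assumes f [measurable]: "f \<in> borel_measurable freq_measure"
  shows "(\<integral>\<^sup>+\<xi>. f \<xi> \<partial>freq_measure) = (\<integral>\<^sup>+\<sigma>. f (fst \<sigma> - x, snd \<sigma> - m) \<partial>freq_measure)"
proof -
  have shift: "(\<lambda>\<sigma>. (fst \<sigma> - x, snd \<sigma> - m)) \<in> measurable freq_measure freq_measure"
    by (rule measurable_into_freq) (simp_all only: of_int_diff, measurable)
  have f2: "(\<lambda>\<sigma>. f (fst \<sigma> - x, snd \<sigma> - m)) \<in> borel_measurable freq_measure"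
    by (rule measurable_compose[OF shift f])
  define F where "F y = (\<integral>\<^sup>+n. f (y, n) \<partial>count_space UNIV)" for y
  have F_meas: "F \<in> borel_measurable borel"
  proof -
    interpret pair_sigma_finite lborel "count_space (UNIV :: int set)" by (rule pair_sigma_finite_freq)
    have "F \<in> borel_measurable lborel"
      unfolding F_def using M2.borel_measurable_nn_integral_fst[of f lborel] f by (simp add: freq_measure_def)
    then show ?thesis by simp
  qed
  have cs: "(\<integral>\<^sup>+n. f (y, n - m) \<partial>count_space UNIV) = F y" for y
    unfolding F_def by (rule nn_integral_bij_count_space[where g = "\<lambda>n. n - m" and f = "\<lambda>n. f (y, n)"])
      (rule bij_betwI[of _ _ _ "\<lambda>n. n + m"], auto)
  have "(\<integral>\<^sup>+\<sigma>. f (fst \<sigma> - x, snd \<sigma> - m) \<partial>freq_measure) = (\<integral>\<^sup>+y. F (- x + 1 * y) \<partial>lborel)"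
    unfolding nn_integral_freq_fst[OF f2] fst_conv snd_conv cs by simp
  also have "\<dots> = (\<integral>\<^sup>+y. F y \<partial>lborel)"
    using nn_integral_real_affine[OF F_meas, of 1 "- x"] by simp
  also have "\<dots> = (\<integral>\<^sup>+\<xi>. f \<xi> \<partial>freq_measure)"
    unfolding nn_integral_freq_fst[OF f] F_def ..
  finally show ?thesis by simp
qed

definition int_weight :: "int \<Rightarrow> real" where
  "int_weight j = 1 / (1 + (of_int j)\<^sup>2)"

lemma int_weight_nonneg [simp]: "0 \<le> int_weight j"
  by (simp add: int_weight_def)

lemma nn_integral_int_weight_finite: "(\<integral>\<^sup>+j. ennreal (int_weight j) \<partial>count_space UNIV) < \<infinity>"
proof -
  have summ: "summable (\<lambda>n::nat. 1 / (1 + (real n)\<^sup>2))"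
  proof (rule summable_comparison_test_ev)
    show "summable (\<lambda>n::nat. inverse ((real n)\<^sup>2))" by (rule inverse_power_summable) simp
    show "\<forall>\<^sub>F n in sequentially. norm (1 / (1 + (real n)\<^sup>2)) \<le> inverse ((real n)\<^sup>2)"
      using eventually_gt_at_top[of 0] by eventually_elim (auto simp: field_simps add_pos_nonneg)
  qed
  have half: "(\<integral>\<^sup>+j. ennreal (int_weight j) * indicator A j \<partial>count_space UNIV) < \<infinity>"
    if b: "bij_betw g (UNIV :: nat set) A" and g: "\<And>n. (real_of_int (g n))\<^sup>2 = (real n)\<^sup>2" for g A
  proof -
    have "(\<integral>\<^sup>+j. ennreal (int_weight j) * indicator A j \<partial>count_space UNIV) = (\<integral>\<^sup>+j. ennreal (int_weight j) \<partial>count_space A)"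
      by (cases "A = UNIV") (simp_all add: nn_integral_count_space_indicator)
    also have "\<dots> = (\<integral>\<^sup>+n. ennreal (int_weight (g n)) \<partial>count_space UNIV)"
      by (rule nn_integral_bij_count_space[OF b, symmetric])
    also have "\<dots> = (\<Sum>n. ennreal (1 / (1 + (real n)\<^sup>2)))"
      unfolding int_weight_def g by (rule nn_integral_count_space_nat)
    also have "\<dots> < \<infinity>" using summ by (simp add: suminf_ennreal2 less_top)
    finally show ?thesis .
  qed
  have "(\<integral>\<^sup>+j. ennreal (int_weight j) \<partial>count_space UNIV)
    \<le> (\<integral>\<^sup>+j. ennreal (int_weight j) * indicator {0..} j + ennreal (int_weight j) * indicator {..0} j \<partial>count_space UNIV)"
    by (intro nn_integral_mono) (auto simp: indicator_def)
  also have "\<dots> = (\<integral>\<^sup>+j. ennreal (int_weight j) * indicator {0..} j \<partial>count_space UNIV) + (\<integral>\<^sup>+j. ennreal (int_weight j) * indicator {..0} j \<partial>count_space UNIV)"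
    by (rule nn_integral_add) auto
  also have "\<dots> < \<infinity>"
  proof -
    have "bij_betw int UNIV {0..}" by (rule bij_betwI[of _ _ _ nat]) auto
    moreover have "bij_betw (\<lambda>n. - int n) UNIV {..0}" by (rule bij_betwI[of _ _ _ "\<lambda>j. nat (- j)"]) auto
    ultimately show ?thesis using half[of int "{0..}"] half[of "\<lambda>n. - int n" "{..0}"] by (simp add: ennreal_add_less_top)
  qed
  finally show ?thesis .
qed

text \<open>Replaces the Gaussian by a summable combination of unit windows, because the pair count is a
statement about unit windows.\<close>

lemma gauss_le_int_weight:
  "ennreal (exp (- d\<^sup>2 / 4)) \<le> (\<integral>\<^sup>+j. ennreal (8 * int_weight j) * indicator {of_int j..of_int j + 1} d \<partial>count_space UNIV)"
proof -
  define j where "j = \<lfloor>d\<rfloor>"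
  have j: "of_int j \<le> d" "d \<le> of_int j + 1" unfolding j_def by linarith+
  have "(of_int j)\<^sup>2 \<le> (\<bar>d\<bar> + 1)\<^sup>2"
  proof -
    have "\<bar>of_int j\<bar> \<le> \<bar>d\<bar> + 1" using j by linarith
    then have "\<bar>of_int j\<bar>\<^sup>2 \<le> (\<bar>d\<bar> + 1)\<^sup>2" by (intro power_mono) auto
    then show ?thesis by simp
  qed
  also have "\<dots> \<le> 2 * d\<^sup>2 + 2" using sum_squares_bound[of "\<bar>d\<bar>" 1] by (simp add: power2_sum)
  finally have j2: "1 + (of_int j)\<^sup>2 \<le> 8 * (1 + d\<^sup>2 / 4)" by simp
  have "1 + d\<^sup>2 / 4 \<le> exp (d\<^sup>2 / 4)" by (rule exp_ge_add_one_self)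
  then have "8 * (1 + d\<^sup>2 / 4) \<le> 8 * exp (d\<^sup>2 / 4)" by (intro mult_left_mono) auto
  with j2 have "1 + (of_int j)\<^sup>2 \<le> 8 * exp (d\<^sup>2 / 4)" by (rule order_trans)
  then have "exp (- d\<^sup>2 / 4) \<le> 8 * int_weight j"
    by (simp add: int_weight_def exp_minus field_simps add_pos_nonneg)
  then have "ennreal (exp (- d\<^sup>2 / 4)) \<le> ennreal (8 * int_weight j) * indicator {of_int j..of_int j + 1} d"
    using j by (simp add: ennreal_leI)
  also have "\<dots> \<le> (\<integral>\<^sup>+j. ennreal (8 * int_weight j) * indicator {of_int j..of_int j + 1} d \<partial>count_space UNIV)"
  proof -
    define F where "F i = ennreal (8 * int_weight i) * indicator {of_int i..of_int i + 1} d" for i :: int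
    have "F j \<le> (\<integral>\<^sup>+i. F i \<partial>count_space UNIV)" using sum_le_nn_integral_count_space[of "{j}" F] by simp
    then show ?thesis by (simp only: F_def)
  qed
  finally show ?thesis .
qed

lemma nn_integral_count_space_swap:
  "(\<integral>\<^sup>+x. \<integral>\<^sup>+y. G x y \<partial>count_space UNIV \<partial>count_space UNIV) = (\<integral>\<^sup>+y. \<integral>\<^sup>+x. G x y \<partial>count_space UNIV \<partial>count_space UNIV)"
  by (rule trans[OF nn_integral_fst_count_space[of "case_prod G", unfolded prod.case]
        nn_integral_snd_count_space[of "case_prod G", unfolded prod.case, symmetric]])

text \<open>The Schur integral of the fourth moment, after the substitution \<open>\<sigma> = \<xi> + \<zeta>\<close>. The Gaussian in
\<open>b0 - \<eta>\<close> has mass \<open>2 \<pi>\<close> for every \<open>\<epsilon>\<close>, and for fixed \<open>\<eta>\<close> the Gaussian in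
\<open>|\<xi>|\<^sup>2 + |\<zeta>|\<^sup>2 - a0\<close> splits into unit windows, each of which costs at most \<open>K\<close>.\<close>

lemma pair_slice_schur_bound:
  fixes \<epsilon> a0 b0 :: real and K :: ennreal
  assumes \<epsilon>: "0 < \<epsilon>" and S [measurable]: "S \<in> sets freq_measure"
    and K: "\<And>W \<eta>. (\<integral>\<^sup>+p. (\<integral>\<^sup>+m. emeasure lborel (pair_slice S W \<eta> p m) \<partial>count_space UNIV) \<partial>count_space UNIV) \<le> K"
  shows "(\<integral>\<^sup>+\<xi>. \<integral>\<^sup>+\<zeta>. ennreal (exp (- (((norm (freq_vec \<xi>))\<^sup>2 + (norm (freq_vec \<zeta>))\<^sup>2) - a0)\<^sup>2 / 4))
      * ennreal (sqrt (pi / \<epsilon>) * exp (- (1 / (4 * \<epsilon>)) * (b0 - (fst \<xi> + fst \<zeta>))\<^sup>2))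
      * (indicator S \<xi> * indicator S \<zeta>) \<partial>freq_measure \<partial>freq_measure)
    \<le> ennreal (2 * pi) * (8 * (\<integral>\<^sup>+j. ennreal (int_weight j) \<partial>count_space UNIV) * K)"
proof -
  interpret F: pair_sigma_finite freq_measure freq_measure
    by (intro pair_sigma_finite.intro sigma_finite_freq_measure)
  define \<sigma>0 where "\<sigma>0 = (\<integral>\<^sup>+j. ennreal (int_weight j) \<partial>count_space UNIV)"
  define \<omega> where "\<omega> \<xi> \<zeta> = (norm (freq_vec \<xi>))\<^sup>2 + (norm (freq_vec \<zeta>))\<^sup>2" for \<xi> \<zeta> :: "real \<times> int"
  define Q where "Q \<xi> \<zeta> = ennreal (exp (- (\<omega> \<xi> \<zeta> - a0)\<^sup>2 / 4)) * (indicator S \<xi> * indicator S \<zeta>)" for \<xi> \<zeta>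
  define \<Gamma> where "\<Gamma> v = ennreal (sqrt (pi / \<epsilon>) * exp (- (1 / (4 * \<epsilon>)) * (b0 - v)\<^sup>2))" for v
  have \<omega>_eq: "\<omega> \<xi> \<zeta> = (fst \<xi>)\<^sup>2 + (of_int (snd \<xi>))\<^sup>2 + ((fst \<zeta>)\<^sup>2 + (of_int (snd \<zeta>))\<^sup>2)" for \<xi> \<zeta>
    using norm_freq_vec_squared[of "fst \<xi>" "snd \<xi>"] norm_freq_vec_squared[of "fst \<zeta>" "snd \<zeta>"] by (simp add: \<omega>_def)
  have Q_meas [measurable]: "(\<lambda>z. Q (f z) (g z)) \<in> borel_measurable M"
    if [measurable]: "f \<in> measurable M freq_measure" "g \<in> measurable M freq_measure" for f g and M :: "'m measure"
    unfolding Q_def \<omega>_eq by measurable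
  have \<Gamma>_meas [measurable]: "\<Gamma> \<in> borel_measurable borel" unfolding \<Gamma>_def[abs_def] by measurable
  have diff: "(\<lambda>z. (fst (fst z) - fst (snd z), snd (fst z) - snd (snd z))) \<in> measurable (freq_measure \<Otimes>\<^sub>M freq_measure) freq_measure"
    by (rule measurable_into_freq) (simp_all only: of_int_diff, measurable)
  have diff': "(\<lambda>z. (fst (snd z) - fst (fst z), snd (snd z) - snd (fst z))) \<in> measurable (freq_measure \<Otimes>\<^sub>M freq_measure) freq_measure"
    by (rule measurable_into_freq) (simp_all only: of_int_diff, measurable)
  have Q\<Gamma>: "(\<lambda>z. Q (fst z) (fst (snd z) - fst (fst z), snd (snd z) - snd (fst z)) * \<Gamma> (fst (snd z)))
    \<in> borel_measurable (freq_measure \<Otimes>\<^sub>M freq_measure)"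
    by (intro borel_measurable_times_ennreal Q_meas diff' measurable_fst
        measurable_compose[OF measurable_compose[OF measurable_snd measurable_freq_coords(1)] \<Gamma>_meas])
  have diff1: "(\<lambda>\<xi>. (\<eta> - fst \<xi>, p - snd \<xi>)) \<in> measurable freq_measure freq_measure" for \<eta> p
    by (rule measurable_into_freq) (simp_all only: of_int_diff, measurable)
  have inner: "(\<integral>\<^sup>+p. \<integral>\<^sup>+\<xi>. Q \<xi> (\<eta> - fst \<xi>, p - snd \<xi>) \<partial>freq_measure \<partial>count_space UNIV) \<le> 8 * \<sigma>0 * K" for \<eta>
  proof -
    have slice_meas [measurable]: "pair_slice S W \<eta> p m \<in> sets lborel" for W p m
    proof -
      have [measurable]: "(\<lambda>x. (x, m)) \<in> measurable lborel freq_measure" "(\<lambda>x. (\<eta> - x, p - m)) \<in> measurable lborel freq_measure"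
        by (intro measurable_into_freq; simp)+
      show ?thesis unfolding pair_slice_def norm_freq_vec_squared by measurable
    qed
    have "(\<integral>\<^sup>+p. \<integral>\<^sup>+\<xi>. Q \<xi> (\<eta> - fst \<xi>, p - snd \<xi>) \<partial>freq_measure \<partial>count_space UNIV)
      = (\<integral>\<^sup>+p. \<integral>\<^sup>+m. \<integral>\<^sup>+x. Q (x, m) (\<eta> - x, p - m) \<partial>lborel \<partial>count_space UNIV \<partial>count_space UNIV)"
      using diff1 by (intro nn_integral_cong) (subst nn_integral_freq_snd, auto)
    also have "\<dots> \<le> (\<integral>\<^sup>+p. \<integral>\<^sup>+m. \<integral>\<^sup>+x. (\<integral>\<^sup>+j. ennreal (8 * int_weight j) * indicator (pair_slice S (a0 + of_int j) \<eta> p m) x \<partial>count_space UNIV) \<partial>lborel \<partial>count_space UNIV \<partial>count_space UNIV)"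
    proof (intro nn_integral_mono)
      fix p m :: int and x :: real
      show "Q (x, m) (\<eta> - x, p - m) \<le> (\<integral>\<^sup>+j. ennreal (8 * int_weight j) * indicator (pair_slice S (a0 + of_int j) \<eta> p m) x \<partial>count_space UNIV)"
      proof (cases "(x, m) \<in> S \<and> (\<eta> - x, p - m) \<in> S")
        case False
        then show ?thesis by (auto simp: Q_def)
      next
        case True
        have "Q (x, m) (\<eta> - x, p - m) = ennreal (exp (- (\<omega> (x, m) (\<eta> - x, p - m) - a0)\<^sup>2 / 4))"
          using True by (simp add: Q_def)
        also have "\<dots> \<le> (\<integral>\<^sup>+j. ennreal (8 * int_weight j) * indicator {of_int j..of_int j + 1} (\<omega> (x, m) (\<eta> - x, p - m) - a0) \<partial>count_space UNIV)"
          by (rule gauss_le_int_weight)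
        also have "\<dots> = (\<integral>\<^sup>+j. ennreal (8 * int_weight j) * indicator (pair_slice S (a0 + of_int j) \<eta> p m) x \<partial>count_space UNIV)"
          using True by (intro nn_integral_cong arg_cong2[where f = "(*)"] refl)
            (auto simp: indicator_def pair_slice_def \<omega>_def)
        finally show ?thesis .
      qed
    qed
    also have "\<dots> = (\<integral>\<^sup>+p. \<integral>\<^sup>+m. (\<integral>\<^sup>+j. ennreal (8 * int_weight j) * emeasure lborel (pair_slice S (a0 + of_int j) \<eta> p m) \<partial>count_space UNIV) \<partial>count_space UNIV \<partial>count_space UNIV)"
    proof (intro nn_integral_cong)
      fix p m :: int
      have "(\<integral>\<^sup>+x. (\<integral>\<^sup>+j. ennreal (8 * int_weight j) * indicator (pair_slice S (a0 + of_int j) \<eta> p m) x \<partial>count_space UNIV) \<partial>lborel)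
        = (\<integral>\<^sup>+j. (\<integral>\<^sup>+x. ennreal (8 * int_weight j) * indicator (pair_slice S (a0 + of_int j) \<eta> p m) x \<partial>lborel) \<partial>count_space UNIV)"
      proof (rule pair_sigma_finite.Fubini'[OF pair_sigma_finite_freq, symmetric])
        have [measurable]: "(\<lambda>z. (fst z, m)) \<in> measurable freq_measure freq_measure"
          "(\<lambda>z. (\<eta> - fst z, p - m)) \<in> measurable freq_measure freq_measure"
          by (intro measurable_into_freq; simp)+
        have [measurable]: "Measurable.pred freq_measure (\<lambda>z. fst z \<in> pair_slice S (a0 + of_int (snd z)) \<eta> p m)"
          unfolding pair_slice_def norm_freq_vec_squared mem_Collect_eq by measurable
        have "(\<lambda>z. ennreal (8 * int_weight (snd z)) * indicator {z. fst z \<in> pair_slice S (a0 + of_int (snd z)) \<eta> p m} z) \<in> borel_measurable freq_measure"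
          unfolding int_weight_def by measurable
        then show "(\<lambda>(x, j). ennreal (8 * int_weight j) * indicator (pair_slice S (a0 + of_int j) \<eta> p m) x) \<in> borel_measurable (lborel \<Otimes>\<^sub>M count_space UNIV)"
          by (simp add: freq_measure_def case_prod_beta' indicator_def)
      qed
      also have "\<dots> = (\<integral>\<^sup>+j. ennreal (8 * int_weight j) * emeasure lborel (pair_slice S (a0 + of_int j) \<eta> p m) \<partial>count_space UNIV)"
        by (intro nn_integral_cong nn_integral_cmult_indicator slice_meas)
      finally show "(\<integral>\<^sup>+x. (\<integral>\<^sup>+j. ennreal (8 * int_weight j) * indicator (pair_slice S (a0 + of_int j) \<eta> p m) x \<partial>count_space UNIV) \<partial>lborel)
        = (\<integral>\<^sup>+j. ennreal (8 * int_weight j) * emeasure lborel (pair_slice S (a0 + of_int j) \<eta> p m) \<partial>count_space UNIV)" .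
    qed
    also have "\<dots> = (\<integral>\<^sup>+j. ennreal (8 * int_weight j) * (\<integral>\<^sup>+p. \<integral>\<^sup>+m. emeasure lborel (pair_slice S (a0 + of_int j) \<eta> p m) \<partial>count_space UNIV \<partial>count_space UNIV) \<partial>count_space UNIV)"
    proof -
      define G where "G p m j = ennreal (8 * int_weight j) * emeasure lborel (pair_slice S (a0 + of_int j) \<eta> p m)" for p m j :: int
      have "(\<integral>\<^sup>+p. \<integral>\<^sup>+m. \<integral>\<^sup>+j. G p m j \<partial>count_space UNIV \<partial>count_space UNIV \<partial>count_space UNIV)
        = (\<integral>\<^sup>+p. \<integral>\<^sup>+j. \<integral>\<^sup>+m. G p m j \<partial>count_space UNIV \<partial>count_space UNIV \<partial>count_space UNIV)"
        by (intro nn_integral_cong nn_integral_count_space_swap)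
      also have "\<dots> = (\<integral>\<^sup>+j. \<integral>\<^sup>+p. \<integral>\<^sup>+m. G p m j \<partial>count_space UNIV \<partial>count_space UNIV \<partial>count_space UNIV)"
        by (rule nn_integral_count_space_swap)
      finally show ?thesis unfolding G_def by (simp add: nn_integral_cmult)
    qed
    also have "\<dots> \<le> (\<integral>\<^sup>+j. ennreal (8 * int_weight j) * K \<partial>count_space UNIV)"
      by (intro nn_integral_mono mult_left_mono K) auto
    also have "\<dots> = (\<integral>\<^sup>+j. (8 * K) * ennreal (int_weight j) \<partial>count_space UNIV)"
      by (intro nn_integral_cong) (simp add: ennreal_mult mult_ac)
    also have "\<dots> = (8 * K) * \<sigma>0" unfolding \<sigma>0_def by (rule nn_integral_cmult) simp
    also have "\<dots> = 8 * \<sigma>0 * K" by (simp add: mult_ac)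
    finally show ?thesis .
  qed
  have "(\<integral>\<^sup>+\<xi>. \<integral>\<^sup>+\<zeta>. Q \<xi> \<zeta> * \<Gamma> (fst \<xi> + fst \<zeta>) \<partial>freq_measure \<partial>freq_measure)
    = (\<integral>\<^sup>+\<xi>. \<integral>\<^sup>+\<sigma>. Q \<xi> (fst \<sigma> - fst \<xi>, snd \<sigma> - snd \<xi>) * \<Gamma> (fst \<sigma>) \<partial>freq_measure \<partial>freq_measure)"
  proof (rule nn_integral_cong)
    fix \<xi> :: "real \<times> int"
    have "(\<lambda>\<zeta>. Q \<xi> \<zeta> * \<Gamma> (fst \<xi> + fst \<zeta>)) \<in> borel_measurable freq_measure" by measurable
    from nn_integral_freq_shift[OF this, of "fst \<xi>" "snd \<xi>"]
    show "(\<integral>\<^sup>+\<zeta>. Q \<xi> \<zeta> * \<Gamma> (fst \<xi> + fst \<zeta>) \<partial>freq_measure) = (\<integral>\<^sup>+\<sigma>. Q \<xi> (fst \<sigma> - fst \<xi>, snd \<sigma> - snd \<xi>) * \<Gamma> (fst \<sigma>) \<partial>freq_measure)"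
      by simp
  qed
  also have "\<dots> = (\<integral>\<^sup>+\<sigma>. \<integral>\<^sup>+\<xi>. Q \<xi> (fst \<sigma> - fst \<xi>, snd \<sigma> - snd \<xi>) * \<Gamma> (fst \<sigma>) \<partial>freq_measure \<partial>freq_measure)"
    using Q\<Gamma> by (intro F.Fubini'[symmetric]) (simp add: case_prod_beta')
  also have "\<dots> = (\<integral>\<^sup>+\<sigma>. \<Gamma> (fst \<sigma>) * (\<integral>\<^sup>+\<xi>. Q \<xi> (fst \<sigma> - fst \<xi>, snd \<sigma> - snd \<xi>) \<partial>freq_measure) \<partial>freq_measure)"
    using diff1 by (intro nn_integral_cong) (subst nn_integral_multc, auto simp: mult.commute)
  also have "\<dots> = (\<integral>\<^sup>+\<eta>. \<integral>\<^sup>+p. \<Gamma> \<eta> * (\<integral>\<^sup>+\<xi>. Q \<xi> (\<eta> - fst \<xi>, p - snd \<xi>) \<partial>freq_measure) \<partial>count_space UNIV \<partial>lborel)"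
  proof -
    have "(\<lambda>\<sigma>. \<integral>\<^sup>+\<xi>. Q \<xi> (fst \<sigma> - fst \<xi>, snd \<sigma> - snd \<xi>) \<partial>freq_measure) \<in> borel_measurable freq_measure"
      using diff by (intro sigma_finite_measure.borel_measurable_nn_integral[OF sigma_finite_freq_measure]) (simp add: case_prod_beta')
    then show ?thesis by (subst nn_integral_freq_fst) auto
  qed
  also have "\<dots> = (\<integral>\<^sup>+\<eta>. \<Gamma> \<eta> * (\<integral>\<^sup>+p. \<integral>\<^sup>+\<xi>. Q \<xi> (\<eta> - fst \<xi>, p - snd \<xi>) \<partial>freq_measure \<partial>count_space UNIV) \<partial>lborel)"
    by (intro nn_integral_cong nn_integral_cmult) auto
  also have "\<dots> \<le> (\<integral>\<^sup>+\<eta>. \<Gamma> \<eta> * (8 * \<sigma>0 * K) \<partial>lborel)"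
    by (intro nn_integral_mono mult_left_mono inner) auto
  also have "\<dots> = (\<integral>\<^sup>+\<eta>. \<Gamma> \<eta> \<partial>lborel) * (8 * \<sigma>0 * K)" by (rule nn_integral_multc) measurable
  also have "(\<integral>\<^sup>+\<eta>. \<Gamma> \<eta> \<partial>lborel) = ennreal (2 * pi)"
  proof -
    have pos: "0 < 1 / (4 * \<epsilon>)" using \<epsilon> by simp
    have "(\<integral>\<^sup>+\<eta>. \<Gamma> \<eta> \<partial>lborel) = (\<integral>\<^sup>+\<eta>. ennreal (sqrt (pi / \<epsilon>)) * ennreal (exp (- (1 / (4 * \<epsilon>)) * (b0 - \<eta>)\<^sup>2)) \<partial>lborel)"
      unfolding \<Gamma>_def using \<epsilon> by (intro nn_integral_cong ennreal_mult) auto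
    also have "\<dots> = ennreal (sqrt (pi / \<epsilon>)) * ennreal (sqrt (pi / (1 / (4 * \<epsilon>))))"
      unfolding nn_integral_gauss_shift[OF pos, of b0, symmetric] by (rule nn_integral_cmult) measurable
    also have "\<dots> = ennreal (sqrt (pi / \<epsilon>) * sqrt (pi / (1 / (4 * \<epsilon>))))" using \<epsilon> by (simp flip: ennreal_mult')
    also have "sqrt (pi / \<epsilon>) * sqrt (pi / (1 / (4 * \<epsilon>))) = sqrt (4 * pi\<^sup>2)"
      using \<epsilon> by (simp add: real_sqrt_mult[symmetric] power2_eq_square)
    also have "sqrt (4 * pi\<^sup>2) = 2 * pi" by (simp add: real_sqrt_mult)
    finally show ?thesis .
  qed
  finally show ?thesis unfolding Q_def \<Gamma>_def \<omega>_def \<sigma>0_def by (simp add: mult_ac)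
qed

text \<open>Moving the centre of the weight changes its transform by a phase only, so the estimates below are
uniform in \<open>t0\<close>.\<close>

lemma norm_gauss_time_integral:
  "norm (LINT t|lborel. exp (- (t - t0)\<^sup>2) *\<^sub>R exp (\<i> * of_real (b * t))) = sqrt pi * exp (- b\<^sup>2 / 4)"
proof -
  have "(LINT t|lborel. exp (- (t - t0)\<^sup>2) *\<^sub>R exp (\<i> * of_real (b * t)))
    = \<bar>1\<bar> *\<^sub>R (LINT t|lborel. exp (- ((t0 + 1 * t) - t0)\<^sup>2) *\<^sub>R exp (\<i> * of_real (b * (t0 + 1 * t))))"
    by (rule lborel_integral_real_affine) simp
  also have "\<dots> = (LINT t|lborel. exp (\<i> * of_real (b * t0)) * (exp (- 1 * t\<^sup>2) *\<^sub>R exp (\<i> * of_real (b * t))))"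
    by (simp add: distrib_left mult_ac exp_add)
  also have "\<dots> = exp (\<i> * of_real (b * t0)) * (LINT t|lborel. exp (- 1 * t\<^sup>2) *\<^sub>R exp (\<i> * of_real (b * t)))"
    by (rule integral_mult_right_zero)
  also have "\<dots> = exp (\<i> * of_real (b * t0)) * complex_of_real (sqrt (pi / 1) * exp (- b\<^sup>2 / (4 * 1)))"
    by (subst integral_gauss_iexp) auto
  finally show ?thesis by (simp add: norm_mult)
qed

lemma nn_integral_product_square:
  assumes "sigma_finite_measure M" and [measurable]: "f \<in> borel_measurable M"
  shows "(\<integral>\<^sup>+z. f (fst z) * f (snd z) \<partial>(M \<Otimes>\<^sub>M M)) = (\<integral>\<^sup>+x. f x \<partial>M)\<^sup>2"
proof -
  interpret sigma_finite_measure M by fact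
  show ?thesis
    by (subst nn_integral_fst[symmetric])
       (simp_all add: nn_integral_cmult nn_integral_multc power2_eq_square)
qed

lemma extension_op_measurable:
  assumes "h \<in> borel_measurable freq_measure"
  shows "(\<lambda>(t, x). extension_op h t x) \<in> borel_measurable (lborel \<Otimes>\<^sub>M lborel)"
proof -
  interpret sigma_finite_measure freq_measure by (rule sigma_finite_freq_measure)
  note assms [measurable]
  have "(\<lambda>(p, \<xi>). exp (\<i> * of_real (snd p * fst \<xi>) - \<i> * of_real (fst p * ((fst \<xi>)\<^sup>2 + (of_int (snd \<xi>))\<^sup>2))) * h \<xi>)
    \<in> borel_measurable ((lborel \<Otimes>\<^sub>M lborel) \<Otimes>\<^sub>M freq_measure)"
    unfolding case_prod_beta' by measurable
  then have "(\<lambda>p. LINT \<xi>|freq_measure. exp (\<i> * of_real (snd p * fst \<xi>) - \<i> * of_real (fst p * ((fst \<xi>)\<^sup>2 + (of_int (snd \<xi>))\<^sup>2))) * h \<xi>)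
    \<in> borel_measurable (lborel \<Otimes>\<^sub>M lborel)"
    by (rule borel_measurable_lebesgue_integral)
  moreover have "(norm (freq_vec \<xi>))\<^sup>2 = (fst \<xi>)\<^sup>2 + (of_int (snd \<xi>))\<^sup>2" for \<xi>
    using norm_freq_vec_squared[of "fst \<xi>" "snd \<xi>"] by simp
  ultimately show ?thesis by (simp add: extension_op_def case_prod_beta')
qed

text \<open>The square of the extension of \<open>h\<close> is the extension of \<open>h(\<xi>) h(\<zeta>)\<close> on the space of pairs, with
the phase functions \<open>a\<close> and \<open>b\<close>. The additional weight \<open>exp (- \<epsilon> x\<^sup>2)\<close> makes the integrals over
\<open>x\<close> absolutely convergent; it disappears in the limit.\<close>

lemma extension_op_gauss_L4:
  fixes K :: ennreal
  assumes h: "integrable freq_measure h" and S: "S \<in> sets freq_measure" and hS: "\<And>\<xi>. \<xi> \<notin> S \<Longrightarrow> h \<xi> = 0"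
    and K: "\<And>W \<eta>. (\<integral>\<^sup>+p. (\<integral>\<^sup>+m. emeasure lborel (pair_slice S W \<eta> p m) \<partial>count_space UNIV) \<partial>count_space UNIV) \<le> K"
  shows "(\<integral>\<^sup>+(t, x). ennreal (exp (- (t - t0)\<^sup>2) * norm (extension_op h t x) ^ 4) \<partial>(lborel \<Otimes>\<^sub>M lborel))
    \<le> ennreal (sqrt pi) * (ennreal (2 * pi) * (8 * (\<integral>\<^sup>+j. ennreal (int_weight j) \<partial>count_space UNIV) * K))
       * (\<integral>\<^sup>+\<xi>. ennreal ((norm (h \<xi>))\<^sup>2) \<partial>freq_measure)\<^sup>2"
    (is "_ \<le> ?A * _")
proof -
  let ?F2 = "freq_measure \<Otimes>\<^sub>M freq_measure"
  let ?L2 = "(lborel :: real measure) \<Otimes>\<^sub>M (lborel :: real measure)"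
  interpret F: pair_sigma_finite freq_measure freq_measure
    by (intro pair_sigma_finite.intro sigma_finite_freq_measure)
  have sfP: "sigma_finite_measure ?F2" ..
  have sfL: "sigma_finite_measure ((lborel :: real measure) \<Otimes>\<^sub>M (lborel :: real measure))" 
    unfolding lborel_prod ..
  have h_meas [measurable]: "h \<in> borel_measurable freq_measure" using h by simp
  define a where "a Y = (norm (freq_vec (fst Y)))\<^sup>2 + (norm (freq_vec (snd Y)))\<^sup>2" for Y :: "(real \<times> int) \<times> (real \<times> int)"
  define b where "b Y = fst (fst Y) + fst (snd Y)" for Y :: "(real \<times> int) \<times> (real \<times> int)"
  define H where "H Y = h (fst Y) * h (snd Y)" for Y
  have a_eq: "a Y = (fst (fst Y))\<^sup>2 + (of_int (snd (fst Y)))\<^sup>2 + ((fst (snd Y))\<^sup>2 + (of_int (snd (snd Y)))\<^sup>2)" for Y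
    using norm_freq_vec_squared[of "fst (fst Y)" "snd (fst Y)"] norm_freq_vec_squared[of "fst (snd Y)" "snd (snd Y)"]
    by (simp add: a_def)
  have ab_meas [measurable]: "a \<in> borel_measurable ?F2" "b \<in> borel_measurable ?F2"
    unfolding a_eq[abs_def] b_def[abs_def] by measurable
  define e where "e \<theta> Y = exp (\<i> * of_real (snd \<theta> * b Y - fst \<theta> * a Y))" for \<theta> :: "real \<times> real" and Y
  have h1: "(\<integral>\<^sup>+y. ennreal (norm (h y)) \<partial>freq_measure) < \<infinity>" using h by (simp add: integrable_iff_bounded)
  have H_int: "integrable ?F2 H"
  proof (rule integrableI_bounded)
    have "(\<integral>\<^sup>+Y. ennreal (norm (H Y)) \<partial>?F2) = (\<integral>\<^sup>+y. ennreal (norm (h y)) \<partial>freq_measure)\<^sup>2"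
      by (subst nn_integral_product_square[OF sigma_finite_freq_measure, symmetric])
         (auto simp: H_def norm_mult ennreal_mult)
    then show "(\<integral>\<^sup>+Y. ennreal (norm (H Y)) \<partial>?F2) < \<infinity>"
      using h1 by (simp add: power2_eq_square ennreal_mult_less_top)
  qed (simp add: H_def[abs_def])
  have E2: "(LINT Y|?F2. e (t, x) Y * H Y) = (extension_op h t x)\<^sup>2" for t x
  proof -
    define u where "u \<xi> = exp (\<i> * of_real (x * fst \<xi>) - \<i> * of_real (t * (norm (freq_vec \<xi>))\<^sup>2)) * h \<xi>" for \<xi>
    have eu: "e (t, x) Y * H Y = u (fst Y) * u (snd Y)" for Y
      by (simp add: e_def H_def u_def a_def b_def algebra_simps flip: exp_add)
    have i: "integrable ?F2 (\<lambda>(\<xi>, \<zeta>). u \<xi> * u \<zeta>)"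
    proof (rule Bochner_Integration.integrable_bound[OF H_int])
      have "(\<lambda>Y. e (t, x) Y * H Y) \<in> borel_measurable ?F2"
        unfolding e_def H_def by measurable
      then show "(\<lambda>(\<xi>, \<zeta>). u \<xi> * u \<zeta>) \<in> borel_measurable ?F2"
        unfolding eu by (simp add: case_prod_beta')
      have "norm (u (fst Y) * u (snd Y)) = norm (H Y)" for Y
        unfolding eu[symmetric] by (simp add: e_def norm_mult)
      then show "AE Y in ?F2. norm (case Y of (\<xi>, \<zeta>) \<Rightarrow> u \<xi> * u \<zeta>) \<le> norm (H Y)"
        by (simp add: case_prod_beta')
    qed
    have "(LINT Y|?F2. e (t, x) Y * H Y) = (LINT \<xi>|freq_measure. LINT \<zeta>|freq_measure. u \<xi> * u \<zeta>)"
      unfolding eu using F.integral_fst[OF i] by (simp add: case_prod_beta')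
    also have "\<dots> = (LINT \<xi>|freq_measure. u \<xi>) * (LINT \<zeta>|freq_measure. u \<zeta>)"
      by (simp only: integral_mult_right_zero integral_mult_left_zero)
    finally show ?thesis by (simp add: extension_op_def u_def power2_eq_square)
  qed
  have reg: "(\<integral>\<^sup>+(t, x). ennreal (exp (- (t - t0)\<^sup>2) * exp (- \<epsilon> * x\<^sup>2) * norm (extension_op h t x) ^ 4) \<partial>?L2)
    \<le> ?A * (\<integral>\<^sup>+\<xi>. ennreal ((norm (h \<xi>))\<^sup>2) \<partial>freq_measure)\<^sup>2" if \<epsilon>: "0 < \<epsilon>" for \<epsilon>
  proof -
    define w where "w \<theta> = exp (- (fst \<theta> - t0)\<^sup>2) * exp (- \<epsilon> * (snd \<theta>)\<^sup>2)" for \<theta> :: "real \<times> real"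
    define k where "k Y Y' = ennreal (sqrt pi * exp (- (a Y' - a Y)\<^sup>2 / 4) * (sqrt (pi / \<epsilon>) * exp (- (1 / (4 * \<epsilon>)) * (b Y - b Y')\<^sup>2)))" for Y Y'
    have w_int: "integrable ?L2 w"
    proof -
      have g1: "integrable lborel (\<lambda>t. exp (- (t - t0)\<^sup>2))"
        using lborel_integrable_real_affine[OF integrable_gauss[of 1], of 1 "- t0"] by simp
      have "integrable ?L2 (\<lambda>(t, x). exp (- (t - t0)\<^sup>2) * exp (- \<epsilon> * x\<^sup>2))"
      proof (rule lborel_pair.Fubini_integrable)
        show "integrable lborel (\<lambda>t. LINT x|lborel. norm (case (t, x) of (t, x) \<Rightarrow> exp (- (t - t0)\<^sup>2) * exp (- \<epsilon> * x\<^sup>2)))"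
          using g1 by simp
        show "AE t in lborel. integrable lborel (\<lambda>x. case (t, x) of (t, x) \<Rightarrow> exp (- (t - t0)\<^sup>2) * exp (- \<epsilon> * x\<^sup>2))"
          using integrable_gauss[OF \<epsilon>] by simp
      qed measurable
      then show ?thesis by (simp add: w_def[abs_def] case_prod_beta')
    qed
    have kernel: "norm (LINT \<theta>|?L2. w \<theta> *\<^sub>R (e \<theta> Y * cnj (e \<theta> Y')))
      = sqrt pi * exp (- (a Y' - a Y)\<^sup>2 / 4) * (sqrt (pi / \<epsilon>) * exp (- (1 / (4 * \<epsilon>)) * (b Y - b Y')\<^sup>2))" for Y Y'
    proof -
      have e2: "w (t, x) *\<^sub>R (e (t, x) Y * cnj (e (t, x) Y'))
        = (exp (- (t - t0)\<^sup>2) *\<^sub>R exp (\<i> * of_real ((a Y' - a Y) * t))) * (exp (- \<epsilon> * x\<^sup>2) *\<^sub>R exp (\<i> * of_real ((b Y - b Y') * x)))" for t x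
      proof -
        have "e (t, x) Y * cnj (e (t, x) Y') = exp (\<i> * of_real ((a Y' - a Y) * t)) * exp (\<i> * of_real ((b Y - b Y') * x))"
          by (simp add: e_def exp_cnj algebra_simps flip: exp_add)
        then show ?thesis by (simp add: w_def scaleR_conv_of_real)
      qed
      have i: "integrable ?L2 (\<lambda>(t, x). w (t, x) *\<^sub>R (e (t, x) Y * cnj (e (t, x) Y')))"
      proof (rule Bochner_Integration.integrable_bound[OF w_int])
        show "(\<lambda>(t, x). w (t, x) *\<^sub>R (e (t, x) Y * cnj (e (t, x) Y'))) \<in> borel_measurable ?L2"
          unfolding e_def w_def by measurable
      qed (auto simp: e_def norm_mult)
      have "(LINT \<theta>|?L2. w \<theta> *\<^sub>R (e \<theta> Y * cnj (e \<theta> Y'))) = (LINT t|lborel. LINT x|lborel. w (t, x) *\<^sub>R (e (t, x) Y * cnj (e (t, x) Y')))"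
        using lborel_pair.integral_fst[OF i] by (simp add: case_prod_beta')
      also have "\<dots> = (LINT t|lborel. exp (- (t - t0)\<^sup>2) *\<^sub>R exp (\<i> * of_real ((a Y' - a Y) * t))) * (LINT x|lborel. exp (- \<epsilon> * x\<^sup>2) *\<^sub>R exp (\<i> * of_real ((b Y - b Y') * x)))"
        unfolding e2 by (simp only: integral_mult_right_zero integral_mult_left_zero)
      finally show ?thesis
        unfolding integral_gauss_iexp[OF \<epsilon>]
        by (simp only: norm_mult norm_gauss_time_integral norm_of_real) (use \<epsilon> in simp)
    qed
    have "(\<integral>\<^sup>+\<theta>. ennreal (w \<theta> * (norm (LINT Y|?F2. e \<theta> Y * H Y))\<^sup>2) \<partial>?L2)
      \<le> ?A * (\<integral>\<^sup>+Y. ennreal ((norm (H Y))\<^sup>2) \<partial>?F2)"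
    proof (rule schur_extension_bound[OF sfP sfL _ _ w_int _ H_int, where k = k])
      show "(\<lambda>(\<theta>, Y). e \<theta> Y) \<in> borel_measurable (?L2 \<Otimes>\<^sub>M ?F2)"
        unfolding e_def by measurable
      show "norm (e \<theta> Y) \<le> 1" for \<theta> Y by (simp add: e_def)
      show "0 \<le> w \<theta>" for \<theta> by (simp add: w_def)
      show "(\<lambda>(Y, Y'). k Y Y') \<in> borel_measurable (?F2 \<Otimes>\<^sub>M ?F2)"
        unfolding k_def by measurable
      show "k Y Y' = k Y' Y" for Y Y' by (simp add: k_def power2_commute)
      show "ennreal (norm (LINT \<theta>|?L2. w \<theta> *\<^sub>R (e \<theta> Y * cnj (e \<theta> Y')))) \<le> k Y Y'" for Y Y'
        unfolding kernel k_def by simp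
      show "(\<integral>\<^sup>+Y'. k Y Y' * indicator {Y'. H Y' \<noteq> 0} Y' \<partial>?F2) \<le> ?A" for Y
      proof -
        define q where "q \<xi> \<zeta> = ennreal (exp (- (((norm (freq_vec \<xi>))\<^sup>2 + (norm (freq_vec \<zeta>))\<^sup>2) - a Y)\<^sup>2 / 4))
          * ennreal (sqrt (pi / \<epsilon>) * exp (- (1 / (4 * \<epsilon>)) * (b Y - (fst \<xi> + fst \<zeta>))\<^sup>2))
          * (indicator S \<xi> * indicator S \<zeta>)" for \<xi> \<zeta>
        have q_meas: "(\<lambda>Y'. q (fst Y') (snd Y')) \<in> borel_measurable ?F2"
        proof -
          note S [measurable]
          have "(\<lambda>Y'. ennreal (exp (- (a Y' - a Y)\<^sup>2 / 4)) * ennreal (sqrt (pi / \<epsilon>) * exp (- (1 / (4 * \<epsilon>)) * (b Y - b Y')\<^sup>2))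
            * (indicator S (fst Y') * indicator S (snd Y'))) \<in> borel_measurable ?F2" by measurable
          then show ?thesis by (simp add: q_def a_def b_def)
        qed
        have "(\<integral>\<^sup>+Y'. k Y Y' * indicator {Y'. H Y' \<noteq> 0} Y' \<partial>?F2)
          \<le> (\<integral>\<^sup>+Y'. ennreal (sqrt pi) * q (fst Y') (snd Y') \<partial>?F2)"
        proof (intro nn_integral_mono)
          fix Y'
          show "k Y Y' * indicator {Y'. H Y' \<noteq> 0} Y' \<le> ennreal (sqrt pi) * q (fst Y') (snd Y')"
          proof (cases "H Y' = 0")
            case False
            then have "fst Y' \<in> S" "snd Y' \<in> S" using hS[of "fst Y'"] hS[of "snd Y'"] by (auto simp: H_def)
            then show ?thesis using False \<epsilon>
              by (simp add: k_def q_def a_def[of Y'] b_def[of Y'] ennreal_mult mult.assoc)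
          qed simp
        qed
        also have "\<dots> = ennreal (sqrt pi) * (\<integral>\<^sup>+Y'. q (fst Y') (snd Y') \<partial>?F2)"
          by (rule nn_integral_cmult[OF q_meas])
        also have "(\<integral>\<^sup>+Y'. q (fst Y') (snd Y') \<partial>?F2) = (\<integral>\<^sup>+\<xi>. \<integral>\<^sup>+\<zeta>. q \<xi> \<zeta> \<partial>freq_measure \<partial>freq_measure)"
          using sigma_finite_measure.nn_integral_fst[OF sigma_finite_freq_measure q_meas] by simp
        also have "\<dots> \<le> ennreal (2 * pi) * (8 * (\<integral>\<^sup>+j. ennreal (int_weight j) \<partial>count_space UNIV) * K)"
          unfolding q_def by (rule pair_slice_schur_bound[OF \<epsilon> S K])
        finally show ?thesis by (simp add: mult_left_mono)
      qed
    qed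
    also have "(\<integral>\<^sup>+Y. ennreal ((norm (H Y))\<^sup>2) \<partial>?F2) = (\<integral>\<^sup>+\<xi>. ennreal ((norm (h \<xi>))\<^sup>2) \<partial>freq_measure)\<^sup>2"
      by (subst nn_integral_product_square[OF sigma_finite_freq_measure, symmetric])
         (auto simp: H_def norm_mult ennreal_mult power_mult_distrib)
    also have "(\<integral>\<^sup>+\<theta>. ennreal (w \<theta> * (norm (LINT Y|?F2. e \<theta> Y * H Y))\<^sup>2) \<partial>?L2)
      = (\<integral>\<^sup>+(t, x). ennreal (exp (- (t - t0)\<^sup>2) * exp (- \<epsilon> * x\<^sup>2) * norm (extension_op h t x) ^ 4) \<partial>?L2)"
      by (intro nn_integral_cong) (auto simp: E2 w_def norm_power simp flip: power_mult)
    finally show ?thesis .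
  qed
  note E_meas [measurable] = extension_op_measurable[OF h_meas]
  show ?thesis
  proof (rule nn_integral_le_of_tendsto)
    show "(\<lambda>(t, x). ennreal (exp (- (t - t0)\<^sup>2) * exp (- (1 / real (Suc n)) * x\<^sup>2) * norm (extension_op h t x) ^ 4)) \<in> borel_measurable ?L2" for n
      using E_meas unfolding case_prod_beta' by measurable
    show "(\<lambda>n. case z of (t, x) \<Rightarrow> ennreal (exp (- (t - t0)\<^sup>2) * exp (- (1 / real (Suc n)) * x\<^sup>2) * norm (extension_op h t x) ^ 4))
      \<longlonglongrightarrow> (case z of (t, x) \<Rightarrow> ennreal (exp (- (t - t0)\<^sup>2) * norm (extension_op h t x) ^ 4))" for z
    proof (cases z)
      case (Pair t x)
      have "(\<lambda>n. - (1 / real (Suc n)) * x\<^sup>2) \<longlonglongrightarrow> - 0 * x\<^sup>2"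
        by (intro tendsto_intros LIMSEQ_Suc lim_1_over_n)
      from tendsto_mult[OF tendsto_mult[OF tendsto_const[of "exp (- (t - t0)\<^sup>2)"] tendsto_exp[OF this]] tendsto_const[of "norm (extension_op h t x) ^ 4"]]
      have "(\<lambda>n. exp (- (t - t0)\<^sup>2) * exp (- (1 / real (Suc n)) * x\<^sup>2) * norm (extension_op h t x) ^ 4) \<longlonglongrightarrow> exp (- (t - t0)\<^sup>2) * norm (extension_op h t x) ^ 4"
        by simp
      then show ?thesis unfolding Pair prod.case by (intro tendsto_ennrealI)
    qed
    show "(\<integral>\<^sup>+(t, x). ennreal (exp (- (t - t0)\<^sup>2) * exp (- (1 / real (Suc n)) * x\<^sup>2) * norm (extension_op h t x) ^ 4) \<partial>?L2)
      \<le> ?A * (\<integral>\<^sup>+\<xi>. ennreal ((norm (h \<xi>))\<^sup>2) \<partial>freq_measure)\<^sup>2" for n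
      by (rule reg) simp
  qed
qed

section \<open>The refined Strichartz estimate\<close>

text \<open>With \<open>\<phi>\<close> and \<open>t \<phi>\<close> bounded, \<open>(1 + t\<^sup>2) \<phi>\<^sup>4 = \<phi>\<^sup>4 + \<phi>\<^sup>2 (t \<phi>)\<^sup>2\<close> is bounded.\<close>

lemma schwartz_quartic_le_int_weight:
  assumes "schwartz \<phi>"
  obtains B where "0 < B" "\<And>t. (\<phi> t) ^ 4 \<le> B * int_weight \<lfloor>t\<rfloor>"
proof -
  have "bounded (range (\<lambda>x. x ^ k * (deriv ^^ n) \<phi> x))" for k n
    using assms by (simp add: schwartz_def)
  from this[of 0 0] this[of 1 0] obtain B0 B1 where
    B0: "\<And>t. \<bar>\<phi> t\<bar> \<le> B0" and B1: "\<And>t. \<bar>t * \<phi> t\<bar> \<le> B1"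
    unfolding bounded_iff by auto
  show thesis
  proof
    have "0 \<le> B0" "0 \<le> B1" using B0[of 0] B1[of 0] by auto
    then show "0 < 3 * B0 ^ 4 + 2 * (B0\<^sup>2 * B1\<^sup>2) + 1" by (simp add: add_nonneg_pos)
    fix t
    have p2: "(\<phi> t)\<^sup>2 \<le> B0\<^sup>2" using power_mono[OF B0[of t], of 2] by simp
    have p4: "(\<phi> t) ^ 4 \<le> B0 ^ 4" using power_mono[OF B0[of t], of 4] by (simp add: power_even_abs)
    have q2: "(t * \<phi> t)\<^sup>2 \<le> B1\<^sup>2" using power_mono[OF B1[of t], of 2] by simp
    have "\<bar>of_int \<lfloor>t\<rfloor>\<bar> \<le> \<bar>t\<bar> + 1" by linarith
    then have "\<bar>of_int \<lfloor>t\<rfloor>\<bar>\<^sup>2 \<le> (\<bar>t\<bar> + 1)\<^sup>2" by (intro power_mono) auto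
    also have "\<dots> \<le> 2 * t\<^sup>2 + 2" using sum_squares_bound[of "\<bar>t\<bar>" 1] by (simp add: power2_sum)
    finally have fl: "1 + (of_int \<lfloor>t\<rfloor>)\<^sup>2 \<le> 3 + 2 * t\<^sup>2" by simp
    have "(\<phi> t) ^ 4 * (1 + (of_int \<lfloor>t\<rfloor>)\<^sup>2) \<le> (\<phi> t) ^ 4 * (3 + 2 * t\<^sup>2)"
      using fl by (intro mult_left_mono) auto
    also have "\<dots> = 3 * (\<phi> t) ^ 4 + 2 * ((\<phi> t)\<^sup>2 * (t * \<phi> t)\<^sup>2)"
      by (simp add: power2_eq_square power4_eq_xxxx algebra_simps)
    also have "\<dots> \<le> 3 * B0 ^ 4 + 2 * (B0\<^sup>2 * B1\<^sup>2)"
      using p2 p4 q2 by (intro add_mono mult_left_mono mult_mono) auto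
    finally have "(\<phi> t) ^ 4 * (1 + (of_int \<lfloor>t\<rfloor>)\<^sup>2) \<le> 3 * B0 ^ 4 + 2 * (B0\<^sup>2 * B1\<^sup>2) + 1" by simp
    then show "(\<phi> t) ^ 4 \<le> (3 * B0 ^ 4 + 2 * (B0\<^sup>2 * B1\<^sup>2) + 1) * int_weight \<lfloor>t\<rfloor>"
      by (simp add: int_weight_def pos_le_divide_eq add_pos_nonneg)
  qed
qed

lemma freq_region_measurable [measurable]: "freq_region M N a c \<xi>0 \<in> sets freq_measure"
proof -
  have "freq_region M N a c \<xi>0 = {\<xi> \<in> space freq_measure.
    sqrt ((fst \<xi> - fst \<xi>0)\<^sup>2 + (of_int (snd \<xi>) - of_int (snd \<xi>0))\<^sup>2) \<le> N \<and> \<bar>fst a * fst \<xi> + snd a * of_int (snd \<xi>) - c\<bar> \<le> M}"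
    by (auto simp: freq_region_def freq_vec_def norm_prod_def inner_prod_def)
  also have "\<dots> \<in> sets freq_measure" by measurable
  finally show ?thesis .
qed

lemma emeasure_freq_region_finite:
  assumes "0 \<le> N"
  shows "emeasure freq_measure (freq_region M N a c \<xi>0) < \<infinity>"
proof -
  interpret pair_sigma_finite lborel "count_space (UNIV :: int set)" by (rule pair_sigma_finite_freq)
  define A where "A = {fst \<xi>0 - N..fst \<xi>0 + N}"
  define B where "B = {n::int. \<bar>of_int n - of_int (snd \<xi>0)\<bar> \<le> N}"
  have B: "finite B" unfolding B_def by (rule card_ints_ball_le(1)[OF assms])
  have "freq_region M N a c \<xi>0 \<subseteq> A \<times> B"
  proof
    fix \<xi> assume \<xi>: "\<xi> \<in> freq_region M N a c \<xi>0"
    have n: "norm (fst \<xi> - fst \<xi>0, real_of_int (snd \<xi>) - of_int (snd \<xi>0)) \<le> N"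
      using \<xi> by (simp add: freq_region_def freq_vec_def)
    have "\<bar>fst \<xi> - fst \<xi>0\<bar> \<le> N"
      using norm_fst_le[of "fst \<xi> - fst \<xi>0" "real_of_int (snd \<xi>) - of_int (snd \<xi>0)"] n by simp
    moreover have "\<bar>real_of_int (snd \<xi>) - of_int (snd \<xi>0)\<bar> \<le> N"
      using norm_snd_le[of "real_of_int (snd \<xi>) - of_int (snd \<xi>0)" "fst \<xi> - fst \<xi>0"] n by simp
    ultimately show "\<xi> \<in> A \<times> B" by (auto simp: A_def B_def mem_Times_iff)
  qed
  then have "emeasure freq_measure (freq_region M N a c \<xi>0) \<le> emeasure freq_measure (A \<times> B)"
    by (rule emeasure_mono) (simp add: freq_measure_def A_def)
  also have "\<dots> = emeasure lborel A * emeasure (count_space UNIV) B"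
    unfolding freq_measure_def by (rule M2.emeasure_pair_measure_Times) (auto simp: A_def)
  also have "\<dots> < \<infinity>" using B assms by (simp add: A_def emeasure_count_space_finite ennreal_mult_less_top ennreal_of_nat_eq_real_of_nat)
  finally show ?thesis .
qed

text \<open>The fourth power of the cut-off is at most \<open>B e\<close> times the sum over the integers \<open>j\<close> of
\<open>(1 + j\<^sup>2)\<^bsup>-1\<^esup> exp (- (t - j)\<^sup>2)\<close>: at \<open>j = \<lfloor>t\<rfloor>\<close> the Gaussian is at least \<open>1/e\<close>.\<close>

lemma extension_op_cutoff_L4:
  fixes \<phi> :: "real \<Rightarrow> real" and K :: ennreal
  assumes B: "0 < B" "\<And>t. (\<phi> t) ^ 4 \<le> B * int_weight \<lfloor>t\<rfloor>"
    and h: "integrable freq_measure h" and S: "S \<in> sets freq_measure" and hS: "\<And>\<xi>. \<xi> \<notin> S \<Longrightarrow> h \<xi> = 0"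
    and K: "\<And>W \<eta>. (\<integral>\<^sup>+p. (\<integral>\<^sup>+m. emeasure lborel (pair_slice S W \<eta> p m) \<partial>count_space UNIV) \<partial>count_space UNIV) \<le> K"
  defines "\<sigma> \<equiv> (\<integral>\<^sup>+j. ennreal (int_weight j) \<partial>count_space UNIV)"
  shows "(\<integral>\<^sup>+(t, x). ennreal (norm (of_real (\<phi> t) * extension_op h t x) ^ 4) \<partial>(lborel \<Otimes>\<^sub>M lborel))
    \<le> ennreal (B * exp 1) * \<sigma> * (ennreal (sqrt pi) * (ennreal (2 * pi) * (8 * \<sigma> * K))
       * (\<integral>\<^sup>+\<xi>. ennreal ((norm (h \<xi>))\<^sup>2) \<partial>freq_measure)\<^sup>2)"
    (is "_ \<le> _ * ?X")
proof -
  let ?L2 = "(lborel :: real measure) \<Otimes>\<^sub>M (lborel :: real measure)"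
  define T where "T t x = norm (extension_op h t x) ^ 4" for t x
  have T_meas [measurable]: "(\<lambda>z. T (fst z) (snd z)) \<in> borel_measurable ?L2"
    using extension_op_measurable[of h] h unfolding T_def by (simp add: case_prod_beta')
  define c where "c j = ennreal (B * exp 1 * int_weight j)" for j
  define G where "G j z = ennreal (exp (- (fst z - of_int j)\<^sup>2) * T (fst z) (snd z))" for j :: int and z :: "real \<times> real"
  have sfL: "sigma_finite_measure ((lborel :: real measure) \<Otimes>\<^sub>M (lborel :: real measure))"
    unfolding lborel_prod ..
  have psf: "pair_sigma_finite ((lborel :: real measure) \<Otimes>\<^sub>M (lborel :: real measure)) (count_space (UNIV :: int set))"
    using sfL by (intro pair_sigma_finite.intro sigma_finite_measure_count_space)
  have pt: "ennreal (norm (of_real (\<phi> t) * extension_op h t x) ^ 4) \<le> (\<integral>\<^sup>+j. c j * G j (t, x) \<partial>count_space UNIV)" for t x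
  proof -
    define j where "j = \<lfloor>t\<rfloor>"
    have "0 \<le> t - of_int j" "t - of_int j \<le> 1" unfolding j_def by linarith+
    then have "(t - of_int j)\<^sup>2 \<le> 1" by (simp add: power_le_one)
    then have e: "1 \<le> exp 1 * exp (- (t - of_int j)\<^sup>2)" by (simp flip: exp_add)
    have "norm (of_real (\<phi> t) * extension_op h t x) ^ 4 = (\<phi> t) ^ 4 * T t x"
      by (simp add: norm_mult power_mult_distrib T_def power_even_abs)
    also have "\<dots> \<le> (B * int_weight j) * (exp 1 * exp (- (t - of_int j)\<^sup>2)) * T t x"
    proof -
      have "(\<phi> t) ^ 4 * 1 \<le> (B * int_weight j) * (exp 1 * exp (- (t - of_int j)\<^sup>2))"
        using B e unfolding j_def by (intro mult_mono) auto
      then show ?thesis by (intro mult_right_mono) (auto simp: T_def)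
    qed
    finally have "ennreal (norm (of_real (\<phi> t) * extension_op h t x) ^ 4) \<le> ennreal (B * exp 1 * int_weight j * (exp (- (t - of_int j)\<^sup>2) * T t x))"
      by (intro ennreal_leI) (simp add: mult_ac)
    also have "\<dots> = c j * G j (t, x)" using B by (simp add: c_def G_def ennreal_mult')
    also have "\<dots> \<le> (\<integral>\<^sup>+j. c j * G j (t, x) \<partial>count_space UNIV)"
      using sum_le_nn_integral_count_space[of "{j}" "\<lambda>j. c j * G j (t, x)"] by simp
    finally show ?thesis .
  qed
  have cG_meas: "(\<lambda>(z, j). c j * G j z) \<in> borel_measurable (?L2 \<Otimes>\<^sub>M count_space UNIV)"
  proof -
    have [measurable]: "(\<lambda>x. c (snd x)) \<in> borel_measurable (?L2 \<Otimes>\<^sub>M count_space UNIV)"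
      "(\<lambda>x. real_of_int (snd x)) \<in> borel_measurable (?L2 \<Otimes>\<^sub>M count_space UNIV)"
      by (rule measurable_compose[OF measurable_snd], simp)+
    have [measurable]: "(\<lambda>x. T (fst (fst x)) (snd (fst x))) \<in> borel_measurable (?L2 \<Otimes>\<^sub>M count_space UNIV)"
      by (rule measurable_compose[OF measurable_fst T_meas])
    show ?thesis unfolding G_def case_prod_beta' by measurable
  qed
  have G_meas: "G j \<in> borel_measurable ?L2" for j unfolding G_def[abs_def] by measurable
  have "(\<integral>\<^sup>+(t, x). ennreal (norm (of_real (\<phi> t) * extension_op h t x) ^ 4) \<partial>?L2)
    \<le> (\<integral>\<^sup>+z. \<integral>\<^sup>+j. c j * G j z \<partial>count_space UNIV \<partial>?L2)"
    by (rule nn_integral_mono) (use pt in auto)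
  also have "\<dots> = (\<integral>\<^sup>+j. \<integral>\<^sup>+z. c j * G j z \<partial>?L2 \<partial>count_space UNIV)"
    by (rule pair_sigma_finite.Fubini'[OF psf cG_meas, symmetric])
  also have "\<dots> = (\<integral>\<^sup>+j. c j * (\<integral>\<^sup>+z. G j z \<partial>?L2) \<partial>count_space UNIV)"
    by (rule nn_integral_cong, rule nn_integral_cmult[OF G_meas])
  also have "\<dots> \<le> (\<integral>\<^sup>+j. c j * ?X \<partial>count_space UNIV)"
  proof (rule nn_integral_mono)
    fix j
    have "(\<integral>\<^sup>+z. G j z \<partial>?L2) \<le> ?X"
      using extension_op_gauss_L4[OF h S hS K, of "of_int j"] unfolding G_def T_def \<sigma>_def by (simp add: case_prod_beta')
    then show "c j * (\<integral>\<^sup>+z. G j z \<partial>?L2) \<le> c j * ?X" by (rule mult_left_mono) simp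
  qed
  also have "\<dots> = (\<integral>\<^sup>+j. c j \<partial>count_space UNIV) * ?X" by (rule nn_integral_multc) simp
  also have "(\<integral>\<^sup>+j. c j \<partial>count_space UNIV) = (\<integral>\<^sup>+j. ennreal (B * exp 1) * ennreal (int_weight j) \<partial>count_space UNIV)"
    unfolding c_def using B by (intro nn_integral_cong ennreal_mult) auto
  also have "\<dots> = ennreal (B * exp 1) * \<sigma>" unfolding \<sigma>_def by (rule nn_integral_cmult) simp
  finally show ?thesis .
qed

theorem theorem1p2:
  fixes \<phi> :: "real \<Rightarrow> real" and \<delta> :: real
  assumes "schwartz \<phi>"
    and "\<And>\<tau>. fourier_real \<phi> \<tau> \<in> \<real>\<^sub>\<ge>\<^sub>0"
    and "closure {\<tau>. fourier_real \<phi> \<tau> \<noteq> 0} \<subseteq> {-1..1}"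
    and "\<And>t. 0 \<le> \<phi> t"
    and "\<And>t. t \<in> {0..1} \<Longrightarrow> 1 \<le> \<phi> t"
    and "0 < \<delta>" and "\<delta> < 1 / 8"
  shows "\<exists>C>0. \<forall>(M::real) (N::real) (a :: real \<times> real) (c::real) (\<xi>0 :: real \<times> int)
           (f :: real \<times> real \<Rightarrow> complex) (g :: real \<times> int \<Rightarrow> complex).
           1 \<le> M \<and> M \<le> N \<and> norm a = 1 \<and>
           in_Lp_cyl 2 f \<and> is_fourier_L2 f g \<and>
           ess_supp freq_measure g \<subseteq> freq_region M N a c \<xi>0 \<longrightarrow>
           in_Lp 4 (lborel \<Otimes>\<^sub>M lborel) (\<lambda>(t, x1). of_real (\<phi> t) * extension_op g t x1) \<and>
           Lp_norm 4 (lborel \<Otimes>\<^sub>M lborel) (\<lambda>(t, x1). of_real (\<phi> t) * extension_op g t x1)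
             \<le> C * (M / N) powr \<delta> * N powr (1 / 4) * Lp_norm 2 cyl_measure f"
proof -
  obtain B where B: "0 < B" "\<And>t. (\<phi> t) ^ 4 \<le> B * int_weight \<lfloor>t\<rfloor>"
    using schwartz_quartic_le_int_weight[OF assms(1)] by blast
  obtain C0 where C0: "C0 > 0" "\<And>M N a c \<xi>0 W \<eta>. 1 \<le> M \<Longrightarrow> M \<le> N \<Longrightarrow> norm a = 1 \<Longrightarrow>
      (\<integral>\<^sup>+p. (\<integral>\<^sup>+m. emeasure lborel (pair_slice (freq_region M N a c \<xi>0) W \<eta> p m) \<partial>count_space UNIV) \<partial>count_space UNIV)
        \<le> ennreal (C0 * ((M / N) powr (4 * \<delta>) * N))"
    using freq_region_pair_count[OF assms(6,7)] by blast
  define s where "s = enn2real (\<integral>\<^sup>+j. ennreal (int_weight j) \<partial>count_space UNIV)"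
  have s: "0 \<le> s" "(\<integral>\<^sup>+j. ennreal (int_weight j) \<partial>count_space UNIV) = ennreal s"
    using nn_integral_int_weight_finite by (simp_all add: s_def less_top)
  \<comment> \<open>The factor \<open>16\<close> is the square of the constant in \<open>fourier_L2_norm_le\<close>.\<close>
  define D where "D = B * exp 1 * s * (sqrt pi * (2 * pi * (8 * s * C0)) * 16)"
  have D: "0 \<le> D" using B s C0 by (simp add: D_def)
  have \<phi>_meas [measurable]: "\<phi> \<in> borel_measurable borel"
  proof -
    have "(deriv ^^ 0) \<phi> differentiable (at x)" for x using assms(1) unfolding schwartz_def by blast
    then have "continuous_on UNIV \<phi>" by (simp add: continuous_at_imp_continuous_on differentiable_imp_continuous_within)
    then show ?thesis by (rule borel_measurable_continuous_onI)
  qed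
  show ?thesis
  proof (intro exI[of _ "(D + 1) powr (1 / 4)"] conjI allI impI)
    show "0 < (D + 1) powr (1 / 4)" using D by simp
    fix M N c :: real and a :: "real \<times> real" and \<xi>0 :: "real \<times> int" and f :: "real \<times> real \<Rightarrow> complex" and g :: "real \<times> int \<Rightarrow> complex"
    assume asm: "1 \<le> M \<and> M \<le> N \<and> norm a = 1 \<and> in_Lp_cyl 2 f \<and> is_fourier_L2 f g \<and> ess_supp freq_measure g \<subseteq> freq_region M N a c \<xi>0"
    define S where "S = freq_region M N a c \<xi>0"
    define R where "R = (M / N) powr (4 * \<delta>) * N"
    define P where "P = Lp_norm 2 cyl_measure f"
    have N: "1 \<le> N" and R: "0 \<le> R" and P: "0 \<le> P" using asm by (auto simp: R_def P_def Lp_norm_def)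
    have S [measurable]: "S \<in> sets freq_measure" unfolding S_def by measurable
    have g2: "in_Lp 2 freq_measure g" using asm by (simp add: is_fourier_L2_def)
    then have g_meas [measurable]: "g \<in> borel_measurable freq_measure" and g_int: "integrable freq_measure (\<lambda>\<xi>. norm (g \<xi>) powr 2)"
      by (auto simp: in_Lp_def)
    define h where "h \<xi> = indicator S \<xi> * g \<xi>" for \<xi>
    have h_meas [measurable]: "h \<in> borel_measurable freq_measure" unfolding h_def[abs_def] by measurable
    have hS: "h \<xi> = 0" if "\<xi> \<notin> S" for \<xi> using that by (simp add: h_def)
    have "AE \<xi> in freq_measure. g \<xi> = h \<xi>"
      using AE_eq_0_off_ess_supp[of g] by eventually_elim (use asm in \<open>auto simp: h_def S_def indicator_def\<close>)
    then have gh: "extension_op g t x = extension_op h t x" for t x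
    proof -
      have eq: "(norm (freq_vec \<xi>))\<^sup>2 = (fst \<xi>)\<^sup>2 + (of_int (snd \<xi>))\<^sup>2" for \<xi>
        using norm_freq_vec_squared[of "fst \<xi>" "snd \<xi>"] by simp
      show ?thesis
        unfolding extension_op_def eq
      proof (rule integral_cong_AE)
        show "AE \<xi> in freq_measure.
            exp (\<i> * of_real (x * fst \<xi>) - \<i> * of_real (t * ((fst \<xi>)\<^sup>2 + (of_int (snd \<xi>))\<^sup>2))) * g \<xi> =
            exp (\<i> * of_real (x * fst \<xi>) - \<i> * of_real (t * ((fst \<xi>)\<^sup>2 + (of_int (snd \<xi>))\<^sup>2))) * h \<xi>"
          using \<open>AE \<xi> in freq_measure. g \<xi> = h \<xi>\<close> by eventually_elim simp
      qed measurable
    qed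
    have h_int: "integrable freq_measure h"
    proof (rule Bochner_Integration.integrable_bound)
      have "integrable freq_measure (indicator S :: _ \<Rightarrow> real)"
        using emeasure_freq_region_finite[of N M a c \<xi>0] N by (intro integrable_real_indicator) (auto simp: S_def)
      then show "integrable freq_measure (\<lambda>\<xi>. indicator S \<xi> + norm (g \<xi>) powr 2)"
        using g_int by (rule Bochner_Integration.integrable_add)
      have "norm (h \<xi>) \<le> indicator S \<xi> + (norm (g \<xi>))\<^sup>2" for \<xi>
      proof -
        have "2 * norm (g \<xi>) \<le> (norm (g \<xi>))\<^sup>2 + 1"
          using sum_squares_bound[of "norm (g \<xi>)" 1] by simp
        then have "norm (g \<xi>) \<le> 1 + (norm (g \<xi>))\<^sup>2"
          using norm_ge_zero[of "g \<xi>"] by linarith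
        then show ?thesis by (simp add: h_def indicator_def)
      qed
      then show "AE \<xi> in freq_measure. norm (h \<xi>) \<le> norm (indicator S \<xi> + norm (g \<xi>) powr 2)"
        by (intro AE_I2) (auto intro: order_trans)
    qed measurable
    have h_norm: "(\<integral>\<^sup>+\<xi>. ennreal ((norm (h \<xi>))\<^sup>2) \<partial>freq_measure) \<le> ennreal (4 * P\<^sup>2)"
    proof -
      have "(\<integral>\<^sup>+\<xi>. ennreal ((norm (h \<xi>))\<^sup>2) \<partial>freq_measure) \<le> (\<integral>\<^sup>+\<xi>. ennreal ((norm (g \<xi>))\<^sup>2) \<partial>freq_measure)"
        by (intro nn_integral_mono ennreal_leI) (simp add: h_def indicator_def)
      also have "\<dots> = ennreal ((Lp_norm 2 freq_measure g)\<^sup>2)" by (rule nn_integral_square_eq_Lp_norm[OF g_int])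
      also have "\<dots> \<le> ennreal (4 * P\<^sup>2)" using fourier_L2_norm_le[of f g] asm by (intro ennreal_leI) (simp add: P_def)
      finally show ?thesis .
    qed
    define u where "u = (\<lambda>(t, x1). of_real (\<phi> t) * extension_op g t x1)"
    have u_meas [measurable]: "u \<in> borel_measurable (lborel \<Otimes>\<^sub>M lborel)"
    proof -
      note [measurable] = extension_op_measurable[OF g_meas, unfolded case_prod_beta']
      show ?thesis unfolding u_def case_prod_beta' by measurable
    qed
    have "(\<integral>\<^sup>+z. ennreal (norm (u z) ^ 4) \<partial>(lborel \<Otimes>\<^sub>M lborel))
      \<le> ennreal (B * exp 1) * ennreal s * (ennreal (sqrt pi) * (ennreal (2 * pi) * (8 * ennreal s * ennreal (C0 * R)))
       * (\<integral>\<^sup>+\<xi>. ennreal ((norm (h \<xi>))\<^sup>2) \<partial>freq_measure)\<^sup>2)"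
      using extension_op_cutoff_L4[OF B h_int S hS, of "ennreal (C0 * R)"] C0(2)[of M N a c \<xi>0] asm
      by (simp add: u_def gh case_prod_beta' s(2) S_def R_def)
    also have "\<dots> \<le> ennreal (B * exp 1) * ennreal s * (ennreal (sqrt pi) * (ennreal (2 * pi) * (8 * ennreal s * ennreal (C0 * R)))
       * (ennreal (4 * P\<^sup>2))\<^sup>2)"
      by (intro mult_left_mono power_mono h_norm) auto
    also have "\<dots> = ennreal (D * R * P ^ 4)"
    proof -
      have "ennreal (B * exp 1) * ennreal s * (ennreal (sqrt pi) * (ennreal (2 * pi) * (ennreal 8 * ennreal s * ennreal (C0 * R)))
       * (ennreal (4 * P\<^sup>2))\<^sup>2) = ennreal (B * exp 1 * s * (sqrt pi * (2 * pi * (8 * s * (C0 * R))) * (4 * P\<^sup>2)\<^sup>2))"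
        using B s C0 R by (simp only: ennreal_mult'[symmetric] ennreal_power) (simp add: ennreal_mult''[symmetric] ennreal_power)
      also have "B * exp 1 * s * (sqrt pi * (2 * pi * (8 * s * (C0 * R))) * (4 * P\<^sup>2)\<^sup>2) = D * R * P ^ 4"
        by (simp add: D_def power2_eq_square power4_eq_xxxx)
      finally show ?thesis by simp
    qed
    finally have bound: "(\<integral>\<^sup>+z. ennreal (norm (u z) ^ 4) \<partial>(lborel \<Otimes>\<^sub>M lborel)) \<le> ennreal (D * R * P ^ 4)" .
    have p4: "(\<lambda>z. norm (u z) powr 4) = (\<lambda>z. norm (u z) ^ 4)" by simp
    have u_int: "integrable (lborel \<Otimes>\<^sub>M lborel) (\<lambda>z. norm (u z) ^ 4)"
    proof (rule integrableI_bounded)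
      show "(\<integral>\<^sup>+z. ennreal (norm (norm (u z) ^ 4)) \<partial>(lborel \<Otimes>\<^sub>M lborel)) < \<infinity>"
        using bound by (simp add: le_less_trans)
    qed measurable
    have "in_Lp 4 (lborel \<Otimes>\<^sub>M lborel) u" unfolding in_Lp_def p4 using u_int u_meas by simp
    moreover have "Lp_norm 4 (lborel \<Otimes>\<^sub>M lborel) u \<le> (D + 1) powr (1 / 4) * (M / N) powr \<delta> * N powr (1 / 4) * P"
    proof -
      have "ennreal (LINT z|(lborel \<Otimes>\<^sub>M lborel). norm (u z) ^ 4) \<le> ennreal (D * R * P ^ 4)"
        using bound nn_integral_eq_integral[OF u_int] by simp
      then have "(LINT z|(lborel \<Otimes>\<^sub>M lborel). norm (u z) ^ 4) \<le> D * R * P ^ 4"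
        using D R P by (subst (asm) ennreal_le_iff) auto
      also have "\<dots> \<le> (D + 1) * R * P ^ 4" using R P by (intro mult_right_mono) auto
      finally have "Lp_norm 4 (lborel \<Otimes>\<^sub>M lborel) u \<le> ((D + 1) * R * P ^ 4) powr (1 / 4)"
        unfolding Lp_norm_def p4 by (intro powr_mono2) auto
      also have "\<dots> = (D + 1) powr (1 / 4) * ((M / N) powr (4 * \<delta>)) powr (1 / 4) * N powr (1 / 4) * (P ^ 4) powr (1 / 4)"
        using D N P asm by (simp add: R_def powr_mult)
      also have "((M / N) powr (4 * \<delta>)) powr (1 / 4) = (M / N) powr \<delta>" by (simp add: powr_powr)
      also have "(P ^ 4) powr (1 / 4) = P"
      proof (cases "P = 0")
        case False
        then have "P ^ 4 = P powr 4" using P by simp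
        then show ?thesis using False P by (simp only: powr_powr) simp
      qed simp
      finally show ?thesis .
    qed
    ultimately show "in_Lp 4 (lborel \<Otimes>\<^sub>M lborel) (\<lambda>(t, x1). of_real (\<phi> t) * extension_op g t x1)"
      "Lp_norm 4 (lborel \<Otimes>\<^sub>M lborel) (\<lambda>(t, x1). of_real (\<phi> t) * extension_op g t x1)
        \<le> (D + 1) powr (1 / 4) * (M / N) powr \<delta> * N powr (1 / 4) * Lp_norm 2 cyl_measure f"
      unfolding u_def P_def by blast+
  qed
qed

end
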